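(* Let $\alpha=-1$ and $\kappa>0$. Let $z^0=(u^0,\rho^0)\in H^s(\mathbb S)\times H^{s-1}(\mathbb S)$, $s>\frac52$, be such that either $\rho^0(x)>0$ for all $x\in\mathbb S$, or $\rho^0(x)<0$ for all $x\in\mathbb S$. Let $T\in(0,\infty)$ be the existence time of the solution $z=(u,\rho)$ of the generalized two-component Hunter–Saxton system with initial datum $z^0$. Then $\|z(t,\cdot)\|_{H^s\times H^{s-1}}$ is bounded on $[0,T)$.
   Context: $\mathbb S=\mathbb R/\mathbb Z$; $H^r(\mathbb S)$ are the $L^2$-based Sobolev spaces. For $(\alpha,\kappa)\in\mathbb R\times\mathbb R$, the generalized two-component Hunter–Saxton system is $$u_{txx}+(1-\alpha)u_xu_{xx}+uu_{xxx}-\kappa\rho\rho_x=0,\qquad \rho_t+u\rho_x=\alpha u_x\rho,\qquad t>0,\ x\in\mathbb R,$$ with $u(t,x+1)=u(t,x)$, $\rho(t,x+1)=\rho(t,x)$, $u(0,x)=u^0(x)$, $\rho(0,x)=\rho^0(x)$. Integrating the first equation twice in space gives $$u_t+uu_x=\partial_x^{-1}\Big(\tfrac{\kappa}{2}\rho^2+\tfrac{\alpha+2}{2}u_x^2+a(t)\Big)+h(t),\qquad \partial_x^{-1}f(x)=\int_0^x f(y)\,dy,$$ with $a(t)=-\frac{\kappa}{2}\int_{\mathbb S}\rho^2dx-\frac{\alpha+2}{2}\int_{\mathbb S}u_x^2dx$ and $h:[0,\infty)\to\mathbb R$ an arbitrary continuous function, which is fixed once and for all (e.g. $h\equiv0$);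 "the solution" means the solution of this integrated equation together with the $\rho$-equation. For $z^0\in H^s\times H^{s-1}$, $s\ge2$, the solution is of class $C([0,T);H^s\times H^{s-1})\cap C^1([0,T);H^{s-1}\times H^{s-2})$. $T$ denotes any finite existence time: the solution is defined in this class on $[0,T)$. *)

theory Defs
  imports "HOL-Analysis.Analysis"
begin

text \<open>Functions on the circle are rendered as \<open>1\<close>-periodic functions on the real line.\<close>

definition fourier_coeff :: "(real \<Rightarrow> real) \<Rightarrow> int \<Rightarrow> complex" where
  "fourier_coeff f k =
     (LINT x:{0..1}|lborel. complex_of_real (f x) * cis (- 2 * pi * of_int k * x))"

definition L2_circle :: "(real \<Rightarrow> real) set" where
  "L2_circle = {f. (\<forall>x. f (x + 1) = f x) \<and> f \<in> borel_measurable borel \<and>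
                   set_integrable lborel {0..1} (\<lambda>x. (f x)\<^sup>2)}"

text \<open>For \<open>r \<ge> 0\<close> this is the Sobolev space \<open>H\<^sup>r\<close> of the circle; for \<open>r < 0\<close>, where
  distributions would be needed, it is not. The weight is the symbol of \<open>(1 - \<partial>\<^sub>x\<^sup>2)\<^sup>r\<close>.\<close>

definition sobolev_weight :: "real \<Rightarrow> int \<Rightarrow> real" where
  "sobolev_weight r k = (1 + (2 * pi * of_int k)\<^sup>2) powr r"

definition sobolev :: "real \<Rightarrow> (real \<Rightarrow> real) set" where
  "sobolev r = {f \<in> L2_circle.
     (\<lambda>k. sobolev_weight r k * (cmod (fourier_coeff f k))\<^sup>2) summable_on UNIV}"

definition sobolev_norm :: "real \<Rightarrow> (real \<Rightarrow> real) \<Rightarrow> real" where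
  "sobolev_norm r f =
     sqrt (\<Sum>\<^sub>\<infinity>k\<in>UNIV. sobolev_weight r k * (cmod (fourier_coeff f k))\<^sup>2)"

text \<open>For \<open>r > 1/2\<close> every class modulo null sets in \<open>H\<^sup>r\<close> contains exactly one continuous
  function, and \<open>H\<^sup>r\<close> is identified with the space of these representatives, so that pointwise
  statements make sense. For \<open>s > 5/2\<close> this applies to \<open>r = s, s - 1, s - 2\<close>.\<close>

definition sobolev_cont :: "real \<Rightarrow> (real \<Rightarrow> real) set" where
  "sobolev_cont r = {f \<in> sobolev r. continuous_on UNIV f}"

text \<open>\<open>C(I; H\<^sup>r)\<close> and \<open>C\<^sup>1(I; H\<^sup>r)\<close> for \<open>r > 1/2\<close>, the latter with the derivative \<open>v'\<close> exhibited;
  limits are with respect to the \<open>H\<^sup>r\<close> norm, and one-sided at an endpoint belonging to \<open>I\<close>.\<close>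

definition sobolev_C0 :: "real \<Rightarrow> real set \<Rightarrow> (real \<Rightarrow> real \<Rightarrow> real) \<Rightarrow> bool" where
  "sobolev_C0 r I v \<longleftrightarrow>
     (\<forall>t\<in>I. v t \<in> sobolev_cont r) \<and>
     (\<forall>t\<in>I. ((\<lambda>\<tau>. sobolev_norm r (\<lambda>x. v \<tau> x - v t x)) \<longlongrightarrow> 0) (at t within I))"

definition sobolev_C1 ::
    "real \<Rightarrow> real set \<Rightarrow> (real \<Rightarrow> real \<Rightarrow> real) \<Rightarrow> (real \<Rightarrow> real \<Rightarrow> real) \<Rightarrow> bool" where
  "sobolev_C1 r I v v' \<longleftrightarrow>
     sobolev_C0 r I v \<and> sobolev_C0 r I v' \<and>
     (\<forall>t\<in>I. ((\<lambda>\<tau>. sobolev_norm r (\<lambda>x. (v \<tau> x - v t x) / (\<tau> - t) - v' t x)) \<longlongrightarrow> 0)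
              (at t within I))"

definition sobolev_pair_norm :: "real \<Rightarrow> (real \<Rightarrow> real) \<Rightarrow> (real \<Rightarrow> real) \<Rightarrow> real" where
  "sobolev_pair_norm s f g = sqrt ((sobolev_norm s f)\<^sup>2 + (sobolev_norm (s - 1) g)\<^sup>2)"

text \<open>The interval integral is oriented, so \<open>x < 0\<close> is covered as well.\<close>

definition dx_inv :: "(real \<Rightarrow> real) \<Rightarrow> real \<Rightarrow> real" where
  "dx_inv f x = (LBINT y=0..x. f y)"

definition gHS_mean :: "real \<Rightarrow> real \<Rightarrow> (real \<Rightarrow> real) \<Rightarrow> (real \<Rightarrow> real) \<Rightarrow> real" where
  "gHS_mean \<alpha> \<kappa> v \<sigma> =
     - (\<kappa> / 2) * (LINT x:{0..1}|lborel. (\<sigma> x)\<^sup>2)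
     - ((\<alpha> + 2) / 2) * (LINT x:{0..1}|lborel. (deriv v x)\<^sup>2)"

text \<open>Solutions on \<open>[0, T)\<close> of the integrated system with initial datum \<open>(u0, \<rho>0)\<close>. For
  \<open>s > 5/2\<close> the functions \<open>u t\<close> and \<open>\<rho> t\<close> are \<open>C\<^sup>1\<close>, hence \<open>deriv\<close> is the classical spatial
  derivative.\<close>

definition gHS_solution ::
    "real \<Rightarrow> real \<Rightarrow> (real \<Rightarrow> real) \<Rightarrow> real \<Rightarrow> real \<Rightarrow> (real \<Rightarrow> real) \<Rightarrow> (real \<Rightarrow> real) \<Rightarrow>
     (real \<Rightarrow> real \<Rightarrow> real) \<Rightarrow> (real \<Rightarrow> real \<Rightarrow> real) \<Rightarrow> bool" where
  "gHS_solution \<alpha> \<kappa> h s T u0 \<rho>0 u \<rho> \<longleftrightarrow>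
     sobolev_C0 s {0..<T} u \<and> sobolev_C0 (s - 1) {0..<T} \<rho> \<and>
     u 0 = u0 \<and> \<rho> 0 = \<rho>0 \<and>
     (\<exists>u' \<rho>'. sobolev_C1 (s - 1) {0..<T} u u' \<and> sobolev_C1 (s - 2) {0..<T} \<rho> \<rho>' \<and>
        (\<forall>t\<in>{0<..<T}. \<forall>x.
           u' t x + u t x * deriv (u t) x =
             dx_inv (\<lambda>y. \<kappa> / 2 * (\<rho> t y)\<^sup>2 + (\<alpha> + 2) / 2 * (deriv (u t) y)\<^sup>2
                         + gHS_mean \<alpha> \<kappa> (u t) (\<rho> t)) x + h t \<and>
           \<rho>' t x + u t x * deriv (\<rho> t) x = \<alpha> * deriv (u t) x * \<rho> t x))"

end

theory Submission
  imports Defs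
begin

text \<open>The proof works with \<open>w = \<partial>\<^sub>x u\<close>. For \<open>\<alpha> = -1\<close>, differentiating the integrated equation in space gives a
system in which \<open>w\<close> and \<open>\<rho>\<close> have the same order, namely
\<open>w\<^sub>t + u w\<^sub>x = \<kappa>/2 \<rho>\<^sup>2 - w\<^sup>2/2 + a\<close> and \<open>\<rho>\<^sub>t + u \<rho>\<^sub>x = - w \<rho>\<close>. Here \<open>a = -E/2\<close>, where the energy
\<open>E = \<integral> w\<^sup>2 + \<kappa> \<rho>\<^sup>2\<close> is conserved (\<open>energy_const\<close>). Write \<open>D = \<partial>\<^sub>t + u \<partial>\<^sub>x\<close> for the derivative along the
flow. In terms of \<open>z = w + i \<surd>\<kappa> \<rho>\<close> the system is the Riccati equation \<open>D z = - z\<^sup>2/2 + a\<close>, and this is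
the reason for two exact identities.

First, \<open>H = \<kappa> \<rho>\<^sup>2 + E + w\<^sup>2\<close> satisfies \<open>D H = - w H\<close>, the same equation as \<open>\<rho>\<close>. So \<open>H / \<rho>\<close> is
transported, and \<open>H / |\<rho>|\<close> stays below its initial maximum \<open>K\<close>, which is finite because \<open>\<rho>\<close> has no zero
at time \<open>0\<close>. From \<open>\<kappa> \<rho>\<^sup>2 \<le> H \<le> K |\<rho>|\<close> and \<open>w\<^sup>2 \<le> H\<close> one reads off uniform bounds on \<open>\<rho>\<close> and \<open>w\<close>
(\<open>amplitude_bound\<close>). Secondly, the difference of two solutions of a Riccati equation solves a linear
equation, so \<open>|z(x) - z(y)|\<^sup>2\<close> grows at most exponentially along pairs of trajectories; compared with
\<open>|x - y|\<^sup>2\<close> this bounds the Lipschitz constants of \<open>w\<close> and \<open>\<rho>\<close> on \<open>[0, T)\<close> (\<open>gradient_bound\<close>). Both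
arguments are applications of the maximum principle \<open>transport_max_principle\<close>.

The Lipschitz bound controls the \<open>H\<^sup>1\<close> norms, hence the sums of the absolute values of the Fourier
coefficients, of \<open>w\<close> and \<open>\<rho>\<close> (\<open>wiener_bound\<close>). These sums are the only low norms that enter the energy
estimate at the regularity \<open>r = s - 1\<close>: the time derivative of \<open>\<Sum> \<langle>k\<rangle>\<^sup>2\<^sup>r (|w\<^sub>k|\<^sup>2 + \<kappa> |\<rho>\<^sub>k|\<^sup>2)\<close>, with
\<open>w\<^sub>k\<close> and \<open>\<rho>\<^sub>k\<close> the Fourier coefficients, is at most a constant times the sum itself. The loss of a
derivative in \<open>u \<partial>\<^sub>x\<close> is removed by symmetrising the convolution sum (\<open>transport_estimate\<close>), and the
quadratic terms are harmless (\<open>product_estimate\<close>). Since \<open>s > 5/2\<close>, all functions that occur have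
absolutely summable Fourier coefficients, so that products are convolutions and the estimates are
estimates of sequences. The weight is truncated by a Lipschitz cutoff; then the sums are finite and
differentiable in time, and the cutoff is removed after integrating. Gronwall's inequality gives the
bound, the mean of \<open>u\<close>, which \<open>w\<close> does not see, being controlled directly
(\<open>mean_velocity_bounded\<close>).\<close>

section \<open>Periodic functions\<close>

lemma periodic_of_int:
  fixes f :: "real \<Rightarrow> 'a"
  assumes "\<And>x. f (x + 1) = f x"
  shows "f (x + of_int n) = f x"
proof -
  have pern: "f (x + of_nat n) = f x" for x n
    by (induction n) (use assms[of "x + of_nat n" for n] in \<open>auto simp: algebra_simps\<close>)
  show ?thesis
  proof (cases "n \<ge> 0")
    case True
    then show ?thesis using pern[of x "nat n"] by simp
  next
    case False
    then show ?thesis using pern[of "x + of_int n" "nat (- n)"] by simp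
  qed
qed

lemma periodic_frac:
  fixes f :: "real \<Rightarrow> 'a"
  assumes "\<And>x. f (x + 1) = f x"
  shows "f (frac x) = f x"
  using periodic_of_int[of f "frac x" "\<lfloor>x\<rfloor>", OF assms] by (simp add: frac_def)

lemma frac_in_unit: "frac (x::real) \<in> {0..1}"
  using frac_ge_0[of x] frac_lt_1[of x] by simp

lemma periodic_bounded:
  fixes f :: "real \<Rightarrow> real \<Rightarrow> real"
  assumes c: "continuous_on ({0..\<tau>} \<times> UNIV) (\<lambda>(t, x). f t x)"
    and p: "\<And>t x. t \<in> {0..\<tau>} \<Longrightarrow> f t (x + 1) = f t x"
  obtains B where "0 < B" "\<And>t x. t \<in> {0..\<tau>} \<Longrightarrow> \<bar>f t x\<bar> \<le> B"
proof -
  have "compact ((\<lambda>(t, x). f t x) ` ({0..\<tau>} \<times> {0..1}))"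
    by (intro compact_continuous_image continuous_on_subset[OF c] compact_Times) auto
  then have "bounded ((\<lambda>(t, x). f t x) ` ({0..\<tau>} \<times> {0..1}))" by (rule compact_imp_bounded)
  then obtain B where B: "B > 0" "\<And>y. y \<in> (\<lambda>(t, x). f t x) ` ({0..\<tau>} \<times> {0..1}) \<Longrightarrow> norm y \<le> B"
    unfolding bounded_pos by blast
  have "\<bar>f t x\<bar> \<le> B" if t: "t \<in> {0..\<tau>}" for t x
  proof -
    have "f t (frac x) \<in> (\<lambda>(t, x). f t x) ` ({0..\<tau>} \<times> {0..1})"
      using t frac_in_unit[of x] by (intro image_eqI[of _ _ "(t, frac x)"]) auto
    from B(2)[OF this] show ?thesis using periodic_frac[of "f t" x, OF p[OF t]] by simp
  qed
  with B(1) show ?thesis using that by blast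
qed

section \<open>Fourier modes and absolutely convergent Fourier series\<close>

definition fourier_mode :: "int \<Rightarrow> real \<Rightarrow> complex" where
  "fourier_mode k x = cis (2 * pi * of_int k * x)"

lemma norm_fourier_mode [simp]: "norm (fourier_mode k x) = 1"
  by (simp add: fourier_mode_def)

lemma fourier_mode_0 [simp]: "fourier_mode 0 x = 1"
  by (simp add: fourier_mode_def)

lemma fourier_mode_mult: "fourier_mode k x * fourier_mode l x = fourier_mode (k + l) x"
  by (simp add: fourier_mode_def cis_mult algebra_simps)

lemma cnj_fourier_mode: "cnj (fourier_mode k x) = fourier_mode (- k) x"
  by (simp add: fourier_mode_def cis_cnj)

lemma fourier_mode_periodic: "fourier_mode k (x + 1) = fourier_mode k x"
proof -
  have "fourier_mode k (x + 1) = fourier_mode k x * cis (2 * pi * of_int k)"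
    by (simp add: fourier_mode_def cis_mult algebra_simps)
  then show ?thesis by (simp add: cis_multiple_2pi)
qed

lemma continuous_on_fourier_mode [continuous_intros]:
  "continuous_on S f \<Longrightarrow> continuous_on S (\<lambda>x. fourier_mode k (f x))"
  unfolding fourier_mode_def by (intro continuous_intros)

lemma fourier_mode_has_vector_derivative:
  "((\<lambda>x. fourier_mode k x) has_vector_derivative (\<i> * of_real (2 * pi * of_int k) * fourier_mode k x)) (at x within S)"
  unfolding fourier_mode_def has_vector_derivative_def
  by (auto intro!: derivative_eq_intros ext simp: scaleR_conv_of_real algebra_simps)

lemma integral_fourier_mode:
  assumes "a \<le> b"
  shows "\<i> * of_real (2 * pi * of_int k) * integral {a..b} (fourier_mode k) = fourier_mode k b - fourier_mode k a"
proof -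
  have "((\<lambda>x. \<i> * of_real (2 * pi * of_int k) * fourier_mode k x) has_integral (fourier_mode k b - fourier_mode k a)) {a..b}"
    by (rule fundamental_theorem_of_calculus[OF assms fourier_mode_has_vector_derivative])
  then have "integral {a..b} (\<lambda>x. \<i> * of_real (2 * pi * of_int k) * fourier_mode k x) = fourier_mode k b - fourier_mode k a"
    by (rule integral_unique)
  then show ?thesis by simp
qed

lemma integral_fourier_mode_unit: "integral {0..1} (fourier_mode k) = (if k = 0 then 1 else 0)"
proof (cases "k = 0")
  case False
  then show ?thesis
    using integral_fourier_mode[of 0 1 k] fourier_mode_periodic[of k 0] by simp
next
  case True
  have "fourier_mode 0 = (\<lambda>x. 1)" by (rule ext) simp
  with True show ?thesis by simp
qed

lemma fourier_coeff_eq_integral: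
  assumes "continuous_on UNIV f"
  shows "fourier_coeff f k = integral {0..1} (\<lambda>x. of_real (f x) * fourier_mode (- k) x)"
proof -
  have eq: "cis (- 2 * pi * of_int k * x) = fourier_mode (- k) x" for x
    by (simp add: fourier_mode_def)
  have c: "continuous_on {0..1} (\<lambda>x. complex_of_real (f x) * fourier_mode (- k) x)"
    by (intro continuous_intros continuous_on_of_real continuous_on_subset[OF assms]) auto
  show ?thesis
    unfolding fourier_coeff_def eq
    by (rule set_borel_integral_eq_integral(2)[OF borel_integrable_atLeastAtMost'[OF c]])
qed

lemma integrable_mult_fourier_mode:
  fixes g :: "real \<Rightarrow> complex"
  assumes "continuous_on UNIV g"
  shows "(\<lambda>x. g x * fourier_mode k x) integrable_on {a..b}"
  by (intro integrable_continuous_interval continuous_intros continuous_on_subset[OF assms]) auto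

text \<open>If \<open>g\<close> is orthogonal to all modes, it is orthogonal to all powers of the trigonometric polynomial
\<open>K x = (1 + cos (2\<pi>(x - x0))) / 2\<close>. These concentrate at \<open>x0\<close>: near \<open>x0\<close> the \<open>n\<close>-th power is at least
\<open>q1\<^sup>n\<close>, away from it at most \<open>q2\<^sup>n\<close> with \<open>q2 < q1\<close>. If \<open>g x0\<close> were not \<open>0\<close>, the first part would
dominate the integral for large \<open>n\<close>. Taking \<open>x0\<close> in the interior avoids shifting the period.\<close>

lemma fourier_mode_completeness_interior:
  fixes g :: "real \<Rightarrow> complex"
  assumes cont: "continuous_on UNIV g"
    and orth: "\<And>k. integral {0..1} (\<lambda>x. g x * fourier_mode k x) = 0"
    and x0: "0 < x0" "x0 < 1"
  shows "g x0 = 0"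
proof (rule ccontr)
  assume nz: "g x0 \<noteq> 0"
  \<comment> \<open>normalised so that \<open>f x0 = 1\<close>\<close>
  define f where "f = (\<lambda>x. Re (g x / g x0))"
  have cf: "continuous_on S f" for S
    unfolding f_def by (intro continuous_intros continuous_on_subset[OF cont]) (use nz in auto)
  have f0: "f x0 = 1" using nz by (simp add: f_def)
  define K where "K = (\<lambda>x. (1 + cos (2 * pi * (x - x0))) / 2)"
  have cK: "continuous_on S K" for S unfolding K_def by (intro continuous_intros) auto
  have K01: "0 \<le> K x" "K x \<le> 1" for x
  proof -
    define c where "c = cos (2 * pi * (x - x0))"
    have "-1 \<le> c" "c \<le> 1" by (simp_all add: c_def)
    then show "0 \<le> K x" "K x \<le> 1" by (simp_all add: K_def flip: c_def)
  qed
  have Kc: "complex_of_real (K x) = 1/2 + fourier_mode (-1) x0 / 4 * fourier_mode 1 x + fourier_mode 1 x0 / 4 * fourier_mode (-1) x" for x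
  proof -
    have "complex_of_real (cos (2 * pi * (x - x0)))
        = (cis (2 * pi * (x - x0)) + cis (- (2 * pi * (x - x0)))) / 2"
      by (simp add: complex_eq_iff)
    then have "complex_of_real (K x) = 1/2 + (cis (2 * pi * (x - x0)) + cis (- (2 * pi * (x - x0)))) / 4"
      by (simp add: K_def add_divide_distrib)
    moreover have "cis (2 * pi * (x - x0)) = fourier_mode (-1) x0 * fourier_mode 1 x"
      "cis (- (2 * pi * (x - x0))) = fourier_mode 1 x0 * fourier_mode (-1) x"
      by (simp_all add: fourier_mode_def cis_mult algebra_simps)
    ultimately show ?thesis by (simp add: add_divide_distrib)
  qed
  have orthK: "integral {0..1} (\<lambda>x. g x * of_real (K x) ^ n * fourier_mode k x) = 0" for n k
  proof (induction n arbitrary: k)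
    case 0
    then show ?case using orth by simp
  next
    case (Suc n)
    have int: "(\<lambda>x. g x * of_real (K x) ^ n * fourier_mode j x) integrable_on {0..1}" for j
      by (rule integrable_mult_fourier_mode) (intro continuous_intros cont cK)
    have "g x * of_real (K x) ^ Suc n * fourier_mode k x
        = 1/2 * (g x * of_real (K x) ^ n * fourier_mode k x)
        + fourier_mode (-1) x0 / 4 * (g x * of_real (K x) ^ n * fourier_mode (k + 1) x)
        + fourier_mode 1 x0 / 4 * (g x * of_real (K x) ^ n * fourier_mode (k - 1) x)" for x
    proof -
      have e: "fourier_mode (k + 1) x = fourier_mode k x * fourier_mode 1 x" "fourier_mode (k - 1) x = fourier_mode k x * fourier_mode (-1) x"
        by (simp_all add: fourier_mode_mult)
      show ?thesis unfolding e power_Suc2 Kc[of x] by (simp add: algebra_simps)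
    qed
    then have "((\<lambda>x. g x * of_real (K x) ^ Suc n * fourier_mode k x) has_integral
        (1/2 * 0 + fourier_mode (-1) x0 / 4 * 0 + fourier_mode 1 x0 / 4 * 0)) {0..1}"
      using int Suc.IH
      by (simp only: ) (intro has_integral_add has_integral_mult_right; simp add: has_integral_iff)
    then show ?case by (simp add: integral_unique)
  qed
  have fK: "integral {0..1} (\<lambda>x. f x * K x ^ n) = 0" for n
  proof -
    have "(\<lambda>x. g x * of_real (K x) ^ n) integrable_on {0..1}"
      by (intro integrable_continuous_interval continuous_intros continuous_on_subset[OF cont] cK) auto
    then have "((\<lambda>x. g x * of_real (K x) ^ n) has_integral 0) {0..1}"
      using orthK[of n 0] by (simp add: has_integral_iff)
    then have "((\<lambda>x. Re (1 / g x0 * (g x * of_real (K x) ^ n))) has_integral Re (1 / g x0 * 0)) {0..1}"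
      by (intro has_integral_Re has_integral_mult_right)
    moreover have "Re (1 / g x0 * (g x * of_real (K x) ^ n)) = f x * K x ^ n" for x
    proof -
      have eq: "1 / g x0 * (g x * of_real (K x) ^ n) = g x / g x0 * of_real (K x ^ n)" by simp
      show ?thesis unfolding eq f_def times_complex.sel by (simp del: of_real_power)
    qed
    ultimately show ?thesis by (simp add: integral_unique)
  qed
  obtain M where M: "\<And>x. x \<in> {0..1} \<Longrightarrow> \<bar>f x\<bar> \<le> M" "M > 0"
  proof -
    have "bounded (f ` {0..1})"
      by (intro compact_imp_bounded compact_continuous_image cf) auto
    then obtain B where "\<And>x. x \<in> {0..1} \<Longrightarrow> \<bar>f x\<bar> \<le> B" unfolding bounded_iff by force
    then have "\<bar>f x\<bar> \<le> \<bar>B\<bar> + 1" if "x \<in> {0..1}" for x using that by (smt (verit))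
    then show ?thesis using that[of "\<bar>B\<bar> + 1"] by simp
  qed
  obtain d where d: "d > 0" "\<And>x. \<bar>x - x0\<bar> < d \<Longrightarrow> f x > 1/2"
  proof -
    have "isCont f x0" using cf[of UNIV] by (simp add: continuous_on_eq_continuous_at)
    then obtain d where d: "d > 0" "\<And>x. \<bar>x - x0\<bar> < d \<Longrightarrow> \<bar>f x - f x0\<bar> < 1/2"
      unfolding continuous_at_eps_delta by (metis dist_real_def half_gt_zero zero_less_one)
    have "f x > 1/2" if "\<bar>x - x0\<bar> < d" for x
      using d(2)[OF that] unfolding f0 by linarith
    then show ?thesis using that d(1) by blast
  qed
  define \<delta> where "\<delta> = min (d/2) (min (x0/2) ((1 - x0)/2))"
  have \<delta>: "\<delta> > 0" "\<delta> < d" "\<delta> < x0" "x0 + \<delta> < 1" "\<delta> < 1/2"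
    using d x0 by (auto simp: \<delta>_def min_def field_simps)
  define q1 where "q1 = (1 + cos (2 * pi * (\<delta>/2))) / 2"
  define q2 where "q2 = (1 + cos (2 * pi * \<delta>)) / 2"
  have q: "q2 < q1" unfolding q1_def q2_def
    using \<delta> by (auto intro!: cos_monotone_0_pi simp: field_simps)
  have q2: "q2 \<ge> 0" using K01(1)[of "x0 + \<delta>"] by (simp add: q2_def K_def)
  have inner: "q1 \<le> K x" if "\<bar>x - x0\<bar> \<le> \<delta>/2" for x
  proof -
    have "cos (2 * pi * (\<delta>/2)) \<le> cos (2 * pi * \<bar>x - x0\<bar>)"
      using that \<delta> by (intro cos_monotone_0_pi_le) (auto simp: field_simps)
    also have "\<dots> = cos (2 * pi * (x - x0))" using cos_abs_real[of "2 * pi * (x - x0)"] by (simp add: abs_mult)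
    finally show ?thesis by (simp add: q1_def K_def)
  qed
  have outer: "K x \<le> q2" if "\<delta> \<le> \<bar>x - x0\<bar>" "x \<in> {0..1}" for x
  proof -
    have e: "cos (2 * pi * (x - x0)) = cos (2 * pi * \<bar>x - x0\<bar>)"
      using cos_abs_real[of "2 * pi * (x - x0)"] by (simp add: abs_mult)
    have b: "\<bar>x - x0\<bar> \<le> 1 - \<delta>" using that \<delta> unfolding abs_if by auto
    have "cos (2 * pi * \<bar>x - x0\<bar>) \<le> cos (2 * pi * \<delta>)"
    proof (cases "\<bar>x - x0\<bar> \<le> 1/2")
      case True
      then show ?thesis using that \<delta> by (intro cos_monotone_0_pi_le) (auto simp: field_simps)
    next
      case False
      have "cos (2 * pi * \<bar>x - x0\<bar>) = cos (2 * pi - 2 * pi * \<bar>x - x0\<bar>)" by simp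
      also have "\<dots> = cos (2 * pi * (1 - \<bar>x - x0\<bar>))" by (simp add: algebra_simps)
      also have "\<dots> \<le> cos (2 * pi * \<delta>)"
      proof (intro cos_monotone_0_pi_le)
        show "2 * pi * \<delta> \<le> 2 * pi * (1 - \<bar>x - x0\<bar>)" using b by (intro mult_left_mono) auto
        have "2 * pi * (1 - \<bar>x - x0\<bar>) \<le> 2 * pi * (1/2)" using False by (intro mult_left_mono) auto
        then show "2 * pi * (1 - \<bar>x - x0\<bar>) \<le> pi" by simp
      qed (use \<delta> in auto)
      finally show ?thesis .
    qed
    then show ?thesis by (simp add: e K_def q2_def)
  qed
  have key: "\<delta> / 2 * q1 ^ n \<le> M * q2 ^ n" for n
  proof -
    let ?h = "\<lambda>x. (if \<bar>x - x0\<bar> \<le> \<delta>/2 then 1/2 * q1 ^ n else 0) - M * q2 ^ n"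
    have le: "?h x \<le> f x * K x ^ n" if x: "x \<in> {0..1}" for x
    proof -
      have Mq: "M * q2 ^ n \<ge> 0" using M q2 by simp
      consider "\<bar>x - x0\<bar> \<le> \<delta>/2" | "\<delta>/2 < \<bar>x - x0\<bar>" "\<bar>x - x0\<bar> < \<delta>" | "\<delta> \<le> \<bar>x - x0\<bar>" by linarith
      then show ?thesis
      proof cases
        case 1
        have "1/2 * q1 ^ n \<le> f x * K x ^ n"
          using 1 \<delta> d(2)[of x] inner[OF 1] q q2 by (intro mult_mono power_mono) auto
        then show ?thesis using 1 Mq by simp
      next
        case 2
        then have "0 \<le> f x * K x ^ n" using d(2)[of x] \<delta> K01[of x] by simp
        then show ?thesis using 2 Mq by simp
      next
        case 3
        have "\<bar>f x * K x ^ n\<bar> \<le> M * q2 ^ n"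
          unfolding abs_mult power_abs
          using outer[OF 3 x] M(1)[OF x] K01[of x] by (intro mult_mono power_mono) auto
        then show ?thesis using 3 \<delta> by simp
      qed
    qed
    have i1: "((\<lambda>x. if x \<in> {x0 - \<delta>/2..x0 + \<delta>/2} then 1/2 * q1 ^ n else 0) has_integral (\<delta> * (1/2 * q1 ^ n))) {0..1}"
    proof -
      have "((\<lambda>x. 1/2 * q1 ^ n) has_integral (\<delta> * (1/2 * q1 ^ n))) {x0 - \<delta>/2..x0 + \<delta>/2}"
        using has_integral_const_real[of "1/2 * q1 ^ n" "x0 - \<delta>/2" "x0 + \<delta>/2"] \<delta> by simp
      then show ?thesis using \<delta> by (subst has_integral_restrict) auto
    qed
    have e: "(\<bar>x - x0\<bar> \<le> \<delta>/2) = (x \<in> {x0 - \<delta>/2..x0 + \<delta>/2})" for x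
      unfolding atLeastAtMost_iff by linarith
    have i2: "(?h has_integral (\<delta> * (1/2 * q1 ^ n) - M * q2 ^ n)) {0..1}"
      unfolding e using i1 has_integral_const_real[of "M * q2 ^ n" 0 1]
      by (intro has_integral_diff) auto
    have i3: "((\<lambda>x. f x * K x ^ n) has_integral 0) {0..1}"
      using fK[of n] by (simp add: has_integral_iff) (intro integrable_continuous_interval continuous_intros cf cK)
    have "\<delta> * (1/2 * q1 ^ n) - M * q2 ^ n \<le> 0"
      using has_integral_le[OF i2 i3] le by blast
    then show ?thesis by simp
  qed
  have lim: "(\<lambda>n. M * (q2 / q1) ^ n) \<longlonglongrightarrow> M * 0"
    using q q2 by (intro tendsto_intros LIMSEQ_realpow_zero) auto
  have "\<delta> / 2 \<le> M * (q2 / q1) ^ n" for n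
    using key[of n] q q2 by (simp add: field_simps)
  then have "\<delta> / 2 \<le> M * 0" by (intro LIMSEQ_le_const[OF lim]) auto
  then show False using \<delta> by simp
qed

lemma fourier_mode_completeness:
  fixes g :: "real \<Rightarrow> complex"
  assumes cont: "continuous_on UNIV g" and per: "\<And>x. g (x + 1) = g x"
    and orth: "\<And>k. integral {0..1} (\<lambda>x. g x * fourier_mode k x) = 0"
  shows "g x = 0"
proof -
  have int: "g x = 0" if "0 < x" "x < 1" for x
    using fourier_mode_completeness_interior[OF cont orth that] .
  have g0: "g 0 = 0"
  proof -
    have "(g \<longlongrightarrow> g 0) (at_right 0)"
      using cont by (auto simp: continuous_on_def intro: tendsto_within_subset)
    moreover have "\<forall>\<^sub>F x in at_right 0. g x = 0"
      using int by (intro eventually_at_rightI[of 0 1]) auto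
    ultimately show ?thesis
      by (metis tendsto_eventually tendsto_unique trivial_limit_at_right_real)
  qed
  have "g x = g (frac x)" using periodic_frac[of g x, OF per] by simp
  also have "\<dots> = 0"
    using int[of "frac x"] g0 frac_lt_1[of x] frac_ge_0[of x] by (metis order_le_less)
  finally show ?thesis .
qed

lemma abs_summable_fourier_mode_series:
  assumes "(\<lambda>k. norm (c k)) summable_on UNIV"
  shows "(\<lambda>k. c k * fourier_mode k x) summable_on UNIV"
  by (rule abs_summable_summable) (use assms in \<open>simp add: norm_mult\<close>)

text \<open>Weierstrass M-test along the filter of finite sets of frequencies; continuity of the sum and termwise
integration below are consequences.\<close>

lemma uniform_limit_fourier_mode_series:
  assumes "(\<lambda>k. norm (c k)) summable_on UNIV"
  shows "uniform_limit UNIV (\<lambda>F x. \<Sum>k\<in>F. c k * fourier_mode k x) (\<lambda>x. \<Sum>\<^sub>\<infinity>k. c k * fourier_mode k x)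
           (finite_subsets_at_top UNIV)"
  by (rule Weierstrass_m_test_general[OF _ assms]) (simp add: norm_mult)

lemma continuous_on_fourier_mode_series:
  assumes "(\<lambda>k. norm (c k)) summable_on UNIV"
  shows "continuous_on UNIV (\<lambda>x. \<Sum>\<^sub>\<infinity>k. c k * fourier_mode k x)"
  by (rule uniform_limit_theorem[OF _ uniform_limit_fourier_mode_series[OF assms]])
     (auto intro!: always_eventually continuous_intros)

lemma has_sum_integral_fourier_mode_series:
  fixes g :: "real \<Rightarrow> complex"
  assumes g: "continuous_on {a..b} g" and c: "(\<lambda>k. norm (c k)) summable_on UNIV"
  shows "((\<lambda>k. c k * integral {a..b} (\<lambda>x. g x * fourier_mode k x)) has_sum
          integral {a..b} (\<lambda>x. g x * (\<Sum>\<^sub>\<infinity>k. c k * fourier_mode k x))) UNIV"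
proof -
  have bg: "bounded (g ` {a..b})"
    by (intro compact_imp_bounded compact_continuous_image g) auto
  have cs: "continuous_on S (\<lambda>x. \<Sum>\<^sub>\<infinity>k. c k * fourier_mode k x)" for S
    by (rule continuous_on_subset[OF continuous_on_fourier_mode_series[OF c]]) auto
  have bs: "bounded ((\<lambda>x. \<Sum>\<^sub>\<infinity>k. c k * fourier_mode k x) ` {a..b})"
    by (intro compact_imp_bounded compact_continuous_image cs) auto
  have ul: "uniform_limit {a..b} (\<lambda>F x. g x * (\<Sum>k\<in>F. c k * fourier_mode k x))
     (\<lambda>x. g x * (\<Sum>\<^sub>\<infinity>k. c k * fourier_mode k x)) (finite_subsets_at_top UNIV)"
    by (intro uniform_lim_mult uniform_limit_const bg bs
        uniform_limit_on_subset[OF uniform_limit_fourier_mode_series[OF c]]) auto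
  have cF: "continuous_on {a..b} (\<lambda>x. g x * (\<Sum>k\<in>F. c k * fourier_mode k x))" for F
    by (intro continuous_intros g)
  obtain I J where I: "\<And>F. ((\<lambda>x. g x * (\<Sum>k\<in>F. c k * fourier_mode k x)) has_integral I F) {a..b}"
    and J: "((\<lambda>x. g x * (\<Sum>\<^sub>\<infinity>k. c k * fourier_mode k x)) has_integral J) {a..b}"
    and lim: "(I \<longlongrightarrow> J) (finite_subsets_at_top UNIV)"
    by (rule uniform_limit_integral[OF ul cF]) auto
  have "I F = (\<Sum>k\<in>F. c k * integral {a..b} (\<lambda>x. g x * fourier_mode k x))" if "finite F" for F
  proof -
    have "((\<lambda>x. \<Sum>k\<in>F. c k * (g x * fourier_mode k x)) has_integral
       (\<Sum>k\<in>F. c k * integral {a..b} (\<lambda>x. g x * fourier_mode k x))) {a..b}"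
      by (intro has_integral_sum has_integral_mult_right integrable_integral that
          integrable_continuous_interval continuous_intros g)
    moreover have "(\<lambda>x. \<Sum>k\<in>F. c k * (g x * fourier_mode k x)) = (\<lambda>x. g x * (\<Sum>k\<in>F. c k * fourier_mode k x))"
      by (simp add: sum_distrib_left algebra_simps)
    ultimately show ?thesis using has_integral_unique[OF I[of F]] by simp
  qed
  then have "((\<lambda>F. \<Sum>k\<in>F. c k * integral {a..b} (\<lambda>x. g x * fourier_mode k x)) \<longlongrightarrow> J)
     (finite_subsets_at_top UNIV)"
    by (intro Lim_transform_eventually[OF lim])
       (rule eventually_finite_subsets_at_top_weakI, simp)
  then show ?thesis using J by (simp add: has_sum_def integral_unique)
qed

lemma fourier_mode_series_coeff:
  assumes c: "(\<lambda>k. norm (c k)) summable_on UNIV"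
  shows "integral {0..1} (\<lambda>x. (\<Sum>\<^sub>\<infinity>k. c k * fourier_mode k x) * fourier_mode (- l) x) = c l"
proof -
  have "integral {0..1} (\<lambda>x. fourier_mode (- l) x * fourier_mode k x) = (if k = l then 1 else 0)" for k
    using integral_fourier_mode_unit[of "k - l"] by (simp add: fourier_mode_mult algebra_simps)
  then have "((\<lambda>k. c k * (if k = l then 1 else 0)) has_sum
          integral {0..1} (\<lambda>x. fourier_mode (- l) x * (\<Sum>\<^sub>\<infinity>k. c k * fourier_mode k x))) UNIV"
    using has_sum_integral_fourier_mode_series[OF _ c, of 0 1 "fourier_mode (- l)"] by (simp add: continuous_intros)
  moreover have "((\<lambda>k. c k * (if k = l then 1 else 0)) has_sum c l) UNIV"
    by (rule has_sum_finite_neutralI[of "{l}"]) auto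
  ultimately have "integral {0..1} (\<lambda>x. fourier_mode (- l) x * (\<Sum>\<^sub>\<infinity>k. c k * fourier_mode k x)) = c l"
    by (rule has_sum_unique)
  then show ?thesis by (simp add: mult.commute)
qed

text \<open>The series converges uniformly to a continuous function with the same Fourier coefficients as \<open>f\<close>;
completeness of the modes identifies it with \<open>f\<close>.\<close>

lemma fourier_inversion:
  fixes f :: "real \<Rightarrow> real"
  assumes cont: "continuous_on UNIV f" and per: "\<And>x. f (x + 1) = f x"
    and summ: "(\<lambda>k. norm (fourier_coeff f k)) summable_on UNIV"
  shows "of_real (f x) = (\<Sum>\<^sub>\<infinity>k. fourier_coeff f k * fourier_mode k x)"
proof -
  let ?S = "\<lambda>x. \<Sum>\<^sub>\<infinity>k. fourier_coeff f k * fourier_mode k x"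
  have cc: "continuous_on UNIV (\<lambda>x. complex_of_real (f x))" by (intro continuous_intros cont)
  have "complex_of_real (f x) - ?S x = 0"
  proof (rule fourier_mode_completeness)
    show "continuous_on UNIV (\<lambda>x. complex_of_real (f x) - ?S x)"
      by (intro continuous_on_diff cc continuous_on_fourier_mode_series summ)
    show "complex_of_real (f (x + 1)) - ?S (x + 1) = complex_of_real (f x) - ?S x" for x
      by (simp add: per fourier_mode_periodic)
    show "integral {0..1} (\<lambda>x. (complex_of_real (f x) - ?S x) * fourier_mode k x) = 0" for k
    proof -
      have "integral {0..1} (\<lambda>x. (complex_of_real (f x) - ?S x) * fourier_mode k x)
         = integral {0..1} (\<lambda>x. complex_of_real (f x) * fourier_mode k x) - integral {0..1} (\<lambda>x. ?S x * fourier_mode k x)"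
        unfolding left_diff_distrib
        by (intro integral_diff integrable_mult_fourier_mode cc continuous_on_fourier_mode_series summ)
      also have "\<dots> = 0"
        using fourier_mode_series_coeff[OF summ, of "- k"] fourier_coeff_eq_integral[OF cont, of "- k"] by simp
      finally show ?thesis .
    qed
  qed
  then show ?thesis by simp
qed

text \<open>Insert the Fourier series of \<open>f\<close> into the integral that defines the coefficient of the product and
integrate termwise.\<close>

lemma fourier_coeff_convolution:
  fixes f v :: "real \<Rightarrow> real"
  assumes v: "continuous_on UNIV v"
    and f: "continuous_on UNIV f" "\<And>x. f (x + 1) = f x"
    and summ: "(\<lambda>k. norm (fourier_coeff f k)) summable_on UNIV"
  shows "((\<lambda>l. fourier_coeff v (k - l) * fourier_coeff f l) has_sum fourier_coeff (\<lambda>x. v x * f x) k) UNIV"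
proof -
  have vc: "continuous_on UNIV (\<lambda>x. complex_of_real (v x))" by (intro continuous_intros v)
  have "((\<lambda>l. fourier_coeff f l * integral {0..1} (\<lambda>x. (of_real (v x) * fourier_mode (- k) x) * fourier_mode l x)) has_sum
          integral {0..1} (\<lambda>x. (of_real (v x) * fourier_mode (- k) x) * (\<Sum>\<^sub>\<infinity>k. fourier_coeff f k * fourier_mode k x))) UNIV"
    by (intro has_sum_integral_fourier_mode_series summ continuous_intros continuous_on_subset[OF v]) auto
  moreover have "integral {0..1} (\<lambda>x. (of_real (v x) * fourier_mode (- k) x) * fourier_mode l x) = fourier_coeff v (k - l)" for l
    by (simp add: fourier_coeff_eq_integral[OF v] mult.assoc fourier_mode_mult)
  moreover have "integral {0..1} (\<lambda>x. (of_real (v x) * fourier_mode (- k) x) * (\<Sum>\<^sub>\<infinity>k. fourier_coeff f k * fourier_mode k x))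
      = fourier_coeff (\<lambda>x. v x * f x) k"
    unfolding fourier_inversion[OF f summ, symmetric]
    by (subst fourier_coeff_eq_integral) (auto intro!: continuous_intros v f simp: mult_ac)
  ultimately show ?thesis by (simp add: mult.commute)
qed

lemma fourier_coeff_uminus:
  assumes "continuous_on UNIV f"
  shows "fourier_coeff f (- k) = cnj (fourier_coeff f k)"
  by (simp add: fourier_coeff_eq_integral[OF assms] integral_cnj cnj_fourier_mode)

text \<open>The zeroth coefficient of \<open>f\<^sup>2\<close>, computed by the convolution formula; \<open>f\<close> is real, so its coefficients
at opposite frequencies are conjugate.\<close>

lemma parseval:
  fixes f :: "real \<Rightarrow> real"
  assumes f: "continuous_on UNIV f" "\<And>x. f (x + 1) = f x"
    and summ: "(\<lambda>k. norm (fourier_coeff f k)) summable_on UNIV"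
  shows "((\<lambda>k. (norm (fourier_coeff f k))\<^sup>2) has_sum integral {0..1} (\<lambda>x. (f x)\<^sup>2)) UNIV"
proof -
  have "((\<lambda>l. fourier_coeff f (0 - l) * fourier_coeff f l) has_sum fourier_coeff (\<lambda>x. f x * f x) 0) UNIV"
    by (rule fourier_coeff_convolution[OF f(1) f summ])
  moreover have "fourier_coeff f (0 - l) * fourier_coeff f l = of_real ((norm (fourier_coeff f l))\<^sup>2)" for l
    by (simp add: fourier_coeff_uminus[OF f(1)] complex_norm_square[symmetric] mult.commute del: of_real_power)
  moreover have "fourier_coeff (\<lambda>x. f x * f x) 0 = of_real (integral {0..1} (\<lambda>x. (f x)\<^sup>2))"
  proof -
    have "fourier_coeff (\<lambda>x. f x * f x) 0 = integral {0..1} (\<lambda>x. complex_of_real ((f x)\<^sup>2))"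
      by (subst fourier_coeff_eq_integral) (auto intro!: continuous_intros f simp: power2_eq_square)
    also have "\<dots> = of_real (integral {0..1} (\<lambda>x. (f x)\<^sup>2))"
      by (intro integral_unique has_integral_of_real integrable_integral integrable_continuous_interval
          continuous_intros continuous_on_subset[OF f(1)]) auto
    finally show ?thesis .
  qed
  ultimately show ?thesis by (simp only: has_sum_of_real_iff)
qed

text \<open>The termwise differentiated series converges uniformly to some \<open>S\<close>. Integrating \<open>S\<close> termwise gives
back \<open>f\<close>, so the fundamental theorem of calculus yields \<open>f' = S\<close>.\<close>

lemma fourier_series_derivative:
  fixes f :: "real \<Rightarrow> real"
  assumes f: "continuous_on UNIV f" "\<And>x. f (x + 1) = f x"
    and summ: "(\<lambda>k. norm (fourier_coeff f k)) summable_on UNIV"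
    and summ': "(\<lambda>k. norm (2 * pi * of_int k * fourier_coeff f k)) summable_on UNIV"
  shows "(f has_real_derivative deriv f x) (at x)"
    and "continuous_on UNIV (deriv f)"
    and "fourier_coeff (deriv f) k = \<i> * of_real (2 * pi * of_int k) * fourier_coeff f k"
proof -
  define c where "c = (\<lambda>k. \<i> * of_real (2 * pi * of_int k) * fourier_coeff f k)"
  have c: "(\<lambda>k. norm (c k)) summable_on UNIV" using summ' by (simp add: c_def norm_mult)
  define S where "S = (\<lambda>x. \<Sum>\<^sub>\<infinity>k. c k * fourier_mode k x)"
  have cS: "continuous_on A S" for A
    unfolding S_def by (rule continuous_on_subset[OF continuous_on_fourier_mode_series[OF c]]) auto
  have ftc: "integral {a..b} S = of_real (f b) - of_real (f a)" if "a \<le> b" for a b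
  proof -
    have h1: "((\<lambda>k. c k * integral {a..b} (\<lambda>x. 1 * fourier_mode k x)) has_sum integral {a..b} (\<lambda>x. 1 * S x)) UNIV"
      unfolding S_def by (intro has_sum_integral_fourier_mode_series c continuous_intros)
    have h2: "c k * integral {a..b} (\<lambda>x. 1 * fourier_mode k x)
        = fourier_coeff f k * fourier_mode k b - fourier_coeff f k * fourier_mode k a" for k
    proof -
      have "c k * integral {a..b} (\<lambda>x. 1 * fourier_mode k x)
          = fourier_coeff f k * (\<i> * of_real (2 * pi * of_int k) * integral {a..b} (fourier_mode k))"
        by (simp add: c_def)
      then show ?thesis unfolding integral_fourier_mode[OF that] by (simp add: algebra_simps)
    qed
    have h3: "((\<lambda>k. fourier_coeff f k * fourier_mode k b - fourier_coeff f k * fourier_mode k a) has_sum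
        (of_real (f b) - of_real (f a))) UNIV"
      unfolding fourier_inversion[OF f summ]
      unfolding diff_conv_add_uminus
      by (intro has_sum_add has_sum_uminusI has_sum_infsum abs_summable_fourier_mode_series summ)
    show ?thesis using has_sum_unique[OF h1[unfolded h2] h3] by simp
  qed
  have dS: "((\<lambda>x. complex_of_real (f x)) has_vector_derivative S x) (at x)" for x
  proof -
    have "((\<lambda>y. integral {x - 1..y} S) has_vector_derivative S x) (at x within {x - 1..x + 1})"
      by (rule integral_has_vector_derivative[OF cS]) auto
    then have "((\<lambda>y. integral {x - 1..y} S + of_real (f (x - 1))) has_vector_derivative S x + 0) (at x within {x - 1..x + 1})"
      by (intro has_vector_derivative_add has_vector_derivative_const)
    then have "((\<lambda>y. complex_of_real (f y)) has_vector_derivative S x + 0) (at x within {x - 1..x + 1})"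
      by (rule has_vector_derivative_transform_within[where d=1]) (auto simp: ftc)
    then have "((\<lambda>y. complex_of_real (f y)) has_vector_derivative S x) (at x within {x - 1<..<x + 1})"
      by (auto intro: has_vector_derivative_within_subset)
    then show ?thesis by (subst (asm) has_vector_derivative_within_open) auto
  qed
  have dRe: "(f has_real_derivative Re (S x)) (at x)" for x
    using bounded_linear.has_vector_derivative[OF bounded_linear_Re dS[of x]] by (simp add: has_real_derivative_iff_has_vector_derivative)
  have im: "Im (S x) = 0" for x
    using bounded_linear.has_vector_derivative[OF bounded_linear_Im dS[of x]] vector_derivative_unique_at[of "\<lambda>_. 0" "Im (S x)" x 0]
    by auto
  have der: "deriv f x = Re (S x)" for x using DERIV_imp_deriv[OF dRe] .
  show "(f has_real_derivative deriv f x) (at x)" using dRe der by simp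
  have "deriv f = (\<lambda>x. Re (S x))" using der by auto
  then show cd: "continuous_on UNIV (deriv f)" by (simp add: continuous_intros cS)
  have "complex_of_real (deriv f x) = S x" for x by (simp add: der im complex_eq_iff)
  then have "fourier_coeff (deriv f) k = integral {0..1} (\<lambda>x. S x * fourier_mode (- k) x)"
    by (simp add: fourier_coeff_eq_integral[OF cd])
  also have "\<dots> = c k" unfolding S_def by (rule fourier_mode_series_coeff[OF c])
  finally show "fourier_coeff (deriv f) k = \<i> * of_real (2 * pi * of_int k) * fourier_coeff f k"
    by (simp add: c_def)
qed

section \<open>Truncated Sobolev weights and the symbol of the commutator\<close>

text \<open>The Japanese bracket \<open>\<langle>2\<pi>k\<rangle>\<close>, which is the symbol of \<open>(1 - \<partial>\<^sub>x\<^sup>2)\<^sup>1\<^sup>/\<^sup>2\<close>; its powers are the Sobolev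
weights.\<close>

definition bracket :: "int \<Rightarrow> real" where
  "bracket k = sqrt (1 + (2 * pi * of_int k)\<^sup>2)"

lemma bracket_ge_1: "1 \<le> bracket k"
  by (simp add: bracket_def)

lemma bracket_pos [simp]: "0 < bracket k" "0 \<le> bracket k"
  using bracket_ge_1[of k] by linarith+

lemma bracket_nonzero [simp]: "bracket k \<noteq> 0"
  by (metis bracket_pos(1) less_irrefl)

lemma sobolev_weight_eq_bracket: "sobolev_weight r k = bracket k powr (2 * r)"
proof -
  have p: "0 < 1 + (2 * pi * of_int k)\<^sup>2" by (simp add: add_pos_nonneg)
  then have "(sqrt (1 + (2 * pi * of_int k)\<^sup>2)) powr (2 * r) = ((1 + (2 * pi * of_int k)\<^sup>2) powr (1/2)) powr (2 * r)"
    by (simp add: powr_half_sqrt)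
  then show ?thesis by (simp add: powr_powr sobolev_weight_def bracket_def)
qed

lemma abs_le_bracket: "\<bar>2 * pi * of_int k\<bar> \<le> bracket k"
  unfolding bracket_def by (rule real_le_rsqrt) simp

lemma bracket_le: "k \<noteq> 0 \<Longrightarrow> bracket k \<le> 2 * \<bar>2 * pi * of_int k\<bar>"
proof -
  assume k: "k \<noteq> 0"
  have "1 \<le> \<bar>2 * pi * of_int k\<bar>"
  proof -
    have "1 * 1 \<le> \<bar>2 * pi\<bar> * \<bar>of_int k\<bar>" using k pi_gt3 by (intro mult_mono) auto
    then show ?thesis by (simp add: abs_mult)
  qed
  then have "1 \<le> (2 * pi * of_int k)\<^sup>2"
    by (metis power2_abs one_le_power)
  then show ?thesis unfolding bracket_def by (intro real_le_lsqrt) (auto simp: power_mult_distrib)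
qed

lemma bracket_diff: "bracket k - bracket l \<le> \<bar>2 * pi * of_int (k - l)\<bar>"
proof -
  have "bracket k = norm (Complex 1 (2 * pi * of_int k))" for k by (simp add: bracket_def complex_norm)
  then have "bracket k - bracket l \<le> norm (Complex 1 (2 * pi * of_int k) - Complex 1 (2 * pi * of_int l))"
    by (metis norm_triangle_ineq2)
  also have "\<dots> = \<bar>2 * pi * of_int (k - l)\<bar>" by (simp add: norm_complex_def right_diff_distrib)
  finally show ?thesis .
qed

lemma bracket_mono: "\<bar>k\<bar> \<le> \<bar>l\<bar> \<Longrightarrow> bracket k \<le> bracket l"
proof -
  assume "\<bar>k\<bar> \<le> \<bar>l\<bar>"
  then have "(real_of_int k)\<^sup>2 \<le> (real_of_int l)\<^sup>2" by (metis abs_le_square_iff of_int_abs of_int_le_iff)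
  then show ?thesis by (simp add: bracket_def power_mult_distrib)
qed

lemma bracket_double: "\<bar>k\<bar> \<le> 2 * \<bar>l\<bar> \<Longrightarrow> bracket k \<le> 2 * bracket l"
proof -
  assume "\<bar>k\<bar> \<le> 2 * \<bar>l\<bar>"
  then have "\<bar>k\<bar> \<le> \<bar>2 * l\<bar>" by simp
  then have "bracket k \<le> bracket (2 * l)" by (rule bracket_mono)
  also have "bracket (2 * l) \<le> sqrt (2\<^sup>2 * (1 + (2 * pi * of_int l)\<^sup>2))"
    unfolding bracket_def by (intro real_sqrt_le_mono) (simp add: power_mult_distrib)
  also have "\<dots> = 2 * bracket l" unfolding bracket_def real_sqrt_mult by simp
  finally show ?thesis .
qed

lemma bracket_minus [simp]: "bracket (- k) = bracket k"
  by (simp add: bracket_def)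

text \<open>One of the two frequencies \<open>k - l\<close> and \<open>l\<close> is at least half of \<open>k\<close>. This is what makes \<open>H\<^sup>r\<close> behave
well under products.\<close>

lemma bracket_powr_subadditive:
  assumes "r \<ge> 0"
  shows "bracket k powr r \<le> 2 powr r * (bracket (k - l) powr r + bracket l powr r)"
proof -
  have "\<bar>k\<bar> \<le> \<bar>k - l\<bar> + \<bar>l\<bar>" using abs_triangle_ineq[of "k - l" l] by simp
  then have "\<bar>k\<bar> \<le> 2 * \<bar>k - l\<bar> \<or> \<bar>k\<bar> \<le> 2 * \<bar>l\<bar>" by (simp only: mult_2) (metis add_le_cancel_left add_le_cancel_right order_trans linear)
  then have "bracket k \<le> 2 * bracket (k - l) \<or> bracket k \<le> 2 * bracket l" using bracket_double by blast
  then have "bracket k powr r \<le> (2 * bracket (k - l)) powr r \<or> bracket k powr r \<le> (2 * bracket l) powr r"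
    using assms by (auto intro!: powr_mono2)
  then show ?thesis by (auto simp: powr_mult distrib_left add_increasing add_increasing2)
qed

lemma powr_diff_le:
  fixes x y p :: real
  assumes "0 < x" "x \<le> y" "1 \<le> p"
  shows "y powr p - x powr p \<le> p * y powr (p - 1) * (y - x)"
proof (cases "x = y")
  case False
  then have "x < y" using assms by simp
  then have "\<exists>z>x. z < y \<and> y powr p - x powr p = (y - x) * (p * z powr (p - 1))"
    using assms by (intro MVT2 has_real_derivative_powr) auto
  then obtain z where z: "x < z" "z < y" "y powr p - x powr p = (y - x) * (p * z powr (p - 1))"
    by blast
  have "p * z powr (p - 1) \<le> p * y powr (p - 1)"
    using z assms by (intro mult_left_mono powr_mono2) auto
  then have "(y - x) * (p * z powr (p - 1)) \<le> (y - x) * (p * y powr (p - 1))"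
    using assms by (intro mult_left_mono) auto
  then show ?thesis using z(3) by (simp add: mult_ac)
qed simp

text \<open>A tent rather than a sharp cutoff: the energy estimate compares weights at neighbouring frequencies
\<open>k\<close> and \<open>l\<close>, and a jump would cost a factor \<open>N\<close> there.\<close>

definition hat_cutoff :: "nat \<Rightarrow> int \<Rightarrow> real" where
  "hat_cutoff N k = max 0 (1 - \<bar>of_int k\<bar> / of_nat N)"

lemma hat_cutoff_bounds: "0 \<le> hat_cutoff N k" "hat_cutoff N k \<le> 1"
  by (simp_all add: hat_cutoff_def)

lemma hat_cutoff_eq_0: "N \<ge> 1 \<Longrightarrow> int N \<le> \<bar>k\<bar> \<Longrightarrow> hat_cutoff N k = 0"
proof -
  assume "N \<ge> 1" "int N \<le> \<bar>k\<bar>"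
  then have "real N \<le> \<bar>of_int k\<bar>" by (metis of_int_abs of_int_le_iff of_int_of_nat_eq)
  then show ?thesis using \<open>N \<ge> 1\<close> by (simp add: hat_cutoff_def field_simps)
qed

text \<open>The slope \<open>1/N\<close> gains what the factor \<open>l\<close> costs, because the two values can only differ if
\<open>|l| < N\<close>.\<close>

lemma hat_cutoff_diff:
  assumes "N \<ge> 1" "\<bar>l\<bar> \<le> \<bar>k\<bar>"
  shows "\<bar>hat_cutoff N k - hat_cutoff N l\<bar> * \<bar>of_int l\<bar> \<le> \<bar>of_int (k - l)\<bar>"
proof (cases "int N \<le> \<bar>l\<bar>")
  case True
  then show ?thesis using assms hat_cutoff_eq_0[of N k] hat_cutoff_eq_0[of N l] by simp
next
  case False
  then have l: "\<bar>real_of_int l\<bar> \<le> real N"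
    by (metis linear of_int_abs of_int_le_iff of_int_of_nat_eq)
  have "\<bar>hat_cutoff N k - hat_cutoff N l\<bar> \<le> \<bar>\<bar>of_int k\<bar> / of_nat N - \<bar>of_int l\<bar> / of_nat N\<bar>"
    unfolding hat_cutoff_def by linarith
  also have "\<dots> = \<bar>\<bar>of_int k\<bar> - \<bar>of_int l\<bar>\<bar> / of_nat N"
    by (simp add: diff_divide_distrib[symmetric])
  also have "\<dots> \<le> \<bar>of_int (k - l)\<bar> / of_nat N"
    by (intro divide_right_mono) auto
  finally have "\<bar>hat_cutoff N k - hat_cutoff N l\<bar> * \<bar>of_int l\<bar> \<le> \<bar>of_int (k - l)\<bar> / of_nat N * of_nat N"
    using l by (intro mult_mono) auto
  then show ?thesis using assms by simp
qed

lemma hat_cutoff_tendsto: "(\<lambda>N. hat_cutoff N k) \<longlonglongrightarrow> 1"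
proof -
  have "(\<lambda>N. max 0 (1 - \<bar>of_int k\<bar> * inverse (of_nat N))) \<longlonglongrightarrow> max 0 (1 - \<bar>of_int k\<bar> * 0 :: real)"
    by (intro tendsto_intros lim_inverse_n)
  then show ?thesis by (simp add: hat_cutoff_def[abs_def] divide_inverse)
qed

definition trunc_weight :: "nat \<Rightarrow> real \<Rightarrow> int \<Rightarrow> real" where
  "trunc_weight N r k = bracket k powr (2 * r) * hat_cutoff N k"

lemma trunc_weight_bounds: "0 \<le> trunc_weight N r k" "trunc_weight N r k \<le> bracket k powr (2 * r)"
  unfolding trunc_weight_def using hat_cutoff_bounds[of N k] by (auto intro: mult_left_le)

lemma trunc_weight_finite_support: "N \<ge> 1 \<Longrightarrow> {k. trunc_weight N r k \<noteq> 0} \<subseteq> {- int N..int N}"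
proof
  fix k assume "N \<ge> 1" "k \<in> {k. trunc_weight N r k \<noteq> 0}"
  then have "\<not> int N \<le> \<bar>k\<bar>" using hat_cutoff_eq_0[of N k] by (auto simp: trunc_weight_def)
  then show "k \<in> {- int N..int N}" by auto
qed

lemma powr_double: "x > 0 \<Longrightarrow> x powr (2 * r) = x powr r * x powr (r::real)"
  by (simp add: powr_add[symmetric])

text \<open>If \<open>k - l\<close> is the larger frequency, each of the two products is bounded on its own, as \<open>k\<close> and \<open>l\<close> are
then bounded by \<open>2|k - l|\<close>. Otherwise \<open>k\<close> and \<open>l\<close> are comparable, and the difference of the weights
is estimated by the mean value theorem for the power and by the Lipschitz bound for the cutoff.\<close>

lemma trunc_weight_commutator_aux:
  assumes r: "1 \<le> 2 * r" and N: "N \<ge> 1" and lk: "\<bar>l\<bar> \<le> \<bar>k\<bar>"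
  shows "\<bar>trunc_weight N r k * (2 * pi * of_int l) - trunc_weight N r l * (2 * pi * of_int k)\<bar>
     \<le> (2 * r + 2) * 2 powr r * \<bar>2 * pi * of_int (k - l)\<bar> *
        (bracket k powr r * bracket l powr r + bracket (k - l) powr r * (bracket k powr r + bracket l powr r))"
proof (cases "\<bar>l\<bar> \<le> \<bar>k - l\<bar>")
  case True
  let ?e = "\<lambda>j::int. \<bar>2 * pi * of_int j\<bar>"
  have r0: "r \<ge> 0" using r by simp
  have c2: "1 \<le> 2 powr r" using r0 by (simp add: ge_one_powr_ge_zero)
  have k2: "\<bar>k\<bar> \<le> 2 * \<bar>k - l\<bar>" using True abs_triangle_ineq[of "k - l" l] by simp
  have jk: "bracket k powr r \<le> 2 powr r * bracket (k - l) powr r"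
    using powr_mono2[OF r0 _ bracket_double[OF k2]] by (simp add: powr_mult)
  have jl: "bracket l powr r \<le> 2 powr r * bracket (k - l) powr r"
  proof -
    have "bracket l powr r \<le> bracket (k - l) powr r" by (intro powr_mono2 r0 bracket_mono True) simp
    also have "\<dots> \<le> 2 powr r * bracket (k - l) powr r" using c2 by (simp add: mult_le_cancel_right1)
    finally show ?thesis .
  qed
  have el: "?e l \<le> ?e (k - l)"
    using True by (simp add: abs_mult)
  have "real_of_int \<bar>k\<bar> \<le> 2 * real_of_int \<bar>k - l\<bar>" using k2 by linarith
  then have ek: "?e k \<le> 2 * ?e (k - l)"
    by (simp add: abs_mult)
  have t1: "\<bar>trunc_weight N r k * (2 * pi * of_int l)\<bar> \<le> (bracket k powr r * (2 powr r * bracket (k - l) powr r)) * ?e (k - l)"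
  proof -
    have "\<bar>trunc_weight N r k * (2 * pi * of_int l)\<bar> = trunc_weight N r k * ?e l"
      using trunc_weight_bounds[of N r k] by (simp add: abs_mult)
    also have "\<dots> \<le> (bracket k powr r * bracket k powr r) * ?e (k - l)"
      using trunc_weight_bounds[of N r k] el by (intro mult_mono) (auto simp: powr_double)
    also have "\<dots> \<le> (bracket k powr r * (2 powr r * bracket (k - l) powr r)) * ?e (k - l)"
      by (intro mult_right_mono mult_left_mono jk) auto
    finally show ?thesis .
  qed
  have t2: "\<bar>trunc_weight N r l * (2 * pi * of_int k)\<bar> \<le> (bracket l powr r * (2 powr r * bracket (k - l) powr r)) * (2 * ?e (k - l))"
  proof -
    have "\<bar>trunc_weight N r l * (2 * pi * of_int k)\<bar> = trunc_weight N r l * ?e k"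
      using trunc_weight_bounds[of N r l] by (simp add: abs_mult)
    also have "\<dots> \<le> (bracket l powr r * bracket l powr r) * (2 * ?e (k - l))"
      using trunc_weight_bounds[of N r l] ek by (intro mult_mono) (auto simp: powr_double)
    also have "\<dots> \<le> (bracket l powr r * (2 powr r * bracket (k - l) powr r)) * (2 * ?e (k - l))"
      by (intro mult_right_mono mult_left_mono jl) auto
    finally show ?thesis .
  qed
  define A B D E where "A = bracket k powr r" and "B = bracket l powr r" and "D = bracket (k - l) powr r" and "E = ?e (k - l)"
  define c where "c = 2 powr r"
  have nn: "A \<ge> 0" "B \<ge> 0" "D \<ge> 0" "E \<ge> 0" "c \<ge> 0" by (simp_all add: A_def B_def D_def E_def c_def)
  have "\<bar>trunc_weight N r k * (2 * pi * of_int l) - trunc_weight N r l * (2 * pi * of_int k)\<bar>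
     \<le> A * (c * D) * E + B * (c * D) * (2 * E)"
    unfolding A_def B_def D_def E_def c_def by (rule order_trans[OF abs_triangle_ineq4 add_mono[OF t1 t2]])
  also have "\<dots> \<le> 2 * (c * E * (D * (A + B)))" using nn by (simp add: algebra_simps)
  also have "\<dots> \<le> (2 * r + 2) * (c * E * (A * B + D * (A + B)))"
    using nn r by (intro mult_mono mult_left_mono) auto
  finally show ?thesis unfolding A_def B_def D_def E_def c_def by (simp add: mult.assoc)
next
  case False
  let ?e = "\<lambda>j::int. \<bar>2 * pi * of_int j\<bar>"
  have r0: "r \<ge> 0" using r by simp
  have c2: "1 \<le> 2 powr r" using r0 by (simp add: ge_one_powr_ge_zero)
  have k2: "\<bar>k\<bar> \<le> 2 * \<bar>l\<bar>" using False abs_triangle_ineq[of "k - l" l] by simp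
  define A B D E where "A = bracket k powr r" and "B = bracket l powr r" and "D = bracket (k - l) powr r" and "E = ?e (k - l)"
  define c where "c = 2 powr r"
  have nn: "A \<ge> 0" "B \<ge> 0" "D \<ge> 0" "E \<ge> 0" "c \<ge> 1" using c2 by (simp_all add: A_def B_def D_def E_def c_def)
  have AB: "A \<le> c * B" unfolding A_def B_def c_def
    using powr_mono2[OF r0 _ bracket_double[OF k2]] by (simp add: powr_mult)
  have BA: "B \<le> A" unfolding A_def B_def by (intro powr_mono2 r0 bracket_mono lk) simp
  let ?P = "\<lambda>j. bracket j powr (2 * r)"
  have d1: "\<bar>?P k - ?P l\<bar> * ?e l \<le> 2 * r * (c * A * B) * E"
  proof -
    have "?P l \<le> ?P k" using r0 by (intro powr_mono2 bracket_mono lk) auto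
    then have "\<bar>?P k - ?P l\<bar> = ?P k - ?P l" by simp
    also have "\<dots> \<le> 2 * r * bracket k powr (2 * r - 1) * (bracket k - bracket l)"
      by (intro powr_diff_le r bracket_mono lk) simp
    also have "\<dots> \<le> 2 * r * bracket k powr (2 * r - 1) * E"
      unfolding E_def using r0 by (intro mult_left_mono bracket_diff) auto
    finally have "\<bar>?P k - ?P l\<bar> * ?e l \<le> (2 * r * bracket k powr (2 * r - 1) * E) * bracket k"
      using r0 nn order_trans[OF abs_le_bracket bracket_mono[OF lk]] by (intro mult_mono) auto
    also have "\<dots> = 2 * r * (bracket k powr (2 * r - 1) * bracket k powr 1) * E" by (simp add: mult_ac)
    also have "\<dots> = 2 * r * (A * A) * E" unfolding A_def powr_add[symmetric] by simp
    also have "\<dots> \<le> 2 * r * (A * (c * B)) * E"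
      using nn r0 AB by (intro mult_right_mono mult_left_mono) auto
    finally show ?thesis by (simp add: mult_ac)
  qed
  have d2: "\<bar>?P l * (hat_cutoff N k - hat_cutoff N l)\<bar> * ?e l \<le> (A * B) * E"
  proof -
    have "\<bar>?P l * (hat_cutoff N k - hat_cutoff N l)\<bar> * ?e l
        = ?P l * ((\<bar>hat_cutoff N k - hat_cutoff N l\<bar> * \<bar>of_int l\<bar>) * (2 * pi))"
      by (simp add: abs_mult)
    also have "\<dots> \<le> ?P l * (\<bar>of_int (k - l)\<bar> * (2 * pi))"
      by (intro mult_left_mono mult_right_mono hat_cutoff_diff N lk) auto
    also have "\<dots> = (B * B) * E" unfolding B_def E_def powr_double[OF bracket_pos(1)]
      by (simp add: abs_mult mult_ac del: of_int_diff)
    also have "\<dots> \<le> (A * B) * E" using nn BA by (intro mult_right_mono) auto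
    finally show ?thesis .
  qed
  have d3: "trunc_weight N r l * E \<le> (A * B) * E"
  proof -
    have "trunc_weight N r l \<le> B * B" using trunc_weight_bounds(2)[of N r l] by (simp add: powr_double B_def)
    also have "\<dots> \<le> A * B" using nn BA by (intro mult_right_mono) auto
    finally show ?thesis using nn by (intro mult_right_mono) auto
  qed
  have d4: "\<bar>(?P k - ?P l) * hat_cutoff N k\<bar> * ?e l \<le> 2 * r * (c * A * B) * E"
  proof -
    have "\<bar>(?P k - ?P l) * hat_cutoff N k\<bar> = \<bar>?P k - ?P l\<bar> * \<bar>hat_cutoff N k\<bar>" by (rule abs_mult)
    also have "\<dots> \<le> \<bar>?P k - ?P l\<bar>" using hat_cutoff_bounds[of N k] by (intro mult_left_le) auto
    finally have "\<bar>(?P k - ?P l) * hat_cutoff N k\<bar> * ?e l \<le> \<bar>?P k - ?P l\<bar> * ?e l"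
      by (rule mult_right_mono) (rule abs_ge_zero)
    then show ?thesis using d1 by (rule order_trans)
  qed
  have split: "trunc_weight N r k * (2 * pi * of_int l) - trunc_weight N r l * (2 * pi * of_int k)
     = ((?P k - ?P l) * hat_cutoff N k) * (2 * pi * of_int l)
     + (?P l * (hat_cutoff N k - hat_cutoff N l)) * (2 * pi * of_int l)
     - trunc_weight N r l * (2 * pi * of_int (k - l))"
    by (simp add: trunc_weight_def algebra_simps)
  have "\<bar>trunc_weight N r k * (2 * pi * of_int l) - trunc_weight N r l * (2 * pi * of_int k)\<bar>
     \<le> \<bar>((?P k - ?P l) * hat_cutoff N k)\<bar> * ?e l + \<bar>(?P l * (hat_cutoff N k - hat_cutoff N l))\<bar> * ?e l
       + trunc_weight N r l * E"
  proof -
    have tri: "\<bar>a * x + b * x - t * y\<bar> \<le> \<bar>a\<bar> * \<bar>x\<bar> + \<bar>b\<bar> * \<bar>x\<bar> + t * \<bar>y\<bar>" if "t \<ge> 0" for a b x y t :: real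
    proof -
      have "\<bar>t * y\<bar> = t * \<bar>y\<bar>" using that by (simp add: abs_mult)
      then show ?thesis unfolding abs_mult[symmetric] by linarith
    qed
    show ?thesis unfolding split E_def by (rule tri[OF trunc_weight_bounds(1)])
  qed
  also have "\<dots> \<le> 2 * r * (c * A * B) * E + (A * B) * E + (A * B) * E" by (intro add_mono d2 d3 d4)
  also have "\<dots> \<le> 2 * r * (c * A * B) * E + (c * A * B) * E + (c * A * B) * E"
  proof -
    have "A * B \<le> c * A * B" using nn using mult_right_mono[of 1 c "A * B"] by (simp add: mult.assoc)
    then have "(A * B) * E \<le> (c * A * B) * E" by (rule mult_right_mono[OF _ nn(4)])
    then show ?thesis by (intro add_mono order_refl)
  qed
  also have "\<dots> = (2 * r + 2) * (c * E * (A * B))" by (simp add: algebra_simps)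
  also have "\<dots> \<le> (2 * r + 2) * (c * E * (A * B + D * (A + B)))"
    using nn r0 by (intro mult_left_mono) auto
  finally show ?thesis unfolding A_def B_def D_def E_def c_def by (simp add: mult.assoc)
qed

text \<open>The symbol estimate behind the energy method: symmetrising the transport term replaces the weight by
the antisymmetric expression on the left. Comparable frequencies gain a factor \<open>k - l\<close>, which is a
derivative of the transporting velocity; in the other case all weights fall on the velocity and on
one of the two remaining factors.\<close>

lemma trunc_weight_commutator:
  assumes r: "1 \<le> 2 * r" and N: "N \<ge> 1"
  shows "\<bar>trunc_weight N r k * (2 * pi * of_int l) - trunc_weight N r l * (2 * pi * of_int k)\<bar>
     \<le> (2 * r + 2) * 2 powr r * \<bar>2 * pi * of_int (k - l)\<bar> *
        (bracket k powr r * bracket l powr r + bracket (k - l) powr r * (bracket k powr r + bracket l powr r))"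
proof (cases "\<bar>l\<bar> \<le> \<bar>k\<bar>")
  case True
  then show ?thesis by (rule trunc_weight_commutator_aux[OF r N])
next
  case False
  have j: "bracket (l - k) = bracket (k - l)" using bracket_minus[of "k - l"] by (simp only: minus_diff_eq)
  have m: "\<bar>2 * pi * real_of_int m\<bar> = 2 * pi * of_int \<bar>m\<bar>" for m by (simp add: abs_mult)
  have e: "\<bar>2 * pi * real_of_int (l - k)\<bar> = \<bar>2 * pi * of_int (k - l)\<bar>"
    unfolding m abs_minus_commute[of l k] by (rule refl)
  have eq: "bracket l powr r * bracket k powr r + bracket (l - k) powr r * (bracket l powr r + bracket k powr r)
      = bracket k powr r * bracket l powr r + bracket (k - l) powr r * (bracket k powr r + bracket l powr r)"
    unfolding j by (simp add: algebra_simps)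
  have "\<bar>k\<bar> \<le> \<bar>l\<bar>" using False by simp
  from trunc_weight_commutator_aux[OF r N this] show ?thesis
    unfolding e eq by (subst abs_minus_commute)
qed

section \<open>Trilinear estimates for weighted sequences\<close>

lemma nonneg_bounded_infsum:
  fixes f :: "'a \<Rightarrow> real"
  assumes "\<And>x. 0 \<le> f x" and "\<And>F. finite F \<Longrightarrow> sum f F \<le> B"
  shows "f summable_on UNIV" and "infsum f UNIV \<le> B"
proof -
  show s: "f summable_on UNIV"
    by (rule nonneg_bdd_above_summable_on) (use assms in \<open>auto intro!: bdd_aboveI2[where M=B]\<close>)
  show "infsum f UNIV \<le> B" by (rule infsum_le_finite_sums[OF s]) (use assms in auto)
qed

lemma sum_square_le_infsum:
  fixes F :: "'b \<Rightarrow> real"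
  assumes "(\<lambda>k. (F k)\<^sup>2) summable_on UNIV" "finite A" "inj_on p A"
  shows "(\<Sum>x\<in>A. (F (p x))\<^sup>2) \<le> (\<Sum>\<^sub>\<infinity>k. (F k)\<^sup>2)"
proof -
  have "(\<Sum>x\<in>A. (F (p x))\<^sup>2) = (\<Sum>k\<in>p ` A. (F k)\<^sup>2)" using assms(3) by (simp add: sum.reindex)
  also have "\<dots> \<le> (\<Sum>\<^sub>\<infinity>k. (F k)\<^sup>2)" using assms by (intro finite_sum_le_infsum) auto
  finally show ?thesis .
qed

lemma cauchy_schwarz_infsum:
  fixes F G :: "'a \<Rightarrow> real"
  assumes F: "\<And>k. 0 \<le> F k" "(\<lambda>k. (F k)\<^sup>2) summable_on UNIV"
    and G: "\<And>k. 0 \<le> G k" "(\<lambda>k. (G k)\<^sup>2) summable_on UNIV"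
  shows "(\<lambda>k. F k * G k) summable_on UNIV"
    and "(\<Sum>\<^sub>\<infinity>k. F k * G k) \<le> sqrt (\<Sum>\<^sub>\<infinity>k. (F k)\<^sup>2) * sqrt (\<Sum>\<^sub>\<infinity>k. (G k)\<^sup>2)"
proof -
  have "(\<Sum>k\<in>A. F k * G k) \<le> sqrt (\<Sum>\<^sub>\<infinity>k. (F k)\<^sup>2) * sqrt (\<Sum>\<^sub>\<infinity>k. (G k)\<^sup>2)" if "finite A" for A
  proof -
    have "(\<Sum>k\<in>A. F k * G k) \<le> L2_set F A * L2_set G A"
      using L2_set_mult_ineq[of F G A] F G by simp
    also have "\<dots> \<le> sqrt (\<Sum>\<^sub>\<infinity>k. (F k)\<^sup>2) * sqrt (\<Sum>\<^sub>\<infinity>k. (G k)\<^sup>2)"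
      unfolding L2_set_def
      using sum_square_le_infsum[OF F(2) that, of id] sum_square_le_infsum[OF G(2) that, of id]
      by (intro mult_mono real_sqrt_le_mono) (auto intro: sum_nonneg infsum_nonneg)
    finally show ?thesis .
  qed
  then show "(\<lambda>k. F k * G k) summable_on UNIV"
    and "(\<Sum>\<^sub>\<infinity>k. F k * G k) \<le> sqrt (\<Sum>\<^sub>\<infinity>k. (F k)\<^sup>2) * sqrt (\<Sum>\<^sub>\<infinity>k. (G k)\<^sup>2)"
    using F G by (auto intro!: nonneg_bounded_infsum)
qed

text \<open>Young's inequality for a convolution tested against a third sequence. For a fixed value of the index
of \<open>b\<close>, each of the other two indices determines the pair, so the Cauchy--Schwarz inequality bounds the
partial sum by the two \<open>\<ell>\<^sup>2\<close> norms. Stated with index maps \<open>p\<close>, \<open>q\<close>, \<open>m\<close>, it covers every choice of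
which of the frequencies \<open>k\<close>, \<open>l\<close>, \<open>k - l\<close> carries the \<open>\<ell>\<^sup>1\<close> factor.\<close>

lemma young_trilinear:
  fixes F G b :: "int \<Rightarrow> real" and p q m :: "int \<times> int \<Rightarrow> int"
  assumes F: "\<And>k. 0 \<le> F k" "(\<lambda>k. (F k)\<^sup>2) summable_on UNIV"
    and G: "\<And>k. 0 \<le> G k" "(\<lambda>k. (G k)\<^sup>2) summable_on UNIV"
    and b: "\<And>k. 0 \<le> b k" "b summable_on UNIV"
    and inj: "inj (\<lambda>x. (p x, m x))" "inj (\<lambda>x. (q x, m x))"
  shows "(\<lambda>x. b (m x) * (F (p x) * G (q x))) summable_on UNIV"
    and "(\<Sum>\<^sub>\<infinity>x. b (m x) * (F (p x) * G (q x)))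
           \<le> infsum b UNIV * (sqrt (\<Sum>\<^sub>\<infinity>k. (F k)\<^sup>2) * sqrt (\<Sum>\<^sub>\<infinity>k. (G k)\<^sup>2))"
proof -
  let ?B = "sqrt (\<Sum>\<^sub>\<infinity>k. (F k)\<^sup>2) * sqrt (\<Sum>\<^sub>\<infinity>k. (G k)\<^sup>2)"
  have B0: "?B \<ge> 0" by (auto intro!: mult_nonneg_nonneg infsum_nonneg)
  have "(\<Sum>x\<in>A. b (m x) * (F (p x) * G (q x))) \<le> infsum b UNIV * ?B" if A: "finite A" for A
  proof -
    have "(\<Sum>x\<in>A. b (m x) * (F (p x) * G (q x)))
        = (\<Sum>j\<in>m ` A. \<Sum>x\<in>{x\<in>A. m x = j}. b (m x) * (F (p x) * G (q x)))"
      by (rule sum.image_gen[OF A])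
    also have "\<dots> = (\<Sum>j\<in>m ` A. b j * (\<Sum>x\<in>{x\<in>A. m x = j}. F (p x) * G (q x)))"
      by (intro sum.cong refl) (simp add: sum_distrib_left)
    also have "\<dots> \<le> (\<Sum>j\<in>m ` A. b j * ?B)"
    proof (intro sum_mono mult_left_mono b)
      fix j
      let ?A = "{x\<in>A. m x = j}"
      have i: "inj_on p ?A" "inj_on q ?A"
        by (rule inj_onI; use injD[OF inj(1)] injD[OF inj(2)] in auto)+
      have "(\<Sum>x\<in>?A. F (p x) * G (q x)) \<le> L2_set (\<lambda>x. F (p x)) ?A * L2_set (\<lambda>x. G (q x)) ?A"
        using L2_set_mult_ineq[of "\<lambda>x. F (p x)" "\<lambda>x. G (q x)" ?A] F G by simp
      also have "\<dots> \<le> ?B"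
        unfolding L2_set_def
        using sum_square_le_infsum[OF F(2) _ i(1)] sum_square_le_infsum[OF G(2) _ i(2)] A
        by (intro mult_mono real_sqrt_le_mono) (auto intro: sum_nonneg infsum_nonneg)
      finally show "(\<Sum>x\<in>?A. F (p x) * G (q x)) \<le> ?B" .
    qed
    also have "\<dots> = (\<Sum>j\<in>m ` A. b j) * ?B" by (simp add: sum_distrib_right)
    also have "\<dots> \<le> infsum b UNIV * ?B"
      using A b B0 by (intro mult_right_mono finite_sum_le_infsum) auto
    finally show ?thesis .
  qed
  then show "(\<lambda>x. b (m x) * (F (p x) * G (q x))) summable_on UNIV"
    and "(\<Sum>\<^sub>\<infinity>x. b (m x) * (F (p x) * G (q x))) \<le> infsum b UNIV * ?B"
    using F G b by (auto intro!: nonneg_bounded_infsum)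
qed

text \<open>The Sobolev norm, the Wiener norm and the spatial derivative on the side of the Fourier
coefficients.\<close>

definition hs_summable :: "real \<Rightarrow> (int \<Rightarrow> complex) \<Rightarrow> bool" where
  "hs_summable r c \<longleftrightarrow> (\<lambda>k. (bracket k powr r * norm (c k))\<^sup>2) summable_on UNIV"

definition hs_norm :: "real \<Rightarrow> (int \<Rightarrow> complex) \<Rightarrow> real" where
  "hs_norm r c = sqrt (\<Sum>\<^sub>\<infinity>k. (bracket k powr r * norm (c k))\<^sup>2)"

definition l1_summable :: "(int \<Rightarrow> complex) \<Rightarrow> bool" where
  "l1_summable c \<longleftrightarrow> (\<lambda>k. norm (c k)) summable_on UNIV"

definition l1_norm :: "(int \<Rightarrow> complex) \<Rightarrow> real" where
  "l1_norm c = (\<Sum>\<^sub>\<infinity>k. norm (c k))"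

definition deriv_seq :: "(int \<Rightarrow> complex) \<Rightarrow> int \<Rightarrow> complex" where
  "deriv_seq c k = \<i> * of_real (2 * pi * of_int k) * c k"

lemma hs_norm_nonneg: "0 \<le> hs_norm r c"
  by (simp add: hs_norm_def infsum_nonneg)

lemma l1_norm_nonneg: "0 \<le> l1_norm c"
  by (simp add: l1_norm_def infsum_nonneg)

lemma norm_deriv_seq: "norm (deriv_seq c k) = \<bar>2 * pi * of_int k\<bar> * norm (c k)"
  by (simp add: deriv_seq_def norm_mult abs_mult)

lemma norm_le_l1_norm: "l1_summable c \<Longrightarrow> norm (c k) \<le> l1_norm c"
  unfolding l1_summable_def l1_norm_def
  using finite_sum_le_infsum[of "\<lambda>k. norm (c k)" UNIV "{k}"] by simp

lemma nonneg_summable_product: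
  fixes P Q :: "int \<Rightarrow> real"
  assumes "\<And>k. 0 \<le> P k" "P summable_on UNIV" "\<And>k. 0 \<le> Q k" "Q summable_on UNIV"
  shows "(\<lambda>(k, l). P k * Q l) summable_on UNIV"
proof -
  have "(\<lambda>(k, l). P k * Q l) summable_on Sigma UNIV (\<lambda>_. UNIV)"
    by (rule summable_on_SigmaI[where g = "\<lambda>k. P k * infsum Q UNIV"])
       (use assms in \<open>auto intro!: has_sum_cmult_right summable_on_cmult_left\<close>)
  then show ?thesis by simp
qed

lemma sum_trunc_weight:
  assumes "N \<ge> 1"
  shows "((\<lambda>k. trunc_weight N r k * h k) has_sum (\<Sum>k\<in>{- int N..int N}. trunc_weight N r k * h k)) UNIV"
  by (rule has_sum_finite_neutralI) (use trunc_weight_finite_support[OF assms, of r] in auto)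

lemma Re_of_real_mult: "Re (of_real a * z) = a * Re z"
  by simp

text \<open>Here \<open>g\<close> is the coefficient sequence of \<open>v \<partial>\<^sub>x f\<close>. A direct estimate would need one derivative of \<open>f\<close> more
than the weights provide. The sequence \<open>v\<close> belongs to a real function, so exchanging \<open>k\<close> and \<open>l\<close> turns
\<open>cnj (f k) * v (k - l) * f l\<close> into its conjugate, and the sum of the two terms carries the
antisymmetric factor that \<open>trunc_weight_commutator\<close> estimates. This is the discrete form of the integration by parts
\<open>\<integral> v f f\<^sub>x = - 1/2 \<integral> v\<^sub>x f\<^sup>2\<close>.\<close>

lemma transport_estimate:
  fixes v f g :: "int \<Rightarrow> complex"
  assumes r: "1 \<le> 2 * r" and N: "N \<ge> 1"
    and v: "\<And>k. v (- k) = cnj (v k)" "l1_summable v" "l1_summable (deriv_seq v)" "hs_summable r (deriv_seq v)"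
    and f: "l1_summable f" "l1_summable (deriv_seq f)" "hs_summable r f"
    and g: "\<And>k. ((\<lambda>l. v (k - l) * deriv_seq f l) has_sum g k) UNIV"
  shows "\<bar>\<Sum>k\<in>{- int N..int N}. trunc_weight N r k * Re (cnj (f k) * g k)\<bar>
    \<le> (2 * r + 2) * 2 powr r * (l1_norm (deriv_seq v) * (hs_norm r f)\<^sup>2 + 2 * l1_norm f * (hs_norm r (deriv_seq v) * hs_norm r f))"
    (is "\<bar>?S\<bar> \<le> ?C * ?R")
proof -
  define a where "a = (\<lambda>(k, l). trunc_weight N r k * Re (cnj (f k) * (v (k - l) * deriv_seq f l)))"
  let ?K = "{- int N..int N}"
  have f': "(\<lambda>k. norm (f k)) summable_on UNIV" "(\<lambda>k. norm (deriv_seq f k)) summable_on UNIV"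
    "(\<lambda>k. norm (deriv_seq v k)) summable_on UNIV"
    using f v by (simp_all add: l1_summable_def)
  have a_summ: "a summable_on UNIV"
  proof -
    have 1: "(\<lambda>k. trunc_weight N r k * norm (f k)) summable_on UNIV"
      using sum_trunc_weight[OF N] by (rule has_sum_imp_summable)
    have 2: "(\<lambda>(k, l). (trunc_weight N r k * norm (f k)) * (l1_norm v * norm (deriv_seq f l))) summable_on UNIV"
      by (intro nonneg_summable_product 1 summable_on_cmult_right f')
         (auto intro!: mult_nonneg_nonneg trunc_weight_bounds l1_norm_nonneg)
    have "\<bar>a x\<bar> \<le> (case x of (k, l) \<Rightarrow> (trunc_weight N r k * norm (f k)) * (l1_norm v * norm (deriv_seq f l)))" for x
    proof (cases x)
      case (Pair k l)
      have "\<bar>Re (cnj (f k) * (v (k - l) * deriv_seq f l))\<bar> \<le> norm (f k) * (norm (v (k - l)) * norm (deriv_seq f l))"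
        by (rule order_trans[OF abs_Re_le_cmod]) (simp add: norm_mult)
      also have "\<dots> \<le> norm (f k) * (l1_norm v * norm (deriv_seq f l))"
        by (intro mult_left_mono mult_right_mono norm_le_l1_norm v) auto
      finally show ?thesis
        using trunc_weight_bounds(1)[of N r k] by (simp add: Pair a_def abs_mult mult.assoc mult_left_mono)
    qed
    then have "(\<lambda>x. norm (a x)) summable_on UNIV"
      by (intro summable_on_comparison_test[OF 2]) auto
    then show ?thesis by (rule abs_summable_summable)
  qed
  have inner: "((\<lambda>l. a (k, l)) has_sum trunc_weight N r k * Re (cnj (f k) * g k)) UNIV" for k
    unfolding a_def prod.case
    by (intro has_sum_cmult_right has_sum_Re[OF has_sum_cmult_right[OF g]])
  have S1: "?S = infsum a UNIV"
  proof -
    have "infsum a UNIV = (\<Sum>\<^sub>\<infinity>k. \<Sum>\<^sub>\<infinity>l. a (k, l))"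
      using infsum_Sigma_banach[of a UNIV "\<lambda>_. UNIV"] a_summ by simp
    also have "\<dots> = (\<Sum>\<^sub>\<infinity>k. trunc_weight N r k * Re (cnj (f k) * g k))"
      by (intro infsum_cong infsumI inner)
    also have "\<dots> = ?S" by (intro infsumI sum_trunc_weight N)
    finally show ?thesis by simp
  qed
  have swap: "bij (prod.swap :: int \<times> int \<Rightarrow> _)" by (rule bij_swap)
  have a_swap: "(\<lambda>x. a (prod.swap x)) summable_on UNIV" "(\<Sum>\<^sub>\<infinity>x. a (prod.swap x)) = infsum a UNIV"
    using a_summ summable_on_reindex_bij_betw[OF swap, of a] infsum_reindex_bij_betw[OF swap, of a] by auto
  have S2: "2 * ?S = (\<Sum>\<^sub>\<infinity>x. a x + a (prod.swap x))"
    using S1 a_swap a_summ by (simp add: infsum_add)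
  define F where "F = (\<lambda>k. bracket k powr r * norm (f k))"
  define U where "U = (\<lambda>k. bracket k powr r * norm (deriv_seq v k))"
  have F: "\<And>k. 0 \<le> F k" "(\<lambda>k. (F k)\<^sup>2) summable_on UNIV" "sqrt (\<Sum>\<^sub>\<infinity>k. (F k)\<^sup>2) = hs_norm r f"
    using f by (auto simp: F_def hs_summable_def hs_norm_def)
  have U: "\<And>k. 0 \<le> U k" "(\<lambda>k. (U k)\<^sup>2) summable_on UNIV" "sqrt (\<Sum>\<^sub>\<infinity>k. (U k)\<^sup>2) = hs_norm r (deriv_seq v)"
    using v by (auto simp: U_def hs_summable_def hs_norm_def)
  define d :: "int \<times> int \<Rightarrow> int" where "d = (\<lambda>(k, l). k - l)"
  \<comment> \<open>the three terms of the commutator bound, with the \<open>\<ell>\<^sup>1\<close> factor in front\<close>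
  define h1 where "h1 = (\<lambda>x. norm (deriv_seq v (d x)) * (F (fst x) * F (snd x)))"
  define h2 where "h2 = (\<lambda>x. norm (f (snd x)) * (U (d x) * F (fst x)))"
  define h3 where "h3 = (\<lambda>x. norm (f (fst x)) * (U (d x) * F (snd x)))"
  have inj: "inj (\<lambda>x. (fst x, d x))" "inj (\<lambda>x. (snd x, d x))" "inj (\<lambda>x. (d x, snd x))"
     "inj (\<lambda>x. (fst x, snd x))" "inj (\<lambda>x. (d x, fst x))" "inj (\<lambda>x::int \<times> int. (snd x, fst x))"
    by (auto simp: inj_on_def d_def)
  note y1 = young_trilinear[OF F(1,2) F(1,2) norm_ge_zero f'(3) inj(1,2)]
  note y2 = young_trilinear[OF U(1,2) F(1,2) norm_ge_zero f'(1) inj(3,4)]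
  note y3 = young_trilinear[OF U(1,2) F(1,2) norm_ge_zero f'(1) inj(5,6)]
  have bound: "\<bar>a x + a (prod.swap x)\<bar> \<le> ?C * (h1 x + h2 x + h3 x)" for x
  proof (cases x)
    case (Pair k l)
    have vs: "v (l - k) = cnj (v (k - l))" using v(1)[of "k - l"] by simp
    have "Re (cnj (f l) * (v (l - k) * deriv_seq f k)) = Re (cnj (cnj (f l) * (v (l - k) * deriv_seq f k)))" by (rule cnj.sel(1)[symmetric])
    also have "cnj (cnj (f l) * (v (l - k) * deriv_seq f k))
        = of_real (- (2 * pi * of_int k)) * (\<i> * cnj (f k) * v (k - l) * f l)"
      by (simp add: vs deriv_seq_def mult_ac)
    also have "Re \<dots> = - (2 * pi * of_int k) * Re (\<i> * cnj (f k) * v (k - l) * f l)"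
      by (rule Re_of_real_mult)
    finally have r2: "Re (cnj (f l) * (v (l - k) * deriv_seq f k)) = - (2 * pi * of_int k) * Re (\<i> * cnj (f k) * v (k - l) * f l)" .
    have a2: "a (l, k) = - (trunc_weight N r l * (2 * pi * of_int k)) * Re (\<i> * cnj (f k) * v (k - l) * f l)"
      unfolding a_def prod.case r2 by (simp only: mult.assoc mult_minus_left mult_minus_right)
    have c1: "cnj (f k) * (v (k - l) * deriv_seq f l) = of_real (2 * pi * of_int l) * (\<i> * cnj (f k) * v (k - l) * f l)"
      by (simp add: deriv_seq_def mult_ac)
    have a1: "a (k, l) = (trunc_weight N r k * (2 * pi * of_int l)) * Re (\<i> * cnj (f k) * v (k - l) * f l)"
      unfolding a_def prod.case c1 Re_of_real_mult by (simp only: mult.assoc)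
    have R: "\<bar>Re (\<i> * cnj (f k) * v (k - l) * f l)\<bar> \<le> norm (f k) * norm (v (k - l)) * norm (f l)"
      by (rule order_trans[OF abs_Re_le_cmod]) (simp add: norm_mult)
    have sum_eq: "a x + a (prod.swap x) = (trunc_weight N r k * (2 * pi * of_int l) - trunc_weight N r l * (2 * pi * of_int k))
        * Re (\<i> * cnj (f k) * v (k - l) * f l)"
      by (simp only: Pair swap_simp a1 a2 left_diff_distrib) (simp only: mult_minus_left diff_conv_add_uminus)
    have "\<bar>a x + a (prod.swap x)\<bar> \<le> (?C * \<bar>2 * pi * of_int (k - l)\<bar> *
        (bracket k powr r * bracket l powr r + bracket (k - l) powr r * (bracket k powr r + bracket l powr r))) * (norm (f k) * norm (v (k - l)) * norm (f l))"
      unfolding sum_eq abs_mult[of "_ - _"] using r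
      by (intro mult_mono trunc_weight_commutator R N) (auto intro!: mult_nonneg_nonneg add_nonneg_nonneg)
    also have "\<dots> = ?C * (h1 x + h2 x + h3 x)"
    proof -
      have "(C * E * (A * B + D * (A + B))) * (x * w * y)
        = C * ((E * w) * ((A * x) * (B * y)) + y * ((D * (E * w)) * (A * x)) + x * ((D * (E * w)) * (B * y)))"
        for A B C D E w x y :: real by algebra
      then show ?thesis
        unfolding Pair h1_def h2_def h3_def d_def F_def U_def norm_deriv_seq prod.case fst_conv snd_conv .
    qed
    finally show ?thesis .
  qed
  have hs: "((\<lambda>x. ?C * (h1 x + h2 x + h3 x)) has_sum (?C * (infsum h1 UNIV + infsum h2 UNIV + infsum h3 UNIV))) UNIV"
    unfolding h1_def h2_def h3_def
    by (intro has_sum_cmult_right has_sum_add has_sum_infsum y1(1) y2(1) y3(1))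
  have as: "((\<lambda>x. a x + a (prod.swap x)) has_sum (2 * ?S)) UNIV"
    unfolding S2 by (intro has_sum_infsum summable_on_add a_summ a_swap)
  have "norm (2 * ?S) \<le> ?C * (infsum h1 UNIV + infsum h2 UNIV + infsum h3 UNIV)"
    by (rule norm_infsum_le[OF as hs]) (use bound in auto)
  also have "\<dots> \<le> ?C * (l1_norm (deriv_seq v) * (hs_norm r f * hs_norm r f) + l1_norm f * (hs_norm r (deriv_seq v) * hs_norm r f)
      + l1_norm f * (hs_norm r (deriv_seq v) * hs_norm r f))"
    using y1(2) y2(2) y3(2) r unfolding F(3) U(3) l1_norm_def[symmetric] h1_def h2_def h3_def
    by (intro mult_left_mono add_mono) auto
  also have "\<dots> = ?C * ?R" by (simp only: power2_eq_square mult_2 distrib_right distrib_left add.assoc)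
  finally have "\<bar>2 * ?S\<bar> \<le> ?C * ?R" by (simp only: real_norm_def)
  then show ?thesis by linarith
qed

text \<open>By \<open>bracket_powr_subadditive\<close> the weight at \<open>k\<close> can be moved to one of the two factors, and the other
factor is then measured in \<open>\<ell>\<^sup>1\<close>.\<close>

lemma product_estimate:
  fixes f g h q :: "int \<Rightarrow> complex"
  assumes r: "0 \<le> r" and N: "N \<ge> 1"
    and f: "hs_summable r f"
    and g: "l1_summable g" "hs_summable r g"
    and h: "l1_summable h" "hs_summable r h"
    and q: "\<And>k. ((\<lambda>l. g (k - l) * h l) has_sum q k) UNIV"
  shows "\<bar>\<Sum>k\<in>{- int N..int N}. trunc_weight N r k * Re (cnj (f k) * q k)\<bar>
    \<le> 2 powr r * hs_norm r f * (hs_norm r g * l1_norm h + l1_norm g * hs_norm r h)"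
proof -
  let ?K = "{- int N..int N}"
  have s: "(\<lambda>k. norm (g k)) summable_on UNIV" "(\<lambda>k. norm (h k)) summable_on UNIV"
    using g h by (simp_all add: l1_summable_def)
  define F where "F = (\<lambda>k. bracket k powr r * norm (f k))"
  define G where "G = (\<lambda>k. bracket k powr r * norm (g k))"
  define H where "H = (\<lambda>k. bracket k powr r * norm (h k))"
  have F: "\<And>k. 0 \<le> F k" "(\<lambda>k. (F k)\<^sup>2) summable_on UNIV" "sqrt (\<Sum>\<^sub>\<infinity>k. (F k)\<^sup>2) = hs_norm r f"
    using f by (auto simp: F_def hs_summable_def hs_norm_def)
  have G: "\<And>k. 0 \<le> G k" "(\<lambda>k. (G k)\<^sup>2) summable_on UNIV" "sqrt (\<Sum>\<^sub>\<infinity>k. (G k)\<^sup>2) = hs_norm r g"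
    using g by (auto simp: G_def hs_summable_def hs_norm_def)
  have H: "\<And>k. 0 \<le> H k" "(\<lambda>k. (H k)\<^sup>2) summable_on UNIV" "sqrt (\<Sum>\<^sub>\<infinity>k. (H k)\<^sup>2) = hs_norm r h"
    using h by (auto simp: H_def hs_summable_def hs_norm_def)
  define d :: "int \<times> int \<Rightarrow> int" where "d = (\<lambda>(k, l). k - l)"
  define h1 where "h1 = (\<lambda>x. norm (h (snd x)) * (F (fst x) * G (d x)))"
  define h2 where "h2 = (\<lambda>x. norm (g (d x)) * (F (fst x) * H (snd x)))"
  have inj: "inj (\<lambda>x. (fst x, snd x))" "inj (\<lambda>x. (d x, snd x))" "inj (\<lambda>x. (fst x, d x))"
     "inj (\<lambda>x. (snd x, d x))"
    by (auto simp: inj_on_def d_def)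
  note y1 = young_trilinear[OF F(1,2) G(1,2) norm_ge_zero s(2) inj(1,2)]
  note y2 = young_trilinear[OF F(1,2) H(1,2) norm_ge_zero s(1) inj(3,4)]
  define c where "c = (\<lambda>x. 2 powr r * (h1 x + h2 x))"
  have c: "(c has_sum (2 powr r * (infsum h1 UNIV + infsum h2 UNIV))) UNIV"
    unfolding c_def h1_def h2_def by (intro has_sum_cmult_right has_sum_add has_sum_infsum y1(1) y2(1))
  have c0: "c x \<ge> 0" for x
    using F G H by (auto simp: c_def h1_def h2_def)
  have cS: "c summable_on Sigma UNIV (\<lambda>_. UNIV)" using c has_sum_imp_summable by auto
  have ck: "(\<lambda>l. c (k, l)) summable_on UNIV" for k
    using summable_on_SigmaD1[of "\<lambda>k l. c (k, l)" UNIV "\<lambda>_. UNIV" k] cS by (simp add: c0)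
  have summand: "\<bar>trunc_weight N r k * Re (cnj (f k) * q k)\<bar> \<le> (\<Sum>\<^sub>\<infinity>l. c (k, l))" for k
  proof -
    have hq: "((\<lambda>l. trunc_weight N r k * Re (cnj (f k) * (g (k - l) * h l))) has_sum
            trunc_weight N r k * Re (cnj (f k) * q k)) UNIV"
      by (intro has_sum_cmult_right has_sum_Re[OF has_sum_cmult_right[OF q]])
    have "norm (trunc_weight N r k * Re (cnj (f k) * (g (k - l) * h l))) \<le> c (k, l)" for l
    proof -
      have "\<bar>Re (cnj (f k) * (g (k - l) * h l))\<bar> \<le> norm (f k) * (norm (g (k - l)) * norm (h l))"
        by (rule order_trans[OF abs_Re_le_cmod]) (simp add: norm_mult)
      moreover have "trunc_weight N r k \<le> bracket k powr r * (2 powr r * (bracket (k - l) powr r + bracket l powr r))"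
      proof -
        have "trunc_weight N r k \<le> bracket k powr r * bracket k powr r"
          using trunc_weight_bounds(2)[of N r k] by (simp add: powr_double)
        also have "\<dots> \<le> bracket k powr r * (2 powr r * (bracket (k - l) powr r + bracket l powr r))"
          by (intro mult_left_mono bracket_powr_subadditive r) auto
        finally show ?thesis .
      qed
      ultimately have "trunc_weight N r k * \<bar>Re (cnj (f k) * (g (k - l) * h l))\<bar>
          \<le> (bracket k powr r * (2 powr r * (bracket (k - l) powr r + bracket l powr r))) * (norm (f k) * (norm (g (k - l)) * norm (h l)))"
        by (intro mult_mono) (auto intro!: mult_nonneg_nonneg add_nonneg_nonneg)
      also have "\<dots> = c (k, l)"
      proof -
        have "(A * (C * (D + B))) * (x * (w * y)) = C * (y * ((A * x) * (D * w)) + w * ((A * x) * (B * y)))"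
          for A B C D w x y :: real by algebra
        then show ?thesis
          unfolding c_def h1_def h2_def d_def F_def G_def H_def prod.case fst_conv snd_conv .
      qed
      finally show ?thesis using trunc_weight_bounds(1)[of N r k] by (simp add: abs_mult)
    qed
    then show ?thesis using norm_infsum_le[OF hq has_sum_infsum[OF ck]] by simp
  qed
  have "\<bar>\<Sum>k\<in>?K. trunc_weight N r k * Re (cnj (f k) * q k)\<bar> \<le> (\<Sum>k\<in>?K. \<Sum>\<^sub>\<infinity>l. c (k, l))"
    by (rule order_trans[OF sum_abs]) (intro sum_mono summand)
  also have "\<dots> \<le> (\<Sum>\<^sub>\<infinity>k. \<Sum>\<^sub>\<infinity>l. c (k, l))"
    using summable_on_Sigma_banach[of "\<lambda>k l. c (k, l)" UNIV "\<lambda>_. UNIV"] cS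
    by (intro finite_sum_le_infsum) (auto intro!: infsum_nonneg c0)
  also have "\<dots> = infsum c UNIV" using infsum_Sigma_banach[OF cS] by simp
  also have "\<dots> = 2 powr r * (infsum h1 UNIV + infsum h2 UNIV)" using c by (rule infsumI)
  also have "\<dots> \<le> 2 powr r * (l1_norm h * (hs_norm r f * hs_norm r g) + l1_norm g * (hs_norm r f * hs_norm r h))"
    using y1(2) y2(2) unfolding F(3) G(3) H(3) l1_norm_def[symmetric] h1_def h2_def
    by (intro mult_left_mono add_mono) auto
  finally show ?thesis by (simp add: algebra_simps)
qed

section \<open>From Sobolev-valued curves to classical regularity\<close>

lemma sobolev_weight_hs: "sobolev_weight r k * (cmod c)\<^sup>2 = (bracket k powr r * cmod c)\<^sup>2"
  by (simp add: sobolev_weight_eq_bracket powr_double power_mult_distrib power2_eq_square)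

lemma sobolev_norm_eq: "sobolev_norm r f = hs_norm r (fourier_coeff f)"
  by (simp add: sobolev_norm_def hs_norm_def sobolev_weight_hs)

text \<open>Continuity makes the measurability and integrability conditions automatic, so membership is a
condition on the Fourier coefficients alone.\<close>

lemma sobolev_cont_iff:
  "f \<in> sobolev_cont r \<longleftrightarrow> continuous_on UNIV f \<and> (\<forall>x. f (x + 1) = f x) \<and> hs_summable r (fourier_coeff f)"
proof -
  have "f \<in> L2_circle" if "continuous_on UNIV f" "\<forall>x. f (x + 1) = f x"
  proof -
    have "set_integrable lborel {0..1} (\<lambda>x. (f x)\<^sup>2)"
      by (intro borel_integrable_atLeastAtMost' continuous_intros continuous_on_subset[OF that(1)]) auto
    then show ?thesis using that by (simp add: L2_circle_def borel_measurable_continuous_onI)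
  qed
  then show ?thesis
    by (auto simp: sobolev_cont_def sobolev_def hs_summable_def sobolev_weight_hs L2_circle_def)
qed

lemma fourier_coeff_lincomb:
  assumes "continuous_on UNIV f" "continuous_on UNIV g"
  shows "fourier_coeff (\<lambda>x. a * f x + b * g x) k = of_real a * fourier_coeff f k + of_real b * fourier_coeff g k"
proof -
  have c: "continuous_on UNIV (\<lambda>x. complex_of_real (f x))" "continuous_on UNIV (\<lambda>x. complex_of_real (g x))"
    by (intro continuous_intros assms)+
  have "fourier_coeff (\<lambda>x. a * f x + b * g x) k
     = integral {0..1} (\<lambda>x. of_real a * (of_real (f x) * fourier_mode (- k) x) + of_real b * (of_real (g x) * fourier_mode (- k) x))"
    by (subst fourier_coeff_eq_integral) (auto intro!: continuous_intros assms simp: algebra_simps)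
  also have "\<dots> = of_real a * fourier_coeff f k + of_real b * fourier_coeff g k"
    unfolding fourier_coeff_eq_integral[OF assms(1)] fourier_coeff_eq_integral[OF assms(2)]
    by (intro integral_unique has_integral_add has_integral_mult_right integrable_integral integrable_mult_fourier_mode c)
  finally show ?thesis .
qed

lemma hs_summable_add:
  assumes "hs_summable r c" "hs_summable r d"
  shows "hs_summable r (\<lambda>k. c k + d k)"
  unfolding hs_summable_def
proof (rule summable_on_comparison_test)
  show "(\<lambda>k. 2 * (bracket k powr r * norm (c k))\<^sup>2 + 2 * (bracket k powr r * norm (d k))\<^sup>2) summable_on UNIV"
    using assms unfolding hs_summable_def by (intro summable_on_add summable_on_cmult_right)
  fix k
  have "norm (c k + d k) \<le> norm (c k) + norm (d k)" by (rule norm_triangle_ineq)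
  then have "bracket k powr r * norm (c k + d k) \<le> bracket k powr r * norm (c k) + bracket k powr r * norm (d k)"
    unfolding distrib_left[symmetric] by (rule mult_left_mono) simp
  then have "(bracket k powr r * norm (c k + d k))\<^sup>2 \<le> (bracket k powr r * norm (c k) + bracket k powr r * norm (d k))\<^sup>2"
    by (rule power_mono) simp
  also have "\<dots> \<le> 2 * (bracket k powr r * norm (c k))\<^sup>2 + 2 * (bracket k powr r * norm (d k))\<^sup>2"
    using zero_le_power2[of "bracket k powr r * norm (c k) - bracket k powr r * norm (d k)"]
    by (simp add: power2_eq_square algebra_simps)
  finally show "(bracket k powr r * norm (c k + d k))\<^sup>2 \<le> \<dots>" .
qed simp

lemma hs_summable_scale: "hs_summable r c \<Longrightarrow> hs_summable r (\<lambda>k. a * c k)"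
  unfolding hs_summable_def
  by (drule summable_on_cmult_right[of _ _ "(norm a)\<^sup>2"]) (simp add: norm_mult power_mult_distrib mult_ac)

lemma hs_norm_triangle:
  assumes "hs_summable r c" "hs_summable r d"
  shows "hs_norm r (\<lambda>k. c k + d k) \<le> hs_norm r c + hs_norm r d"
proof -
  have n: "0 \<le> hs_norm r c + hs_norm r d" by (intro add_nonneg_nonneg hs_norm_nonneg)
  have fin: "L2_set (\<lambda>k. bracket k powr r * norm (c k)) F \<le> hs_norm r c" if "hs_summable r c" "finite F" for c F
    unfolding L2_set_def hs_norm_def
    by (intro real_sqrt_le_mono finite_sum_le_infsum) (use that in \<open>auto simp: hs_summable_def\<close>)
  have "(\<Sum>\<^sub>\<infinity>k. (bracket k powr r * norm (c k + d k))\<^sup>2) \<le> (hs_norm r c + hs_norm r d)\<^sup>2"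
  proof (rule infsum_le_finite_sums)
    show "(\<lambda>k. (bracket k powr r * norm (c k + d k))\<^sup>2) summable_on UNIV"
      using hs_summable_add[OF assms] by (simp add: hs_summable_def)
    fix F :: "int set" assume F: "finite F"
    have "L2_set (\<lambda>k. bracket k powr r * norm (c k + d k)) F
        \<le> L2_set (\<lambda>k. bracket k powr r * norm (c k) + bracket k powr r * norm (d k)) F"
      unfolding distrib_left[symmetric] by (intro L2_set_mono mult_left_mono norm_triangle_ineq) auto
    also have "\<dots> \<le> hs_norm r c + hs_norm r d"
      by (rule order_trans[OF L2_set_triangle_ineq add_mono[OF fin[OF assms(1) F] fin[OF assms(2) F]]])
    finally show "(\<Sum>k\<in>F. (bracket k powr r * norm (c k + d k))\<^sup>2) \<le> (hs_norm r c + hs_norm r d)\<^sup>2"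
      unfolding L2_set_def by (rule sqrt_le_D)
  qed
  then show ?thesis unfolding hs_norm_def[of r "\<lambda>k. c k + d k"] by (rule real_le_lsqrt[OF n])
qed

lemma hs_norm_uminus: "hs_norm r (\<lambda>k. - c k) = hs_norm r c"
  by (simp add: hs_norm_def)

lemma sobolev_cont_lincomb:
  assumes "f \<in> sobolev_cont r" "g \<in> sobolev_cont r"
  shows "(\<lambda>x. a * f x + b * g x) \<in> sobolev_cont r"
proof -
  have "fourier_coeff (\<lambda>x. a * f x + b * g x) = (\<lambda>k. of_real a * fourier_coeff f k + of_real b * fourier_coeff g k)"
    using assms by (auto simp: sobolev_cont_iff fourier_coeff_lincomb)
  then show ?thesis
    using assms unfolding sobolev_cont_iff by (auto intro!: continuous_intros hs_summable_add hs_summable_scale)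
qed

lemma sobolev_cont_diff:
  assumes "f \<in> sobolev_cont r" "g \<in> sobolev_cont r"
  shows "(\<lambda>x. f x - g x) \<in> sobolev_cont r"
    and "fourier_coeff (\<lambda>x. f x - g x) = (\<lambda>k. fourier_coeff f k - fourier_coeff g k)"
  using sobolev_cont_lincomb[OF assms, of 1 "- 1"] fourier_coeff_lincomb[of f g 1 "- 1"] assms
  by (auto simp: sobolev_cont_iff)

lemma sobolev_norm_triangle_diff:
  assumes "f \<in> sobolev_cont r" "g \<in> sobolev_cont r"
  shows "\<bar>sobolev_norm r f - sobolev_norm r g\<bar> \<le> sobolev_norm r (\<lambda>x. f x - g x)"
proof -
  let ?c = "fourier_coeff f" and ?d = "fourier_coeff g"
  have s: "hs_summable r ?c" "hs_summable r ?d" "hs_summable r (\<lambda>k. ?c k - ?d k)"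
    using assms sobolev_cont_diff[OF assms] by (auto simp: sobolev_cont_iff)
  have s': "hs_summable r (\<lambda>k. - (?c k - ?d k))" using hs_summable_scale[OF s(3), of "- 1"] by simp
  have "hs_norm r ?c \<le> hs_norm r (\<lambda>k. ?c k - ?d k) + hs_norm r ?d"
    using hs_norm_triangle[OF s(3) s(2)] by simp
  moreover have "hs_norm r ?d \<le> hs_norm r (\<lambda>k. ?c k - ?d k) + hs_norm r ?c"
    using hs_norm_triangle[OF s' s(1)] hs_norm_uminus[of r "\<lambda>k. ?c k - ?d k"] by simp
  ultimately show ?thesis unfolding sobolev_norm_eq sobolev_cont_diff(2)[OF assms] by linarith
qed

text \<open>Comparison with \<open>\<Sum> n\<^sup>q\<close> on each half of the integers.\<close>

lemma bracket_powr_summable: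
  assumes "q < - 1"
  shows "(\<lambda>k. bracket k powr q) summable_on UNIV"
proof -
  have n: "(\<lambda>n. bracket (int n) powr q) summable_on UNIV"
  proof -
    have "summable (\<lambda>n. bracket (int n) powr q)"
    proof (rule summable_comparison_test')
      show "summable (\<lambda>n. real n powr q)" using assms by (simp add: summable_real_powr_iff)
      fix n :: nat assume n: "1 \<le> n"
      have "1 * real n \<le> (2 * pi) * real n" using pi_gt3 by (intro mult_right_mono) auto
      also have "\<dots> \<le> bracket (int n)" using abs_le_bracket[of "int n"] by (simp add: abs_mult)
      finally have "bracket (int n) powr q \<le> real n powr q" using n assms by (intro powr_mono2') auto
      then show "norm (bracket (int n) powr q) \<le> real n powr q" by simp
    qed
    then show ?thesis by (simp add: summable_on_UNIV_nonneg_real_iff)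
  qed
  have "(\<lambda>k. bracket k powr q) summable_on (range int)"
    using n by (subst summable_on_reindex) (auto simp: o_def)
  moreover have "(\<lambda>k. bracket k powr q) summable_on (range (\<lambda>n. - int n))"
    using n by (subst summable_on_reindex) (auto simp: o_def inj_on_def)
  ultimately have "(\<lambda>k. bracket k powr q) summable_on (range int \<union> range (\<lambda>n. - int n))"
    by (rule summable_on_union)
  moreover have "range int \<union> range (\<lambda>n. - int n) = UNIV"
  proof -
    have "k \<in> range int \<union> range (\<lambda>n. - int n)" for k
      by (cases k rule: int_cases2) auto
    then show ?thesis by auto
  qed
  ultimately show ?thesis by simp
qed

text \<open>Cauchy--Schwarz against \<open>\<langle>2\<pi>k\<rangle>\<close> to the power \<open>\<theta> - r\<close>, which is square summable exactly when
\<open>r - \<theta> > 1/2\<close>.\<close>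

lemma hs_embedding:
  assumes "\<theta> + 1/2 < r"
  obtains C where "0 \<le> C"
    "\<And>c. hs_summable r c \<Longrightarrow> (\<lambda>k. bracket k powr \<theta> * norm (c k)) summable_on UNIV"
    "\<And>c. hs_summable r c \<Longrightarrow> (\<Sum>\<^sub>\<infinity>k. bracket k powr \<theta> * norm (c k)) \<le> C * hs_norm r c"
proof
  define C where "C = sqrt (\<Sum>\<^sub>\<infinity>k. (bracket k powr (\<theta> - r))\<^sup>2)"
  have sq: "(bracket k powr (\<theta> - r))\<^sup>2 = bracket k powr (2 * (\<theta> - r))" for k
    by (simp only: power2_eq_square powr_double[OF bracket_pos(1)])
  have s: "(\<lambda>k. (bracket k powr (\<theta> - r))\<^sup>2) summable_on UNIV"
    unfolding sq using assms by (intro bracket_powr_summable) auto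
  show "0 \<le> C" by (simp add: C_def infsum_nonneg)
  fix c assume c: "hs_summable r c"
  have e: "bracket k powr \<theta> * norm (c k) = bracket k powr (\<theta> - r) * (bracket k powr r * norm (c k))" for k
    by (simp add: mult.assoc[symmetric] powr_add[symmetric])
  show "(\<lambda>k. bracket k powr \<theta> * norm (c k)) summable_on UNIV"
    unfolding e by (rule cauchy_schwarz_infsum) (use s c in \<open>auto simp: hs_summable_def\<close>)
  show "(\<Sum>\<^sub>\<infinity>k. bracket k powr \<theta> * norm (c k)) \<le> C * hs_norm r c"
    unfolding e C_def hs_norm_def by (rule cauchy_schwarz_infsum) (use s c in \<open>auto simp: hs_summable_def\<close>)
qed

lemma hs_embedding_l1:
  assumes "1/2 < r"
  obtains C where "0 \<le> C" "\<And>c. hs_summable r c \<Longrightarrow> l1_summable c"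
    "\<And>c. hs_summable r c \<Longrightarrow> l1_norm c \<le> C * hs_norm r c"
proof -
  have r: "0 + 1/2 < r" using assms by simp
  obtain C where "0 \<le> C" "\<And>c. hs_summable r c \<Longrightarrow> (\<lambda>k. bracket k powr 0 * norm (c k)) summable_on UNIV"
    "\<And>c. hs_summable r c \<Longrightarrow> (\<Sum>\<^sub>\<infinity>k. bracket k powr 0 * norm (c k)) \<le> C * hs_norm r c"
    by (rule hs_embedding[OF r]) blast
  moreover have "bracket k powr 0 = 1" for k by simp
  ultimately show ?thesis using that[of C] by (simp add: l1_summable_def l1_norm_def)
qed

lemma hs_embedding_deriv_seq:
  assumes "3/2 < r"
  obtains C where "0 \<le> C" "\<And>c. hs_summable r c \<Longrightarrow> l1_summable (deriv_seq c)"
    "\<And>c. hs_summable r c \<Longrightarrow> l1_norm (deriv_seq c) \<le> C * hs_norm r c"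
proof -
  have r: "1 + 1/2 < r" using assms by simp
  obtain C where C: "0 \<le> C" "\<And>c. hs_summable r c \<Longrightarrow> (\<lambda>k. bracket k powr 1 * norm (c k)) summable_on UNIV"
    "\<And>c. hs_summable r c \<Longrightarrow> (\<Sum>\<^sub>\<infinity>k. bracket k powr 1 * norm (c k)) \<le> C * hs_norm r c"
    by (rule hs_embedding[OF r]) blast
  have le: "norm (deriv_seq c k) \<le> bracket k powr 1 * norm (c k)" for c k
    unfolding norm_deriv_seq using abs_le_bracket[of k] bracket_pos(1)[of k] by (simp add: mult_right_mono)
  have s: "l1_summable (deriv_seq c)" if "hs_summable r c" for c
    unfolding l1_summable_def by (rule summable_on_comparison_test[OF C(2)[OF that] le[of c]]) simp
  show ?thesis
  proof (rule that[OF C(1) s])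
    fix c assume c: "hs_summable r c"
    have "l1_norm (deriv_seq c) \<le> (\<Sum>\<^sub>\<infinity>k. bracket k powr 1 * norm (c k))"
      unfolding l1_norm_def
      by (intro infsum_mono le C(2)[OF c]) (use s[OF c] in \<open>simp add: l1_summable_def\<close>)
    then show "l1_norm (deriv_seq c) \<le> C * hs_norm r c" using C(3)[OF c] by simp
  qed
qed

lemma abs_le_l1_norm:
  assumes "continuous_on UNIV f" "\<And>x. f (x + 1) = f x" "l1_summable (fourier_coeff f)"
  shows "\<bar>f x\<bar> \<le> l1_norm (fourier_coeff f)"
proof -
  have s: "(\<lambda>k. norm (fourier_coeff f k)) summable_on UNIV" using assms by (simp add: l1_summable_def)
  have "norm (complex_of_real (f x)) \<le> (\<Sum>\<^sub>\<infinity>k. norm (fourier_coeff f k * fourier_mode k x))"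
    unfolding fourier_inversion[OF assms(1,2) s]
    by (rule norm_infsum_bound) (use s in \<open>simp add: norm_mult\<close>)
  then show ?thesis by (simp add: norm_mult l1_norm_def)
qed

lemma sobolev_cont_sup_bound:
  assumes "1/2 < r"
  obtains C where "0 \<le> C" "\<And>f x. f \<in> sobolev_cont r \<Longrightarrow> \<bar>f x\<bar> \<le> C * sobolev_norm r f"
proof -
  obtain C where C: "0 \<le> C" "\<And>c. hs_summable r c \<Longrightarrow> l1_summable c"
    "\<And>c. hs_summable r c \<Longrightarrow> l1_norm c \<le> C * hs_norm r c"
    using hs_embedding_l1[OF assms] by blast
  have "\<bar>f x\<bar> \<le> C * sobolev_norm r f" if "f \<in> sobolev_cont r" for f x
    using abs_le_l1_norm[of f x] C(2,3)[of "fourier_coeff f"] that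
    by (force simp: sobolev_cont_iff sobolev_norm_eq)
  with C(1) show ?thesis using that by blast
qed

lemma sobolev_cont_l1:
  assumes "1/2 < r" "f \<in> sobolev_cont r"
  shows "l1_summable (fourier_coeff f)"
  using hs_embedding_l1[OF assms(1)] assms(2) unfolding sobolev_cont_iff by metis

lemma sobolev_cont_deriv_seq_l1:
  assumes "3/2 < r" "f \<in> sobolev_cont r"
  shows "l1_summable (deriv_seq (fourier_coeff f))"
  using hs_embedding_deriv_seq[OF assms(1)] assms(2) unfolding sobolev_cont_iff by metis

lemma hs_norm_deriv_seq_le:
  assumes "hs_summable r c"
  shows "hs_summable (r - 1) (deriv_seq c)" "hs_norm (r - 1) (deriv_seq c) \<le> hs_norm r c"
proof -
  have le: "(bracket k powr (r - 1) * norm (deriv_seq c k))\<^sup>2 \<le> (bracket k powr r * norm (c k))\<^sup>2" for k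
  proof (rule power_mono)
    have "bracket k powr (r - 1) * norm (deriv_seq c k) \<le> bracket k powr (r - 1) * (bracket k * norm (c k))"
      unfolding norm_deriv_seq by (intro mult_left_mono mult_right_mono abs_le_bracket) auto
    also have "\<dots> = (bracket k powr (r - 1) * bracket k powr 1) * norm (c k)" by simp
    also have "\<dots> = bracket k powr r * norm (c k)" unfolding powr_add[symmetric] by simp
    finally show "bracket k powr (r - 1) * norm (deriv_seq c k) \<le> bracket k powr r * norm (c k)" .
  qed simp
  show s: "hs_summable (r - 1) (deriv_seq c)"
    using assms unfolding hs_summable_def by (rule summable_on_comparison_test[OF _ le]) simp
  show "hs_norm (r - 1) (deriv_seq c) \<le> hs_norm r c"
    unfolding hs_norm_def by (intro real_sqrt_le_mono infsum_mono le) (use s assms in \<open>auto simp: hs_summable_def\<close>)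
qed

lemma sobolev_cont_deriv:
  assumes r: "3/2 < r" and f: "f \<in> sobolev_cont r"
  shows "(f has_real_derivative deriv f x) (at x)"
    and "deriv f \<in> sobolev_cont (r - 1)"
    and "fourier_coeff (deriv f) = deriv_seq (fourier_coeff f)"
    and "sobolev_norm (r - 1) (deriv f) \<le> sobolev_norm r f"
proof -
  have c: "continuous_on UNIV f" and p: "\<And>x. f (x + 1) = f x" and h: "hs_summable r (fourier_coeff f)"
    using f by (auto simp: sobolev_cont_iff)
  have s: "(\<lambda>k. norm (fourier_coeff f k)) summable_on UNIV"
    using sobolev_cont_l1[OF _ f] r by (simp add: l1_summable_def)
  have s': "(\<lambda>k. norm (2 * pi * of_int k * fourier_coeff f k)) summable_on UNIV"
    using sobolev_cont_deriv_seq_l1[OF r f] by (simp add: l1_summable_def norm_deriv_seq norm_mult abs_mult)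
  note F = fourier_series_derivative[OF c p s s']
  show d: "(f has_real_derivative deriv f x) (at x)" for x by (rule F(1))
  show fc: "fourier_coeff (deriv f) = deriv_seq (fourier_coeff f)" using F(3) by (auto simp: deriv_seq_def)
  have "deriv f (x + 1) = deriv f x" for x
  proof -
    have "((\<lambda>x. f (x + 1)) has_real_derivative deriv f (x + 1)) (at x)"
      using d[of "x + 1"] by (simp add: DERIV_shift)
    then have "(f has_real_derivative deriv f (x + 1)) (at x)" by (simp add: p)
    then show ?thesis using d[of x] DERIV_unique by blast
  qed
  then show "deriv f \<in> sobolev_cont (r - 1)"
    using F(2) hs_norm_deriv_seq_le(1)[OF h] by (simp add: sobolev_cont_iff fc)
  show "sobolev_norm (r - 1) (deriv f) \<le> sobolev_norm r f"
    using hs_norm_deriv_seq_le(2)[OF h] by (simp add: sobolev_norm_eq fc)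
qed

lemma joint_continuity:
  fixes v :: "real \<Rightarrow> real \<Rightarrow> real" and b :: "real \<Rightarrow> real \<Rightarrow> real"
  assumes c: "\<And>t. t \<in> I \<Longrightarrow> continuous_on UNIV (v t)"
    and b: "\<And>t. t \<in> I \<Longrightarrow> (b t \<longlongrightarrow> 0) (at t within I)"
    and le: "\<And>t \<tau> x. t \<in> I \<Longrightarrow> \<tau> \<in> I \<Longrightarrow> \<bar>v \<tau> x - v t x\<bar> \<le> b t \<tau>"
  shows "continuous_on (I \<times> UNIV) (\<lambda>(t, x). v t x)"
  unfolding continuous_on_iff
proof (intro ballI allI impI)
  fix p :: "real \<times> real" and e :: real assume p: "p \<in> I \<times> UNIV" and e: "0 < e"
  obtain t x where tx: "p = (t, x)" "t \<in> I" using p by auto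
  have "\<forall>\<^sub>F \<tau> in at t within I. b t \<tau> < e/2" using order_tendstoD(2)[OF b[OF tx(2)], of "e/2"] e by simp
  then obtain d1 where d1: "d1 > 0" "\<And>\<tau>. \<tau> \<in> I \<Longrightarrow> \<tau> \<noteq> t \<Longrightarrow> dist \<tau> t < d1 \<Longrightarrow> b t \<tau> < e/2"
    unfolding eventually_at by blast
  obtain d2 where d2: "d2 > 0" "\<And>y. dist y x < d2 \<Longrightarrow> dist (v t y) (v t x) < e/2"
    using c[OF tx(2)] e unfolding continuous_on_iff by (metis UNIV_I half_gt_zero)
  have "dist (case q of (t, x) \<Rightarrow> v t x) (case p of (t, x) \<Rightarrow> v t x) < e"
    if q: "q \<in> I \<times> UNIV" "dist q p < min d1 d2" for q
  proof -
    obtain \<tau> y where qy: "q = (\<tau>, y)" "\<tau> \<in> I" using q by auto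
    have "dist \<tau> t < d1" "dist y x < d2"
      using q(2) dist_fst_le[of q p] dist_snd_le[of q p] by (auto simp: qy tx)
    then have "\<bar>v \<tau> y - v t y\<bar> < e/2" "\<bar>v t y - v t x\<bar> < e/2"
      using d1(2)[OF qy(2)] le[OF tx(2) qy(2), of y] d2(2)[of y] e
      by (cases "\<tau> = t"; force simp: dist_real_def)+
    then have "\<bar>v \<tau> y - v t x\<bar> < e" by linarith
    then show ?thesis by (simp add: qy tx dist_real_def)
  qed
  then show "\<exists>d>0. \<forall>q\<in>I \<times> UNIV. dist q p < d \<longrightarrow> dist (case q of (t, x) \<Rightarrow> v t x) (case p of (t, x) \<Rightarrow> v t x) < e"
    using d1(1) d2(1) by (intro exI[of _ "min d1 d2"]) auto
qed

lemma sobolev_C0_joint_continuous: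
  assumes r: "1/2 < r" and v: "sobolev_C0 r I v"
  shows "continuous_on (I \<times> UNIV) (\<lambda>(t, x). v t x)"
proof -
  obtain C where C: "0 \<le> C" "\<And>f x. f \<in> sobolev_cont r \<Longrightarrow> \<bar>f x\<bar> \<le> C * sobolev_norm r f"
    using sobolev_cont_sup_bound[OF r] by blast
  have m: "\<And>t. t \<in> I \<Longrightarrow> v t \<in> sobolev_cont r"
    and l: "\<And>t. t \<in> I \<Longrightarrow> ((\<lambda>\<tau>. sobolev_norm r (\<lambda>x. v \<tau> x - v t x)) \<longlongrightarrow> 0) (at t within I)"
    using v by (auto simp: sobolev_C0_def)
  show ?thesis
  proof (rule joint_continuity[where b="\<lambda>t \<tau>. C * sobolev_norm r (\<lambda>x. v \<tau> x - v t x)"])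
    show "continuous_on UNIV (v t)" if "t \<in> I" for t using m[OF that] by (simp add: sobolev_cont_iff)
    show "((\<lambda>\<tau>. C * sobolev_norm r (\<lambda>x. v \<tau> x - v t x)) \<longlongrightarrow> 0) (at t within I)" if "t \<in> I" for t
      using tendsto_mult_right_zero[OF l[OF that]] .
    show "\<bar>v \<tau> x - v t x\<bar> \<le> C * sobolev_norm r (\<lambda>x. v \<tau> x - v t x)" if "t \<in> I" "\<tau> \<in> I" for t \<tau> x
      using C(2)[OF sobolev_cont_diff(1)[OF m[OF that(2)] m[OF that(1)]]] .
  qed
qed

lemma deriv_diff_sobolev:
  assumes "3/2 < r" "f \<in> sobolev_cont r" "g \<in> sobolev_cont r"
  shows "deriv (\<lambda>x. f x - g x) = (\<lambda>x. deriv f x - deriv g x)"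
  using sobolev_cont_deriv(1)[OF assms(1,2)] sobolev_cont_deriv(1)[OF assms(1,3)]
  by (auto intro!: DERIV_imp_deriv derivative_intros)

lemma sobolev_C0_deriv:
  assumes r: "3/2 < r" and v: "sobolev_C0 r I v"
  shows "sobolev_C0 (r - 1) I (\<lambda>t. deriv (v t))"
proof -
  have m: "\<And>t. t \<in> I \<Longrightarrow> v t \<in> sobolev_cont r"
    and l: "\<And>t. t \<in> I \<Longrightarrow> ((\<lambda>\<tau>. sobolev_norm r (\<lambda>x. v \<tau> x - v t x)) \<longlongrightarrow> 0) (at t within I)"
    using v by (auto simp: sobolev_C0_def)
  have "((\<lambda>\<tau>. sobolev_norm (r - 1) (\<lambda>x. deriv (v \<tau>) x - deriv (v t) x)) \<longlongrightarrow> 0) (at t within I)" if t: "t \<in> I" for t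
  proof (rule tendsto_sandwich[OF _ _ tendsto_const l[OF t]])
    show "\<forall>\<^sub>F \<tau> in at t within I. 0 \<le> sobolev_norm (r - 1) (\<lambda>x. deriv (v \<tau>) x - deriv (v t) x)"
      by (simp add: sobolev_norm_eq hs_norm_nonneg)
    have "sobolev_norm (r - 1) (\<lambda>x. deriv (v \<tau>) x - deriv (v t) x) \<le> sobolev_norm r (\<lambda>x. v \<tau> x - v t x)" if "\<tau> \<in> I" for \<tau>
      using sobolev_cont_deriv(4)[OF r sobolev_cont_diff(1)[OF m[OF that] m[OF t]]]
      unfolding deriv_diff_sobolev[OF r m[OF that] m[OF t]] .
    then show "\<forall>\<^sub>F \<tau> in at t within I. sobolev_norm (r - 1) (\<lambda>x. deriv (v \<tau>) x - deriv (v t) x)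
        \<le> sobolev_norm r (\<lambda>x. v \<tau> x - v t x)"
      by (auto simp: eventually_at_filter)
  qed
  then show ?thesis using m sobolev_cont_deriv(2)[OF r] by (simp add: sobolev_C0_def)
qed

text \<open>Spatial differentiation commutes with the difference quotients in time and is bounded from \<open>H\<^sup>r\<close> to
\<open>H\<^sup>r\<^sup>-\<^sup>1\<close>.\<close>

lemma sobolev_C1_deriv:
  assumes r: "3/2 < r" and v: "sobolev_C1 r I v v'"
  shows "sobolev_C1 (r - 1) I (\<lambda>t. deriv (v t)) (\<lambda>t. deriv (v' t))"
proof -
  have c0: "sobolev_C0 r I v" "sobolev_C0 r I v'" using v by (auto simp: sobolev_C1_def)
  have m: "\<And>t. t \<in> I \<Longrightarrow> v t \<in> sobolev_cont r" "\<And>t. t \<in> I \<Longrightarrow> v' t \<in> sobolev_cont r"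
    and l: "\<And>t. t \<in> I \<Longrightarrow> ((\<lambda>\<tau>. sobolev_norm r (\<lambda>x. (v \<tau> x - v t x) / (\<tau> - t) - v' t x)) \<longlongrightarrow> 0) (at t within I)"
    using v by (auto simp: sobolev_C0_def sobolev_C1_def)
  have "((\<lambda>\<tau>. sobolev_norm (r - 1) (\<lambda>x. (deriv (v \<tau>) x - deriv (v t) x) / (\<tau> - t) - deriv (v' t) x)) \<longlongrightarrow> 0)
      (at t within I)" if t: "t \<in> I" for t
  proof (rule tendsto_sandwich[OF _ _ tendsto_const l[OF t]])
    show "\<forall>\<^sub>F \<tau> in at t within I. 0 \<le> sobolev_norm (r - 1) (\<lambda>x. (deriv (v \<tau>) x - deriv (v t) x) / (\<tau> - t) - deriv (v' t) x)"
      by (simp add: sobolev_norm_eq hs_norm_nonneg)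
    have "sobolev_norm (r - 1) (\<lambda>x. (deriv (v \<tau>) x - deriv (v t) x) / (\<tau> - t) - deriv (v' t) x)
        \<le> sobolev_norm r (\<lambda>x. (v \<tau> x - v t x) / (\<tau> - t) - v' t x)" if \<tau>: "\<tau> \<in> I" for \<tau>
    proof -
      have "(\<lambda>x. (1 / (\<tau> - t)) * (v \<tau> x - v t x) + (-1) * v' t x) \<in> sobolev_cont r"
        by (intro sobolev_cont_lincomb sobolev_cont_diff(1) m t \<tau>)
      then have q: "(\<lambda>x. (v \<tau> x - v t x) / (\<tau> - t) - v' t x) \<in> sobolev_cont r" by simp
      have "deriv (\<lambda>x. (v \<tau> x - v t x) / (\<tau> - t) - v' t x)
          = (\<lambda>x. (deriv (v \<tau>) x - deriv (v t) x) / (\<tau> - t) - deriv (v' t) x)"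
      proof
        fix x
        have "((\<lambda>x. (1 / (\<tau> - t)) * (v \<tau> x - v t x) - v' t x) has_real_derivative
            (1 / (\<tau> - t)) * (deriv (v \<tau>) x - deriv (v t) x) - deriv (v' t) x) (at x)"
          by (intro DERIV_diff DERIV_cmult sobolev_cont_deriv(1)[OF r] m t \<tau>)
        then show "deriv (\<lambda>x. (v \<tau> x - v t x) / (\<tau> - t) - v' t x) x
          = (deriv (v \<tau>) x - deriv (v t) x) / (\<tau> - t) - deriv (v' t) x"
          by (intro DERIV_imp_deriv) simp
      qed
      with sobolev_cont_deriv(4)[OF r q] show ?thesis by simp
    qed
    then show "\<forall>\<^sub>F \<tau> in at t within I. sobolev_norm (r - 1) (\<lambda>x. (deriv (v \<tau>) x - deriv (v t) x) / (\<tau> - t) - deriv (v' t) x)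
        \<le> sobolev_norm r (\<lambda>x. (v \<tau> x - v t x) / (\<tau> - t) - v' t x)"
      by (auto simp: eventually_at_filter)
  qed
  then show ?thesis using sobolev_C0_deriv[OF r] c0 by (simp add: sobolev_C1_def)
qed

lemma sobolev_C1_pointwise:
  assumes r: "1/2 < r" and v: "sobolev_C1 r I v v'" and t: "t \<in> I"
  shows "((\<lambda>t. v t x) has_real_derivative v' t x) (at t within I)"
proof -
  obtain C where C: "0 \<le> C" "\<And>f x. f \<in> sobolev_cont r \<Longrightarrow> \<bar>f x\<bar> \<le> C * sobolev_norm r f"
    using sobolev_cont_sup_bound[OF r] by blast
  have m: "\<And>t. t \<in> I \<Longrightarrow> v t \<in> sobolev_cont r" "\<And>t. t \<in> I \<Longrightarrow> v' t \<in> sobolev_cont r"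
    and l: "((\<lambda>\<tau>. sobolev_norm r (\<lambda>x. (v \<tau> x - v t x) / (\<tau> - t) - v' t x)) \<longlongrightarrow> 0) (at t within I)"
    using v t by (auto simp: sobolev_C0_def sobolev_C1_def)
  have "\<bar>(v \<tau> x - v t x) / (\<tau> - t) - v' t x\<bar> \<le> C * sobolev_norm r (\<lambda>x. (v \<tau> x - v t x) / (\<tau> - t) - v' t x)"
    if \<tau>: "\<tau> \<in> I" for \<tau>
  proof -
    have "(\<lambda>x. (1 / (\<tau> - t)) * (v \<tau> x - v t x) + (-1) * v' t x) \<in> sobolev_cont r"
      by (intro sobolev_cont_lincomb sobolev_cont_diff(1) m t \<tau>)
    then have "(\<lambda>x. (v \<tau> x - v t x) / (\<tau> - t) - v' t x) \<in> sobolev_cont r" by simp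
    from C(2)[OF this] show ?thesis .
  qed
  then have "\<forall>\<^sub>F \<tau> in at t within I. norm ((v \<tau> x - v t x) / (\<tau> - t) - v' t x)
      \<le> C * sobolev_norm r (\<lambda>x. (v \<tau> x - v t x) / (\<tau> - t) - v' t x)"
    by (auto simp: eventually_at_filter)
  then have "((\<lambda>\<tau>. (v \<tau> x - v t x) / (\<tau> - t) - v' t x) \<longlongrightarrow> 0) (at t within I)"
    by (rule Lim_null_comparison) (rule tendsto_mult_right_zero[OF l])
  then show ?thesis unfolding has_field_derivative_iff by (simp add: LIM_zero_iff)
qed

lemma sobolev_C0_norm_continuous:
  assumes v: "sobolev_C0 r I v"
  shows "continuous_on I (\<lambda>t. sobolev_norm r (v t))"
  unfolding continuous_on_def
proof
  fix t assume t: "t \<in> I"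
  have m: "\<And>t. t \<in> I \<Longrightarrow> v t \<in> sobolev_cont r"
    and l: "((\<lambda>\<tau>. sobolev_norm r (\<lambda>x. v \<tau> x - v t x)) \<longlongrightarrow> 0) (at t within I)"
    using v t by (auto simp: sobolev_C0_def)
  have "\<forall>\<^sub>F \<tau> in at t within I. norm (sobolev_norm r (v \<tau>) - sobolev_norm r (v t)) \<le> sobolev_norm r (\<lambda>x. v \<tau> x - v t x)"
    using sobolev_norm_triangle_diff[OF m m[OF t]] by (auto simp: eventually_at_filter)
  then have "((\<lambda>\<tau>. sobolev_norm r (v \<tau>) - sobolev_norm r (v t)) \<longlongrightarrow> 0) (at t within I)"
    by (rule Lim_null_comparison[OF _ l])
  then show "((\<lambda>t. sobolev_norm r (v t)) \<longlongrightarrow> sobolev_norm r (v t)) (at t within I)"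
    by (simp add: LIM_zero_iff)
qed

section \<open>Maximum principle and uniform gradient bounds\<close>

text \<open>At a positive maximum over space and time the spatial differential vanishes and the time derivative,
taken from the left, is not negative, which contradicts \<open>strict\<close>. The compact set \<open>K\<close> guarantees that a positive supremum is attained: in the applications
it comes from periodicity and from decay away from the diagonal.\<close>

lemma transport_max_principle:
  fixes Q Qt :: "real \<Rightarrow> 'a::real_normed_vector \<Rightarrow> real"
    and Q' :: "real \<Rightarrow> 'a \<Rightarrow> 'a \<Rightarrow> real" and b :: "real \<Rightarrow> 'a \<Rightarrow> 'a"
  assumes K: "compact K"
    and cont: "continuous_on ({0..\<tau>} \<times> UNIV) (\<lambda>(t, x). Q t x)"
    and dom: "\<And>t x. t \<in> {0..\<tau>} \<Longrightarrow> 0 < Q t x \<Longrightarrow> \<exists>y\<in>K. Q t x \<le> Q t y"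
    and init: "\<And>x. Q 0 x \<le> 0"
    and dt: "\<And>t x. t \<in> {0<..\<tau>} \<Longrightarrow> ((\<lambda>t. Q t x) has_real_derivative Qt t x) (at t within {0..\<tau>})"
    and dx: "\<And>t x. t \<in> {0<..\<tau>} \<Longrightarrow> (Q t has_derivative Q' t x) (at x)"
    and strict: "\<And>t x. t \<in> {0<..\<tau>} \<Longrightarrow> 0 < Q t x \<Longrightarrow> Qt t x + Q' t x (b t x) < 0"
    and t: "t \<in> {0..\<tau>}"
  shows "Q t x \<le> 0"
proof (rule ccontr)
  assume "\<not> Q t x \<le> 0"
  then have pos: "Q t x > 0" by simp
  have ne: "{0..\<tau>} \<times> K \<noteq> {}" using dom[OF t pos] t by auto
  have "compact ({0..\<tau>} \<times> K)" by (intro compact_Times K) auto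
  moreover have "continuous_on ({0..\<tau>} \<times> K) (\<lambda>(t, x). Q t x)"
    by (rule continuous_on_subset[OF cont]) auto
  ultimately obtain p where p: "p \<in> {0..\<tau>} \<times> K"
    and pmax: "\<forall>y\<in>{0..\<tau>} \<times> K. (case y of (t, x) \<Rightarrow> Q t x) \<le> (case p of (t, x) \<Rightarrow> Q t x)"
    using continuous_attains_sup[OF _ ne] by blast
  obtain s y where sy: "p = (s, y)" by (cases p)
  have s: "s \<in> {0..\<tau>}" using p sy by auto
  have maxK: "Q t' x' \<le> Q s y" if "t' \<in> {0..\<tau>}" "x' \<in> K" for t' x'
    using pmax that sy by auto
  have spos: "0 < Q s y" using dom[OF t pos] maxK[OF t] pos by force
  have max: "Q t' x' \<le> Q s y" if "t' \<in> {0..\<tau>}" for t' x'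
  proof (cases "0 < Q t' x'")
    case True
    then show ?thesis using dom[OF that True] maxK[OF that] by force
  next
    case False
    then show ?thesis using spos by simp
  qed
  have "s \<noteq> 0" using init[of y] spos by auto
  then have s': "s \<in> {0<..\<tau>}" using s by simp
  have "Q' s y = (\<lambda>v. 0)"
    by (rule differential_zero_maxmin[OF _ open_UNIV dx[OF s']]) (use max[OF s] in auto)
  then have "Qt s y < 0" using strict[OF s' spos] by simp
  from has_real_derivative_neg_dec_left[OF dt[OF s'] this]
  obtain d where d: "d > 0" "\<And>h. h > 0 \<Longrightarrow> s - h \<in> {0..\<tau>} \<Longrightarrow> h < d \<Longrightarrow> Q s y < Q (s - h) y" by blast
  define h where "h = min (d/2) s"
  have h: "h > 0" "h < d" "s - h \<in> {0..\<tau>}" using d(1) s' by (auto simp: h_def min_def)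
  show False using d(2)[OF h(1,3,2)] max[OF h(3), of y] by simp
qed

lemma derivative_le_of_lipschitz:
  fixes f :: "real \<Rightarrow> real"
  assumes d: "(f has_real_derivative D) (at x)" and l: "\<And>y. (f y - f x)\<^sup>2 \<le> C * (y - x)\<^sup>2"
  shows "D\<^sup>2 \<le> C"
proof -
  have "((\<lambda>y. (f y - f x) / (y - x)) \<longlongrightarrow> D) (at x)" using d by (simp add: has_field_derivative_iff)
  then have "((\<lambda>y. ((f y - f x) / (y - x))\<^sup>2) \<longlongrightarrow> D\<^sup>2) (at x)" by (intro tendsto_intros)
  moreover have "\<forall>\<^sub>F y in at x. ((f y - f x) / (y - x))\<^sup>2 \<le> C"
    unfolding eventually_at_filter
    by (intro always_eventually) (use l in \<open>auto simp: power_divide divide_le_eq\<close>)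
  ultimately show ?thesis by (rule tendsto_upperbound) simp
qed

text \<open>The setting of the pointwise bounds: the equations for \<open>w = \<partial>\<^sub>x u\<close> and \<open>\<rho>\<close> in the classical sense,
with all derivatives that occur given as jointly continuous functions. The suffixes \<open>t\<close> and \<open>x\<close>
denote partial derivatives.\<close>

locale classical_solution =
  fixes T \<kappa> :: real and u w wt wx \<rho> \<rho>t \<rho>x :: "real \<Rightarrow> real \<Rightarrow> real" and a :: "real \<Rightarrow> real"
  assumes T: "0 < T" and \<kappa>: "0 < \<kappa>"
    and cont: "continuous_on ({0..<T} \<times> UNIV) (\<lambda>(t, x). u t x)"
      "continuous_on ({0..<T} \<times> UNIV) (\<lambda>(t, x). w t x)"
      "continuous_on ({0..<T} \<times> UNIV) (\<lambda>(t, x). wt t x)"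
      "continuous_on ({0..<T} \<times> UNIV) (\<lambda>(t, x). wx t x)"
      "continuous_on ({0..<T} \<times> UNIV) (\<lambda>(t, x). \<rho> t x)"
      "continuous_on ({0..<T} \<times> UNIV) (\<lambda>(t, x). \<rho>t t x)"
      "continuous_on ({0..<T} \<times> UNIV) (\<lambda>(t, x). \<rho>x t x)"
    and per: "\<And>t x. t \<in> {0..<T} \<Longrightarrow> u t (x + 1) = u t x"
      "\<And>t x. t \<in> {0..<T} \<Longrightarrow> w t (x + 1) = w t x"
      "\<And>t x. t \<in> {0..<T} \<Longrightarrow> wx t (x + 1) = wx t x"
      "\<And>t x. t \<in> {0..<T} \<Longrightarrow> \<rho> t (x + 1) = \<rho> t x"
      "\<And>t x. t \<in> {0..<T} \<Longrightarrow> \<rho>x t (x + 1) = \<rho>x t x"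
    and dx: "\<And>t x. t \<in> {0..<T} \<Longrightarrow> (u t has_real_derivative w t x) (at x)"
      "\<And>t x. t \<in> {0..<T} \<Longrightarrow> (w t has_real_derivative wx t x) (at x)"
      "\<And>t x. t \<in> {0..<T} \<Longrightarrow> (\<rho> t has_real_derivative \<rho>x t x) (at x)"
    and dt: "\<And>t x. t \<in> {0..<T} \<Longrightarrow> ((\<lambda>t. w t x) has_real_derivative wt t x) (at t within {0..<T})"
      "\<And>t x. t \<in> {0..<T} \<Longrightarrow> ((\<lambda>t. \<rho> t x) has_real_derivative \<rho>t t x) (at t within {0..<T})"
    and eq_w: "\<And>t x. t \<in> {0<..<T} \<Longrightarrow>
        wt t x + u t x * wx t x = \<kappa> / 2 * (\<rho> t x)\<^sup>2 - (w t x)\<^sup>2 / 2 + a t"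
    and eq_\<rho>: "\<And>t x. t \<in> {0<..<T} \<Longrightarrow> \<rho>t t x + u t x * \<rho>x t x = - w t x * \<rho> t x"
    and mean: "\<And>t. t \<in> {0..<T} \<Longrightarrow>
        a t = - (\<kappa> / 2) * integral {0..1} (\<lambda>x. (\<rho> t x)\<^sup>2) - 1 / 2 * integral {0..1} (\<lambda>x. (w t x)\<^sup>2)"
begin

lemma joint_cont:
  assumes f: "continuous_on ({0..<T} \<times> UNIV) (\<lambda>(t, x). f t x)"
    and g: "continuous_on S g" "\<And>z. z \<in> S \<Longrightarrow> g z \<in> {0..<T}" and h: "continuous_on S h"
  shows "continuous_on S (\<lambda>z. f (g z) (h z) :: real)"
proof -
  have "continuous_on S (\<lambda>z. (\<lambda>(t, x). f t x) (g z, h z))"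
    by (rule continuous_on_compose2[OF f]) (use g in \<open>auto intro!: continuous_on_Pair h\<close>)
  then show ?thesis by simp
qed

lemmas cont_intros = joint_cont[OF cont(1)] joint_cont[OF cont(2)] joint_cont[OF cont(3)]
  joint_cont[OF cont(4)] joint_cont[OF cont(5)] joint_cont[OF cont(6)] joint_cont[OF cont(7)]

definition energy :: "real \<Rightarrow> real" where
  "energy t = integral {0..1} (\<lambda>x. (w t x)\<^sup>2 + \<kappa> * (\<rho> t x)\<^sup>2)"

lemma mean_eq_energy:
  assumes t: "t \<in> {0..<T}"
  shows "a t = - energy t / 2"
proof -
  have "energy t = integral {0..1} (\<lambda>x. (w t x)\<^sup>2) + \<kappa> * integral {0..1} (\<lambda>x. (\<rho> t x)\<^sup>2)"
    unfolding energy_def integral_mult_right[symmetric]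
    by (rule integral_add) (use t in \<open>auto intro!: integrable_continuous_interval continuous_intros cont_intros\<close>)
  then show ?thesis using mean[OF t] by (simp add: field_simps)
qed

lemma energy_has_derivative:
  assumes t: "t \<in> {0..<T}"
  shows "(energy has_real_derivative integral {0..1} (\<lambda>x. 2 * w t x * wt t x + \<kappa> * (2 * \<rho> t x * \<rho>t t x)))
           (at t within {0..<T})"
proof -
  have "((\<lambda>t. integral (cbox 0 1) (\<lambda>x. (w t x)\<^sup>2 + \<kappa> * (\<rho> t x)\<^sup>2)) has_real_derivative
      integral (cbox 0 1) (\<lambda>x. 2 * w t x * wt t x + \<kappa> * (2 * \<rho> t x * \<rho>t t x))) (at t within {0..<T})"
  proof (rule leibniz_rule_field_derivative[OF _ _ _ t])
    show "((\<lambda>t. (w t x)\<^sup>2 + \<kappa> * (\<rho> t x)\<^sup>2) has_real_derivative 2 * w t x * wt t x + \<kappa> * (2 * \<rho> t x * \<rho>t t x))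
        (at t within {0..<T})" if "t \<in> {0..<T}" for t x
      using that by (auto intro!: derivative_eq_intros dt)
    show "(\<lambda>x. (w t x)\<^sup>2 + \<kappa> * (\<rho> t x)\<^sup>2) integrable_on cbox 0 1" if "t \<in> {0..<T}" for t
      using that by (auto intro!: integrable_continuous_interval continuous_intros cont_intros)
    show "continuous_on ({0..<T} \<times> cbox 0 1) (\<lambda>(t, x). 2 * w t x * wt t x + \<kappa> * (2 * \<rho> t x * \<rho>t t x))"
      unfolding case_prod_beta by (auto intro!: continuous_intros cont_intros)
  qed auto
  then show ?thesis by (simp add: energy_def[abs_def])
qed

text \<open>By the equations, the time derivative of the energy density is the \<open>x\<close>-derivative of the periodic
function \<open>?F\<close>. The equations hold for positive times only, so constancy up to time \<open>0\<close> comes from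
continuity.\<close>

lemma energy_const:
  assumes t: "t \<in> {0..<T}"
  shows "energy t = energy 0"
proof (cases "t = 0")
  case False
  have zero: "integral {0..1} (\<lambda>x. 2 * w s x * wt s x + \<kappa> * (2 * \<rho> s x * \<rho>t s x)) = 0"
    if s: "0 < s" "s < t" for s
  proof -
    have s0: "s \<in> {0..<T}" "s \<in> {0<..<T}" using s t by auto
    let ?F = "\<lambda>x. - (u s x * ((w s x)\<^sup>2 + \<kappa> * (\<rho> s x)\<^sup>2)) + 2 * a s * u s x"
    have "2 * w s x * wt s x + \<kappa> * (2 * \<rho> s x * \<rho>t s x)
       = - (w s x * ((w s x)\<^sup>2 + \<kappa> * (\<rho> s x)\<^sup>2) + u s x * (2 * w s x * wx s x + \<kappa> * (2 * \<rho> s x * \<rho>x s x)))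
         + 2 * a s * w s x" for x
    proof -
      have 1: "wt s x = \<kappa> / 2 * (\<rho> s x)\<^sup>2 - (w s x)\<^sup>2 / 2 + a s - u s x * wx s x"
        using eq_w[OF s0(2), of x] by simp
      have 2: "\<rho>t s x = - w s x * \<rho> s x - u s x * \<rho>x s x" using eq_\<rho>[OF s0(2), of x] by simp
      show ?thesis unfolding 1 2 by (simp add: field_simps power2_eq_square)
    qed
    then have "((\<lambda>x. 2 * w s x * wt s x + \<kappa> * (2 * \<rho> s x * \<rho>t s x)) has_integral (?F 1 - ?F 0)) {0..1}"
      by (intro fundamental_theorem_of_calculus)
         (auto simp: has_real_derivative_iff_has_vector_derivative[symmetric]
           intro!: derivative_eq_intros has_field_derivative_at_within[OF dx(1)[OF s0(1)]]
             has_field_derivative_at_within[OF dx(2)[OF s0(1)]] has_field_derivative_at_within[OF dx(3)[OF s0(1)]])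
    moreover have "?F 1 = ?F 0"
      using per(1)[OF s0(1), of 0] per(2)[OF s0(1), of 0] per(4)[OF s0(1), of 0] by simp
    ultimately show ?thesis by (simp add: integral_unique)
  qed
  have t0: "0 < t" using False t by simp
  show ?thesis
  proof (rule DERIV_isconst_end[OF t0])
    show "continuous_on {0..t} energy"
      using t by (intro continuous_on_subset[OF DERIV_continuous_on[OF energy_has_derivative]]) auto
    show "(energy has_real_derivative 0) (at s)" if s: "0 < s" "s < t" for s
    proof -
      have "(energy has_real_derivative 0) (at s within {0..<T})"
        using energy_has_derivative[of s] zero[OF s] s t by simp
      then have "(energy has_real_derivative 0) (at s within {0<..<T})"
        by (rule has_field_derivative_subset) auto
      then show ?thesis using at_within_open[of s "{0<..<T}"] s t by simp
    qed
  qed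
qed simp

lemma has_x_derivative:
  "t \<in> {0..<T} \<Longrightarrow> (u t has_derivative (\<lambda>h. h * w t x)) (at x)"
  "t \<in> {0..<T} \<Longrightarrow> (w t has_derivative (\<lambda>h. h * wx t x)) (at x)"
  "t \<in> {0..<T} \<Longrightarrow> (\<rho> t has_derivative (\<lambda>h. h * \<rho>x t x)) (at x)"
  by (rule has_derivative_eq_rhs[OF dx(1)[unfolded has_field_derivative_def]], auto,
      rule has_derivative_eq_rhs[OF dx(2)[unfolded has_field_derivative_def]], auto,
      rule has_derivative_eq_rhs[OF dx(3)[unfolded has_field_derivative_def]], auto)

lemma periodic_bounded_on:
  fixes f :: "real \<Rightarrow> real \<Rightarrow> real"
  assumes "continuous_on ({0..<T} \<times> UNIV) (\<lambda>(t, x). f t x)"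
    "\<And>t x. t \<in> {0..<T} \<Longrightarrow> f t (x + 1) = f t x" "\<tau> < T"
  obtains B where "0 < B" "\<And>t x. t \<in> {0..\<tau>} \<Longrightarrow> \<bar>f t x\<bar> \<le> B"
proof -
  have c: "continuous_on ({0..\<tau>} \<times> UNIV) (\<lambda>(t, x). f t x)"
    by (rule continuous_on_subset[OF assms(1)]) (use assms(3) in auto)
  have p: "f t (x + 1) = f t x" if "t \<in> {0..\<tau>}" for t x using assms that by auto
  show ?thesis by (rule periodic_bounded[OF c]) (use p that in blast)+
qed

text \<open>By conservation of energy, \<open>H = \<kappa> \<rho>\<^sup>2 + E + w\<^sup>2\<close> and \<open>\<rho>\<close> both solve \<open>D f = - w f\<close>; here the value
\<open>a = -E/2\<close> matters. So the function \<open>H\<^sup>2 - K\<^sup>2 \<rho>\<^sup>2\<close> solves \<open>D G = - 2 w G\<close> and cannot become positive.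
This expresses the transport of \<open>H / \<rho>\<close> without dividing by \<open>\<rho>\<close>.\<close>

lemma transported_bound:
  assumes K: "\<And>x. (\<kappa> * (\<rho> 0 x)\<^sup>2 + energy 0 + (w 0 x)\<^sup>2)\<^sup>2 \<le> K\<^sup>2 * (\<rho> 0 x)\<^sup>2"
    and t: "t \<in> {0..<T}"
  shows "(\<kappa> * (\<rho> t x)\<^sup>2 + energy 0 + (w t x)\<^sup>2)\<^sup>2 \<le> K\<^sup>2 * (\<rho> t x)\<^sup>2"
proof -
  obtain \<Lambda> where \<Lambda>: "0 < \<Lambda>" "\<And>s x. s \<in> {0..t} \<Longrightarrow> \<bar>w s x\<bar> \<le> \<Lambda>"
    using periodic_bounded_on[OF cont(2) per(2)] t by auto
  \<comment> \<open>large enough for \<open>exp (- c t) G\<close> to decrease strictly along the flow where \<open>G > 0\<close>\<close>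
  define c where "c = 2 * \<Lambda> + 1"
  define H where "H = (\<lambda>t x. \<kappa> * (\<rho> t x)\<^sup>2 + energy 0 + (w t x)\<^sup>2)"
  define Ht where "Ht = (\<lambda>t x. \<kappa> * (2 * \<rho> t x * \<rho>t t x) + 2 * w t x * wt t x)"
  define Hx where "Hx = (\<lambda>t x. \<kappa> * (2 * \<rho> t x * \<rho>x t x) + 2 * w t x * wx t x)"
  define G where "G = (\<lambda>t x. (H t x)\<^sup>2 - K\<^sup>2 * (\<rho> t x)\<^sup>2)"
  define Gt where "Gt = (\<lambda>t x. 2 * H t x * Ht t x - K\<^sup>2 * (2 * \<rho> t x * \<rho>t t x))"
  define Gx where "Gx = (\<lambda>t x. 2 * H t x * Hx t x - K\<^sup>2 * (2 * \<rho> t x * \<rho>x t x))"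
  have dG: "Gt s x + u s x * Gx s x = - 2 * w s x * G s x" if s: "s \<in> {0<..<T}" for s x
  proof -
    have "a s = - energy 0 / 2" using mean_eq_energy[of s] energy_const[of s] s by simp
    then have 1: "wt s x = \<kappa> / 2 * (\<rho> s x)\<^sup>2 - (w s x)\<^sup>2 / 2 - energy 0 / 2 - u s x * wx s x"
      using eq_w[OF s, of x] by simp
    have 2: "\<rho>t s x = - w s x * \<rho> s x - u s x * \<rho>x s x" using eq_\<rho>[OF s, of x] by simp
    have h: "Ht s x + u s x * Hx s x = - w s x * H s x"
      unfolding Ht_def Hx_def H_def 1 2 by (simp add: field_simps power2_eq_square)
    have "Gt s x + u s x * Gx s x = 2 * H s x * (Ht s x + u s x * Hx s x)
        - K\<^sup>2 * (2 * \<rho> s x * (\<rho>t s x + u s x * \<rho>x s x))"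
      unfolding Gt_def Gx_def by (simp add: algebra_simps)
    also have "\<dots> = - 2 * w s x * G s x"
      unfolding h eq_\<rho>[OF s] G_def by (simp add: algebra_simps power2_eq_square)
    finally show ?thesis .
  qed
  have "exp (- c * t) * G t x \<le> 0"
  proof (rule transport_max_principle[where Q="\<lambda>t x. exp (- c * t) * G t x" and K="{0..1}" and \<tau>=t and b=u
        and Qt="\<lambda>t x. exp (- c * t) * (Gt t x - c * G t x)" and Q'="\<lambda>t x h. exp (- c * t) * (h * Gx t x)"])
    show "continuous_on ({0..t} \<times> UNIV) (\<lambda>(s, x). exp (- c * s) * G s x)"
      unfolding case_prod_beta G_def H_def using t by (auto intro!: continuous_intros cont_intros)
    show "\<exists>y\<in>{0..1}. exp (- c * s) * G s x \<le> exp (- c * s) * G s y" if "s \<in> {0..t}" for s x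
    proof -
      have "s \<in> {0..<T}" using that t by auto
      then have "w s (frac x) = w s x" "\<rho> s (frac x) = \<rho> s x"
        using periodic_frac[of "w s" x] periodic_frac[of "\<rho> s" x] per by auto
      then show ?thesis by (intro bexI[of _ "frac x"] frac_in_unit) (simp add: G_def H_def)
    qed
    show "exp (- c * 0) * G 0 x \<le> 0" for x using K[of x] by (simp add: G_def H_def)
    fix s x assume s: "s \<in> {0<..t}"
    then have s': "s \<in> {0..<T}" "s \<in> {0<..<T}" using t by auto
    have "((\<lambda>s. exp (- c * s) * G s x) has_real_derivative exp (- c * s) * (Gt s x - c * G s x)) (at s within {0..<T})"
      unfolding G_def H_def Gt_def Ht_def using s'(1)
      by (auto intro!: derivative_eq_intros dt simp: algebra_simps)
    then show "((\<lambda>s. exp (- c * s) * G s x) has_real_derivative exp (- c * s) * (Gt s x - c * G s x)) (at s within {0..t})"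
      by (rule has_field_derivative_subset) (use t in auto)
    show "((\<lambda>x. exp (- c * s) * G s x) has_derivative (\<lambda>h. exp (- c * s) * (h * Gx s x))) (at x)"
      unfolding G_def H_def Gx_def Hx_def using s'(1)
      by (auto intro!: derivative_eq_intros has_x_derivative ext simp: algebra_simps)
    assume pos: "0 < exp (- c * s) * G s x"
    then have "0 < G s x" by (simp add: zero_less_mult_iff)
    moreover have "- 2 * w s x - c < 0" using \<Lambda>(2)[of s x] s unfolding c_def by auto
    ultimately have "exp (- c * s) * ((- 2 * w s x - c) * G s x) < 0"
      by (simp add: mult_less_0_iff)
    also have "(- 2 * w s x - c) * G s x = (Gt s x + u s x * Gx s x) - c * G s x"
      unfolding dG[OF s'(2)] by (simp add: algebra_simps)
    finally show "exp (- c * s) * (Gt s x - c * G s x) + exp (- c * s) * (u s x * Gx s x) < 0"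
      by (simp add: algebra_simps)
  qed (use t in auto)
  then have "G t x \<le> 0" by (simp add: mult_le_0_iff)
  then show ?thesis by (simp add: G_def H_def)
qed

lemma energy_nonneg: "t \<in> {0..<T} \<Longrightarrow> 0 \<le> energy t"
  unfolding energy_def using \<kappa>
  by (intro integral_nonneg integrable_continuous_interval continuous_intros cont_intros) auto

text \<open>With \<open>K\<close> a bound for \<open>H / |\<rho>|\<close> at time \<open>0\<close>, the bound \<open>H \<le> K |\<rho>|\<close> persists. It bounds \<open>\<rho>\<close> because
\<open>H\<close> is quadratic in \<open>\<rho>\<close>, and then \<open>w\<close>.\<close>

lemma amplitude_bound:
  assumes nz: "\<And>x. \<rho> 0 x \<noteq> 0"
  obtains M where "0 < M" "\<And>t x. t \<in> {0..<T} \<Longrightarrow> \<bar>w t x\<bar> \<le> M" "\<And>t x. t \<in> {0..<T} \<Longrightarrow> \<bar>\<rho> t x\<bar> \<le> M"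
proof -
  let ?H = "\<lambda>t x. \<kappa> * (\<rho> t x)\<^sup>2 + energy 0 + (w t x)\<^sup>2"
  have zero: "0 \<in> {0..<T}" using T by simp
  have E: "0 \<le> energy 0" by (rule energy_nonneg[OF zero])
  obtain K where K: "0 < K" "\<And>x. \<bar>?H 0 x / \<rho> 0 x\<bar> \<le> K"
  proof -
    have "continuous_on ({0..0} \<times> UNIV) (\<lambda>(t::real, x). ?H 0 x / \<rho> 0 x)"
      unfolding case_prod_beta using T by (auto intro!: continuous_intros cont_intros simp: nz)
    moreover have "?H 0 (x + 1) / \<rho> 0 (x + 1) = ?H 0 x / \<rho> 0 x" for x using per zero by simp
    ultimately obtain B where "0 < B" "\<And>t x. t \<in> {0..0::real} \<Longrightarrow> \<bar>?H 0 x / \<rho> 0 x\<bar> \<le> B"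
      using periodic_bounded[of 0 "\<lambda>t x. ?H 0 x / \<rho> 0 x"] by blast
    then show ?thesis using that[of B] by simp
  qed
  have init: "(?H 0 x)\<^sup>2 \<le> K\<^sup>2 * (\<rho> 0 x)\<^sup>2" for x
  proof -
    have "\<bar>?H 0 x\<bar> \<le> K * \<bar>\<rho> 0 x\<bar>" using K(2)[of x] nz[of x] by (simp add: abs_divide divide_le_eq)
    then have "\<bar>?H 0 x\<bar>\<^sup>2 \<le> (K * \<bar>\<rho> 0 x\<bar>)\<^sup>2" by (rule power_mono) simp
    then show ?thesis by (simp add: power_mult_distrib)
  qed
  have H: "?H t x \<le> K * \<bar>\<rho> t x\<bar>" if "t \<in> {0..<T}" for t x
  proof (rule power2_le_imp_le)
    show "(?H t x)\<^sup>2 \<le> (K * \<bar>\<rho> t x\<bar>)\<^sup>2"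
      using transported_bound[OF init that, of x] by (simp add: power_mult_distrib)
  qed (use K in simp)
  have r: "\<bar>\<rho> t x\<bar> \<le> K / \<kappa>" if "t \<in> {0..<T}" for t x
  proof (cases "\<rho> t x = 0")
    case False
    have "\<kappa> * \<bar>\<rho> t x\<bar>\<^sup>2 \<le> ?H t x" using E by simp
    also have "\<dots> \<le> K * \<bar>\<rho> t x\<bar>" by (rule H[OF that])
    finally have "\<bar>\<rho> t x\<bar> * (\<kappa> * \<bar>\<rho> t x\<bar>) \<le> \<bar>\<rho> t x\<bar> * K" by (simp add: power2_eq_square mult_ac)
    then have "\<kappa> * \<bar>\<rho> t x\<bar> \<le> K" using False by (simp add: mult_le_cancel_left_pos)
    then show ?thesis using \<kappa> by (simp add: pos_le_divide_eq mult.commute)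
  qed (use K \<kappa> in simp)
  have w2: "(w t x)\<^sup>2 \<le> K * (K / \<kappa>)" if "t \<in> {0..<T}" for t x
  proof -
    have "(w t x)\<^sup>2 \<le> ?H t x" using E \<kappa> by simp
    also have "\<dots> \<le> K * \<bar>\<rho> t x\<bar>" by (rule H[OF that])
    also have "\<dots> \<le> K * (K / \<kappa>)" using r[OF that] K(1) by (intro mult_left_mono) auto
    finally show ?thesis .
  qed
  define M where "M = K / \<kappa> + sqrt (K * (K / \<kappa>))"
  have w1: "\<bar>w t x\<bar> \<le> sqrt (K * (K / \<kappa>))" if "t \<in> {0..<T}" for t x
    using real_sqrt_le_mono[OF w2[OF that, of x]] by simp
  have p: "0 < K / \<kappa>" "0 \<le> sqrt (K * (K / \<kappa>))" using K \<kappa> by simp_all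
  show ?thesis
  proof (rule that[of M])
    show "0 < M" unfolding M_def using p by linarith
    fix t x assume t: "t \<in> {0..<T}"
    show "\<bar>w t x\<bar> \<le> M" unfolding M_def using w1[OF t, of x] p by linarith
    show "\<bar>\<rho> t x\<bar> \<le> M" unfolding M_def using r[OF t, of x] p by linarith
  qed
qed

text \<open>Doubling of the space variable. Along the velocity \<open>(u(x), u(y))\<close> the quantity
\<open>A = (w(x) - w(y))\<^sup>2 + \<kappa> (\<rho>(x) - \<rho>(y))\<^sup>2\<close> solves the linear equation \<open>D A = - (w(x) + w(y)) A\<close>, by
factoring the difference of squares in the Riccati equation for \<open>w + i \<surd>\<kappa> \<rho>\<close>, while \<open>(x - y)\<^sup>2\<close>
decreases at most at the rate \<open>2M\<close>. So the comparison of the two is preserved.\<close>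

lemma two_point_bound:
  assumes M: "0 < M" "\<And>t x. t \<in> {0..<T} \<Longrightarrow> \<bar>w t x\<bar> \<le> M" "\<And>t x. t \<in> {0..<T} \<Longrightarrow> \<bar>\<rho> t x\<bar> \<le> M"
    and L: "1 \<le> L" "\<And>x y. (w 0 x - w 0 y)\<^sup>2 + \<kappa> * (\<rho> 0 x - \<rho> 0 y)\<^sup>2 \<le> L\<^sup>2 * (x - y)\<^sup>2"
    and t: "t \<in> {0..<T}"
  shows "(w t x - w t y)\<^sup>2 + \<kappa> * (\<rho> t x - \<rho> t y)\<^sup>2 \<le> exp (4 * M * t) * L\<^sup>2 * (x - y)\<^sup>2"
proof -
  define A where "A = (\<lambda>t x y. (w t x - w t y)\<^sup>2 + \<kappa> * (\<rho> t x - \<rho> t y)\<^sup>2)"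
  define At where "At = (\<lambda>t x y. 2 * (w t x - w t y) * (wt t x - wt t y) + \<kappa> * (2 * (\<rho> t x - \<rho> t y) * (\<rho>t t x - \<rho>t t y)))"
  define A' where "A' = (\<lambda>t x y h k. 2 * (w t x - w t y) * (h * wx t x - k * wx t y)
     + \<kappa> * (2 * (\<rho> t x - \<rho> t y) * (h * \<rho>x t x - k * \<rho>x t y)))"
  have transport: "At s x y + A' s x y (u s x) (u s y) = - (w s x + w s y) * A s x y" if s: "s \<in> {0<..<T}" for s x y
  proof -
    have 1: "wt s x = \<kappa> / 2 * (\<rho> s x)\<^sup>2 - (w s x)\<^sup>2 / 2 + a s - u s x * wx s x" for x
      using eq_w[OF s, of x] by simp
    have 2: "\<rho>t s x = - w s x * \<rho> s x - u s x * \<rho>x s x" for x using eq_\<rho>[OF s, of x] by simp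
    show ?thesis unfolding At_def A'_def A_def 1 2 by (simp add: field_simps power2_eq_square)
  qed
  have u_lip: "\<bar>u s x - u s y\<bar> \<le> M * \<bar>x - y\<bar>" if s: "s \<in> {0..<T}" for s x y
    using field_differentiable_bound[of UNIV "u s" "w s" M x y] M(2)[OF s] dx(1)[OF s] by simp
  define B where "B = 4 * M\<^sup>2 + \<kappa> * (4 * M\<^sup>2)"
  have A_le: "A s x y \<le> B" if s: "s \<in> {0..<T}" for s x y
  proof -
    have "\<bar>w s x - w s y\<bar> \<le> 2 * M" "\<bar>\<rho> s x - \<rho> s y\<bar> \<le> 2 * M"
      using M(2)[OF s, of x] M(2)[OF s, of y] M(3)[OF s, of x] M(3)[OF s, of y] by linarith+
    then have "(w s x - w s y)\<^sup>2 \<le> (2 * M)\<^sup>2" "(\<rho> s x - \<rho> s y)\<^sup>2 \<le> (2 * M)\<^sup>2"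
      using M(1) by (simp_all only: power2_le_iff_abs_le mult_nonneg_nonneg zero_le_numeral less_imp_le)
    then show ?thesis using \<kappa> unfolding A_def B_def
      by (intro add_mono mult_left_mono) (auto simp: power_mult_distrib)
  qed
  have B0: "B > 0" using M \<kappa> by (simp add: B_def add_pos_pos)
  \<comment> \<open>the rate \<open>4M\<close> is \<open>2M\<close> for the growth of \<open>A\<close> plus \<open>2M\<close> for the decrease of \<open>(x - y)\<^sup>2\<close>\<close>
  let ?Q = "\<lambda>t z. exp (- (4 * M) * t) * A t (fst z) (snd z) - L\<^sup>2 * (fst z - snd z)\<^sup>2"
  have "?Q t (x, y) \<le> 0"
  proof (rule transport_max_principle[where Q="?Q" and K="{0..1::real} \<times> {-(B + 1)..B + 2}" and \<tau>=t
        and b="\<lambda>t z. (u t (fst z), u t (snd z))"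
        and Qt="\<lambda>t z. exp (- (4 * M) * t) * (At t (fst z) (snd z) - 4 * M * A t (fst z) (snd z))"
        and Q'="\<lambda>t z h. exp (- (4 * M) * t) * A' t (fst z) (snd z) (fst h) (snd h)
                  - L\<^sup>2 * (2 * (fst z - snd z) * (fst h - snd h))"])
    show "compact ({0..1::real} \<times> {-(B + 1)..B + 2})" by (intro compact_Times compact_Icc)
    show "continuous_on ({0..t} \<times> UNIV) (\<lambda>(s, z). ?Q s z)"
      unfolding case_prod_beta A_def using t by (auto intro!: continuous_intros cont_intros)
    show "?Q 0 z \<le> 0" for z using L(2)[of "fst z" "snd z"] by (simp add: A_def)
    show "\<exists>z'\<in>{0..1::real} \<times> {-(B + 1)..B + 2}. ?Q s z \<le> ?Q s z'" if s: "s \<in> {0..t}" and pos: "0 < ?Q s z" for s z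
    proof -
      have s': "s \<in> {0..<T}" using s t by auto
      have "L\<^sup>2 * (fst z - snd z)\<^sup>2 < exp (- (4 * M) * s) * A s (fst z) (snd z)" using pos by simp
      also have "\<dots> \<le> 1 * B" using s M(1) A_le[OF s'] \<kappa> by (intro mult_mono) (auto simp: A_def)
      finally have "L\<^sup>2 * (fst z - snd z)\<^sup>2 < B" by simp
      moreover have "1 * (fst z - snd z)\<^sup>2 \<le> L\<^sup>2 * (fst z - snd z)\<^sup>2"
        using L(1) by (intro mult_right_mono) auto
      ultimately have "\<bar>fst z - snd z\<bar>\<^sup>2 < B" by simp
      also have "B \<le> (B + 1)\<^sup>2" using B0 by (simp add: power2_eq_square algebra_simps)
      finally have d2: "\<bar>fst z - snd z\<bar>\<^sup>2 < (B + 1)\<^sup>2" .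
      have d: "\<bar>fst z - snd z\<bar> < B + 1" by (rule power2_less_imp_less[OF d2]) (use B0 in simp)
      \<comment> \<open>\<open>?Q\<close> is negative far from the diagonal and invariant under the diagonal shift by an integer\<close>
      let ?n = "\<lfloor>fst z\<rfloor>"
      have eq: "w s (x - of_int n) = w s x" "\<rho> s (x - of_int n) = \<rho> s x" for x and n :: int
        using periodic_of_int[of "w s" x "- n"] periodic_of_int[of "\<rho> s" x "- n"] per s' by auto
      have "(fst z - of_int ?n, snd z - of_int ?n) \<in> {0..1::real} \<times> {-(B + 1)..B + 2}"
      proof -
        have "0 \<le> fst z - of_int ?n" "fst z - of_int ?n \<le> 1" by linarith+
        then show ?thesis unfolding mem_Times_iff atLeastAtMost_iff fst_conv snd_conv using d by (intro conjI; linarith)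
      qed
      then show ?thesis by (rule bexI[rotated]) (simp add: A_def eq)
    qed
    fix s z assume s: "s \<in> {0<..t}"
    then have s': "s \<in> {0..<T}" "s \<in> {0<..<T}" using t by auto
    have "((\<lambda>s. ?Q s z) has_real_derivative exp (- (4 * M) * s) * (At s (fst z) (snd z) - 4 * M * A s (fst z) (snd z)))
        (at s within {0..<T})"
      unfolding A_def At_def using s'(1) by (auto intro!: derivative_eq_intros dt simp: algebra_simps)
    then show "((\<lambda>s. ?Q s z) has_real_derivative exp (- (4 * M) * s) * (At s (fst z) (snd z) - 4 * M * A s (fst z) (snd z)))
        (at s within {0..t})"
      by (rule has_field_derivative_subset) (use t in auto)
    have f: "((\<lambda>z. w s (fst z)) has_derivative (\<lambda>h. fst h * wx s (fst z))) (at z)"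
      "((\<lambda>z. w s (snd z)) has_derivative (\<lambda>h. snd h * wx s (snd z))) (at z)"
      "((\<lambda>z. \<rho> s (fst z)) has_derivative (\<lambda>h. fst h * \<rho>x s (fst z))) (at z)"
      "((\<lambda>z. \<rho> s (snd z)) has_derivative (\<lambda>h. snd h * \<rho>x s (snd z))) (at z)" for z :: "real \<times> real"
      using s'(1)
      by (auto intro!: has_derivative_compose[OF has_derivative_fst[OF has_derivative_ident] has_x_derivative(2)]
          has_derivative_compose[OF has_derivative_snd[OF has_derivative_ident] has_x_derivative(2)]
          has_derivative_compose[OF has_derivative_fst[OF has_derivative_ident] has_x_derivative(3)]
          has_derivative_compose[OF has_derivative_snd[OF has_derivative_ident] has_x_derivative(3)])
    show "(?Q s has_derivative (\<lambda>h. exp (- (4 * M) * s) * A' s (fst z) (snd z) (fst h) (snd h)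
                  - L\<^sup>2 * (2 * (fst z - snd z) * (fst h - snd h)))) (at z)"
      unfolding A_def A'_def
      by (auto intro!: derivative_eq_intros f ext simp: algebra_simps)
    assume pos: "0 < ?Q s z"
    define X Y where "X = fst z" and "Y = snd z"
    define e where "e = exp (- (4 * M) * s)"
    have eA: "L\<^sup>2 * (X - Y)\<^sup>2 < e * A s X Y" using pos by (simp add: X_def Y_def e_def)
    have wsum: "- (w s X + w s Y) \<le> 2 * M" using M(2)[OF s'(1), of X] M(2)[OF s'(1), of Y] by auto
    have "e * A s X Y \<ge> 0" using \<kappa> by (simp add: A_def e_def)
    then have 1: "- (w s X + w s Y) * (e * A s X Y) \<le> 2 * M * (e * A s X Y)"
      by (rule mult_right_mono[OF wsum])
    have "- ((X - Y) * (u s X - u s Y)) \<le> \<bar>X - Y\<bar> * \<bar>u s X - u s Y\<bar>"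
      using abs_ge_minus_self[of "(X - Y) * (u s X - u s Y)"] by (simp add: abs_mult)
    also have "\<dots> \<le> \<bar>X - Y\<bar> * (M * \<bar>X - Y\<bar>)" by (intro mult_left_mono u_lip s') auto
    also have "\<dots> = M * (X - Y)\<^sup>2" by (simp add: power2_eq_square mult.left_commute)
    finally have "L\<^sup>2 * (- ((X - Y) * (u s X - u s Y))) \<le> L\<^sup>2 * (M * (X - Y)\<^sup>2)"
      by (rule mult_left_mono) simp
    then have 2: "- (L\<^sup>2 * (2 * (X - Y) * (u s X - u s Y))) \<le> 2 * M * (L\<^sup>2 * (X - Y)\<^sup>2)"
      by (simp add: algebra_simps)
    have 3: "2 * M * (L\<^sup>2 * (X - Y)\<^sup>2) < 2 * M * (e * A s X Y)" using eA M(1) by simp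
    have "e * (At s X Y - 4 * M * A s X Y) + (e * A' s X Y (u s X) (u s Y) - L\<^sup>2 * (2 * (X - Y) * (u s X - u s Y)))
      = e * (At s X Y + A' s X Y (u s X) (u s Y)) - 4 * M * (e * A s X Y) + - (L\<^sup>2 * (2 * (X - Y) * (u s X - u s Y)))"
      by (simp add: algebra_simps)
    also have "\<dots> = - (w s X + w s Y) * (e * A s X Y) - 4 * M * (e * A s X Y) + - (L\<^sup>2 * (2 * (X - Y) * (u s X - u s Y)))"
      unfolding transport[OF s'(2)] by (simp only: mult.left_commute)
    also have "\<dots> < 0" using 1 2 3 by linarith
    finally show "exp (- (4 * M) * s) * (At s (fst z) (snd z) - 4 * M * A s (fst z) (snd z))
       + (exp (- (4 * M) * s) * A' s (fst z) (snd z) (fst (u s (fst z), u s (snd z))) (snd (u s (fst z), u s (snd z)))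
          - L\<^sup>2 * (2 * (fst z - snd z) * (fst (u s (fst z), u s (snd z)) - snd (u s (fst z), u s (snd z))))) < 0"
      by (simp add: X_def Y_def e_def)
  qed (use t in auto)
  then have "exp (- (4 * M) * t) * A t x y \<le> L\<^sup>2 * (x - y)\<^sup>2" by simp
  then have "exp (4 * M * t) * (exp (- (4 * M) * t) * A t x y) \<le> exp (4 * M * t) * (L\<^sup>2 * (x - y)\<^sup>2)"
    by (rule mult_left_mono) simp
  then show ?thesis by (simp add: A_def mult.assoc[symmetric] exp_add[symmetric])
qed

text \<open>The data are Lipschitz, \<open>two_point_bound\<close> propagates the square of their Lipschitz constant up to the factor
\<open>exp (4 M T)\<close>, and letting \<open>y\<close> tend to \<open>x\<close> turns it into a bound for the derivatives.\<close>

lemma gradient_bound: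
  assumes nz: "\<And>x. \<rho> 0 x \<noteq> 0"
  obtains M where "0 < M" "\<And>t x. t \<in> {0..<T} \<Longrightarrow> \<bar>w t x\<bar> \<le> M" "\<And>t x. t \<in> {0..<T} \<Longrightarrow> \<bar>\<rho> t x\<bar> \<le> M"
    "\<And>t x. t \<in> {0..<T} \<Longrightarrow> (wx t x)\<^sup>2 \<le> M" "\<And>t x. t \<in> {0..<T} \<Longrightarrow> (\<rho>x t x)\<^sup>2 \<le> M"
proof -
  obtain M where M: "0 < M" "\<And>t x. t \<in> {0..<T} \<Longrightarrow> \<bar>w t x\<bar> \<le> M" "\<And>t x. t \<in> {0..<T} \<Longrightarrow> \<bar>\<rho> t x\<bar> \<le> M"
    using amplitude_bound[OF nz] by metis
  have zero: "0 \<in> {0..<T}" "0 < T" using T by auto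
  obtain L1 where L1: "0 < L1" "\<And>x. \<bar>wx 0 x\<bar> \<le> L1"
    by (rule periodic_bounded_on[OF cont(4) per(3) zero(2)]) auto
  obtain L2 where L2: "0 < L2" "\<And>x. \<bar>\<rho>x 0 x\<bar> \<le> L2"
    by (rule periodic_bounded_on[OF cont(7) per(5) zero(2)]) auto
  define L where "L = 1 + sqrt (L1\<^sup>2 + \<kappa> * L2\<^sup>2)"
  have L: "1 \<le> L" "L1\<^sup>2 + \<kappa> * L2\<^sup>2 \<le> L\<^sup>2"
  proof -
    have p: "0 \<le> L1\<^sup>2 + \<kappa> * L2\<^sup>2" using \<kappa> by simp
    show "1 \<le> L" unfolding L_def using p by simp
    have "(sqrt (L1\<^sup>2 + \<kappa> * L2\<^sup>2))\<^sup>2 \<le> L\<^sup>2" unfolding L_def using p by (intro power_mono) auto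
    then show "L1\<^sup>2 + \<kappa> * L2\<^sup>2 \<le> L\<^sup>2" using p by simp
  qed
  have init: "(w 0 x - w 0 y)\<^sup>2 + \<kappa> * (\<rho> 0 x - \<rho> 0 y)\<^sup>2 \<le> L\<^sup>2 * (x - y)\<^sup>2" for x y
  proof -
    have d: "\<bar>w 0 x - w 0 y\<bar> \<le> L1 * \<bar>x - y\<bar>" "\<bar>\<rho> 0 x - \<rho> 0 y\<bar> \<le> L2 * \<bar>x - y\<bar>"
      using field_differentiable_bound[of UNIV "w 0" "wx 0" L1 x y] L1(2) dx(2)[OF zero(1)]
        field_differentiable_bound[of UNIV "\<rho> 0" "\<rho>x 0" L2 x y] L2(2) dx(3)[OF zero(1)] by simp_all
    have "(w 0 x - w 0 y)\<^sup>2 \<le> L1\<^sup>2 * (x - y)\<^sup>2" "(\<rho> 0 x - \<rho> 0 y)\<^sup>2 \<le> L2\<^sup>2 * (x - y)\<^sup>2"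
      using power_mono[OF d(1), of 2] power_mono[OF d(2), of 2] by (simp_all add: power_mult_distrib)
    then have "(w 0 x - w 0 y)\<^sup>2 + \<kappa> * (\<rho> 0 x - \<rho> 0 y)\<^sup>2 \<le> L1\<^sup>2 * (x - y)\<^sup>2 + \<kappa> * (L2\<^sup>2 * (x - y)\<^sup>2)"
      using \<kappa> by (intro add_mono mult_left_mono) auto
    also have "\<dots> = (L1\<^sup>2 + \<kappa> * L2\<^sup>2) * (x - y)\<^sup>2" by (simp add: algebra_simps)
    also have "\<dots> \<le> L\<^sup>2 * (x - y)\<^sup>2" by (intro mult_right_mono L) auto
    finally show ?thesis .
  qed
  define C where "C = exp (4 * M * T) * L\<^sup>2"
  have two: "(w t x - w t y)\<^sup>2 + \<kappa> * (\<rho> t x - \<rho> t y)\<^sup>2 \<le> C * (x - y)\<^sup>2" if t: "t \<in> {0..<T}" for t x y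
  proof -
    have "exp (4 * M * t) * L\<^sup>2 * (x - y)\<^sup>2 \<le> C * (x - y)\<^sup>2"
      unfolding C_def using t M(1) by (intro mult_right_mono) auto
    then show ?thesis using two_point_bound[OF M L(1) init t, of x y] by linarith
  qed
  have C0: "C \<ge> 0" by (simp add: C_def)
  have wx: "(wx t x)\<^sup>2 \<le> C" if t: "t \<in> {0..<T}" for t x
  proof (rule derivative_le_of_lipschitz[OF dx(2)[OF t]])
    show "(w t y - w t x)\<^sup>2 \<le> C * (y - x)\<^sup>2" for y
    proof -
      have "0 \<le> \<kappa> * (\<rho> t y - \<rho> t x)\<^sup>2" using \<kappa> by simp
      then show ?thesis using two[OF t, of y x] by linarith
    qed
  qed
  have \<rho>x: "(\<rho>x t x)\<^sup>2 \<le> C / \<kappa>" if t: "t \<in> {0..<T}" for t x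
  proof (rule derivative_le_of_lipschitz[OF dx(3)[OF t]])
    show "(\<rho> t y - \<rho> t x)\<^sup>2 \<le> C / \<kappa> * (y - x)\<^sup>2" for y
    proof -
      have "\<kappa> * (\<rho> t y - \<rho> t x)\<^sup>2 \<le> C * (y - x)\<^sup>2"
        using two[OF t, of y x] zero_le_power2[of "w t y - w t x"] by linarith
      then show ?thesis using \<kappa> by (simp add: field_simps)
    qed
  qed
  have p: "C / \<kappa> \<ge> 0" using C0 \<kappa> by simp
  define N where "N = M + C + C / \<kappa>"
  show ?thesis
  proof (rule that[of N])
    show "0 < N" using M C0 p by (simp add: N_def)
    fix t x assume t: "t \<in> {0..<T}"
    show "\<bar>w t x\<bar> \<le> N" using M(2)[OF t, of x] C0 p by (simp add: N_def)
    show "\<bar>\<rho> t x\<bar> \<le> N" using M(3)[OF t, of x] C0 p by (simp add: N_def)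
    show "(wx t x)\<^sup>2 \<le> N" using wx[OF t, of x] M(1) p by (simp add: N_def)
    show "(\<rho>x t x)\<^sup>2 \<le> N" using \<rho>x[OF t, of x] M(1) C0 by (simp add: N_def)
  qed
qed

end

section \<open>Integral inequalities and Fourier coefficients of curves\<close>

text \<open>The right-hand side \<open>G\<close> satisfies \<open>G' = c1 Y \<le> c1 G\<close>, so \<open>exp (- c1 t) G t\<close> is nonincreasing.\<close>

lemma gronwall_integral:
  fixes Y :: "real \<Rightarrow> real"
  assumes cont: "continuous_on {0..<T} Y" and c1: "0 \<le> c1"
    and le: "\<And>t. t \<in> {0..<T} \<Longrightarrow> Y t \<le> c0 + c1 * integral {0..t} Y"
    and t: "t \<in> {0..<T}"
  shows "Y t \<le> c0 * exp (c1 * t)"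
proof -
  define G where "G = (\<lambda>s. c0 + c1 * integral {0..s} Y)"
  have ct: "continuous_on {0..t} Y" by (rule continuous_on_subset[OF cont]) (use t in auto)
  have dG: "(G has_real_derivative c1 * Y s) (at s within {0..t})" if "s \<in> {0..t}" for s
    unfolding G_def using integral_has_real_derivative[OF ct that]
    by (auto intro!: derivative_eq_intros)
  have "exp (- c1 * t) * G t \<le> exp (- c1 * 0) * G 0"
  proof (rule DERIV_nonpos_imp_decreasing_open[where f="\<lambda>s. exp (- c1 * s) * G s" and a=0 and b=t])
    show "0 \<le> t" using t by simp
    show "continuous_on {0..t} (\<lambda>s. exp (- c1 * s) * G s)"
      by (intro continuous_intros DERIV_continuous_on[OF dG])
    fix s assume s: "0 < s" "s < t"
    have "(G has_real_derivative c1 * Y s) (at s)"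
      using dG[of s] s at_within_Icc_at[of 0 s t] by simp
    then have d: "((\<lambda>s. exp (- c1 * s) * G s) has_real_derivative
        exp (- c1 * s) * (c1 * Y s) + (exp (- c1 * s) * - c1) * G s) (at s)"
      by (auto intro!: derivative_eq_intros)
    have eq: "exp (- c1 * s) * (c1 * Y s) + (exp (- c1 * s) * - c1) * G s = (exp (- c1 * s) * c1) * (Y s - G s)"
      by (simp add: algebra_simps)
    have "Y s \<le> G s" unfolding G_def using le[of s] s t by simp
    then have "(exp (- c1 * s) * c1) * (Y s - G s) \<le> 0"
      using c1 by (intro mult_nonneg_nonpos) auto
    then show "\<exists>y. ((\<lambda>s. exp (- c1 * s) * G s) has_real_derivative y) (at s) \<and> y \<le> 0"
      unfolding eq[symmetric] using d by blast
  qed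
  also have "exp (- c1 * 0) * G 0 = c0" by (simp add: G_def)
  finally have "G t / exp (c1 * t) \<le> c0" by (simp add: exp_minus divide_inverse mult.commute)
  then have "G t \<le> c0 * exp (c1 * t)" by (simp add: pos_divide_le_eq)
  then show ?thesis using le[OF t] by (simp add: G_def)
qed

lemma le_integral_of_derivative_bound:
  fixes e Y :: "real \<Rightarrow> real"
  assumes e: "continuous_on {0..t} e" and Y: "continuous_on {0..t} Y" and t: "0 \<le> t"
    and d: "\<And>s. 0 < s \<Longrightarrow> s < t \<Longrightarrow> \<exists>y. (e has_real_derivative y) (at s) \<and> y \<le> c * Y s"
  shows "e t \<le> e 0 + c * integral {0..t} Y"
proof -
  have dI: "((\<lambda>s. integral {0..s} Y) has_real_derivative Y s) (at s within {0..t})" if "s \<in> {0..t}" for s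
    by (rule integral_has_real_derivative[OF Y that])
  have "e t - c * integral {0..t} Y \<le> e 0 - c * integral {0..0} Y"
  proof (rule DERIV_nonpos_imp_decreasing_open[OF t])
    show "continuous_on {0..t} (\<lambda>s. e s - c * integral {0..s} Y)"
      by (intro continuous_intros e DERIV_continuous_on[OF dI])
    fix s assume s: "0 < s" "s < t"
    obtain y where y: "(e has_real_derivative y) (at s)" "y \<le> c * Y s" using d[OF s] by blast
    have "((\<lambda>s. integral {0..s} Y) has_real_derivative Y s) (at s)"
      using dI[of s] s at_within_Icc_at[of 0 s t] by simp
    then have "((\<lambda>s. e s - c * integral {0..s} Y) has_real_derivative y - c * Y s) (at s)"
      by (intro DERIV_diff y DERIV_cmult)
    then show "\<exists>y. ((\<lambda>s. e s - c * integral {0..s} Y) has_real_derivative y) (at s) \<and> y \<le> 0"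
      using y(2) by force
  qed
  then show ?thesis by simp
qed

lemma fourier_coeff_const: "fourier_coeff (\<lambda>_. c) k = (if k = 0 then of_real c else 0)"
proof -
  have "fourier_coeff (\<lambda>_. c) k = integral {0..1} (\<lambda>x. of_real c * fourier_mode (- k) x)"
    by (rule fourier_coeff_eq_integral) simp
  also have "\<dots> = of_real c * integral {0..1} (fourier_mode (- k))" by simp
  finally show ?thesis by (simp add: integral_fourier_mode_unit)
qed

lemma fourier_coeff_0: "continuous_on UNIV f \<Longrightarrow> fourier_coeff f 0 = of_real (integral {0..1} f)"
proof -
  assume f: "continuous_on UNIV f"
  have "(f has_integral integral {0..1} f) {0..1}"
    by (intro integrable_integral integrable_continuous_interval continuous_on_subset[OF f]) auto
  from integral_unique[OF has_integral_of_real[OF this]] show ?thesis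
    by (simp add: fourier_coeff_eq_integral[OF f])
qed

text \<open>Differentiation under the integral sign.\<close>

lemma fourier_coeff_has_vector_derivative:
  fixes f ft :: "real \<Rightarrow> real \<Rightarrow> real"
  assumes c: "continuous_on ({0..<T} \<times> UNIV) (\<lambda>(t, x). f t x)"
    and ct: "continuous_on ({0..<T} \<times> UNIV) (\<lambda>(t, x). ft t x)"
    and d: "\<And>t x. t \<in> {0..<T} \<Longrightarrow> ((\<lambda>t. f t x) has_real_derivative ft t x) (at t within {0..<T})"
    and t: "t \<in> {0..<T}"
  shows "((\<lambda>t. fourier_coeff (f t) k) has_vector_derivative fourier_coeff (ft t) k) (at t within {0..<T})"
proof -
  have slice: "continuous_on UNIV (g t)" if "continuous_on ({0..<T} \<times> UNIV) (\<lambda>(t, x). g t x)" "t \<in> {0..<T}"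
    for g :: "real \<Rightarrow> real \<Rightarrow> real" and t
  proof -
    have "continuous_on UNIV (\<lambda>x. (\<lambda>(t, x). g t x) (t, x))"
      by (rule continuous_on_compose2[OF that(1)]) (use that(2) in \<open>auto intro!: continuous_intros\<close>)
    then show ?thesis by simp
  qed
  have "((\<lambda>t. integral (cbox 0 1) (\<lambda>x. of_real (f t x) * fourier_mode (- k) x)) has_vector_derivative
      integral (cbox 0 1) (\<lambda>x. of_real (ft t x) * fourier_mode (- k) x)) (at t within {0..<T})"
  proof (rule leibniz_rule_vector_derivative[OF _ _ _ t])
    show "((\<lambda>t. complex_of_real (f t x) * fourier_mode (- k) x) has_vector_derivative of_real (ft t x) * fourier_mode (- k) x)
        (at t within {0..<T})" if "t \<in> {0..<T}" for t x
      using d[OF that, of x]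
      by (intro has_vector_derivative_mult_left has_vector_derivative_of_real)
         (simp add: has_real_derivative_iff_has_vector_derivative)
    show "(\<lambda>x. complex_of_real (f t x) * fourier_mode (- k) x) integrable_on cbox 0 1" if "t \<in> {0..<T}" for t
      using integrable_mult_fourier_mode[of "\<lambda>x. complex_of_real (f t x)" "- k" 0 1] slice[OF c that]
      by (simp add: continuous_on_of_real)
    have "continuous_on ({0..<T} \<times> cbox 0 1) (\<lambda>p. complex_of_real ((\<lambda>(t, x). ft t x) p) * fourier_mode (- k) (snd p))"
      by (intro continuous_intros continuous_on_subset[OF ct]) auto
    then show "continuous_on ({0..<T} \<times> cbox 0 1) (\<lambda>(t, x). complex_of_real (ft t x) * fourier_mode (- k) x)"
      by (simp add: case_prod_beta)
  qed auto
  then have "((\<lambda>t. integral {0..1} (\<lambda>x. of_real (f t x) * fourier_mode (- k) x)) has_vector_derivative fourier_coeff (ft t) k)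
      (at t within {0..<T})"
    by (simp add: fourier_coeff_eq_integral[OF slice[OF ct t]])
  then show ?thesis
    by (rule has_vector_derivative_transform[rotated 2]) (use t in \<open>auto simp: fourier_coeff_eq_integral[OF slice[OF c]]\<close>)
qed

lemma norm_sq_has_derivative:
  assumes "(c has_vector_derivative d) (at t within S)"
  shows "((\<lambda>t. (norm (c t :: complex))\<^sup>2) has_real_derivative 2 * Re (cnj (c t) * d)) (at t within S)"
proof -
  have "((\<lambda>t. c t \<bullet> c t) has_derivative (\<lambda>h. c t \<bullet> (h *\<^sub>R d) + (h *\<^sub>R d) \<bullet> c t)) (at t within S)"
    using assms unfolding has_vector_derivative_def by (intro has_derivative_inner)
  moreover have "(\<lambda>h. c t \<bullet> (h *\<^sub>R d) + (h *\<^sub>R d) \<bullet> c t) = (*) (2 * Re (cnj (c t) * d))"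
    by (auto simp: inner_complex_def algebra_simps)
  ultimately show ?thesis by (simp add: has_field_derivative_def power2_norm_eq_inner)
qed

text \<open>Parseval's identity for \<open>f\<close> and its derivative bounds the \<open>H\<^sup>1\<close> norm by the suprema, and \<open>H\<^sup>1\<close> embeds
into the functions with absolutely summable Fourier coefficients.\<close>

lemma wiener_bound:
  obtains C where "0 \<le> C"
    "\<And>f B. \<lbrakk>f \<in> sobolev_cont r; 3/2 < r; \<And>x. (f x)\<^sup>2 \<le> B; \<And>x. (deriv f x)\<^sup>2 \<le> B\<rbrakk>
      \<Longrightarrow> l1_norm (fourier_coeff f) \<le> C * sqrt (2 * B)"
proof -
  have "(1/2::real) < 1" by simp
  then obtain C where C: "0 \<le> C" "\<And>c. hs_summable 1 c \<Longrightarrow> l1_norm c \<le> C * hs_norm 1 c"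
    using hs_embedding_l1[of 1] by metis
  show ?thesis
  proof (rule that[OF C(1)])
    fix f B
    assume f: "f \<in> sobolev_cont r" and r: "3/2 < r" and B: "\<And>x. (f x)\<^sup>2 \<le> B" "\<And>x. (deriv f x)\<^sup>2 \<le> B"
    note D = sobolev_cont_deriv[OF r f]
    have c: "continuous_on UNIV f" "\<And>x. f (x + 1) = f x" "continuous_on UNIV (deriv f)" "\<And>x. deriv f (x + 1) = deriv f x"
      using f D(2) by (auto simp: sobolev_cont_iff)
    have s1: "(\<lambda>k. norm (fourier_coeff f k)) summable_on UNIV"
      using sobolev_cont_l1[OF _ f] r by (simp add: l1_summable_def)
    have s2: "(\<lambda>k. norm (fourier_coeff (deriv f) k)) summable_on UNIV"
      using sobolev_cont_l1[OF _ D(2)] r by (simp add: l1_summable_def)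
    have P: "((\<lambda>k. (norm (fourier_coeff f k))\<^sup>2 + (norm (fourier_coeff (deriv f) k))\<^sup>2) has_sum
        (integral {0..1} (\<lambda>x. (f x)\<^sup>2) + integral {0..1} (\<lambda>x. (deriv f x)\<^sup>2))) UNIV"
      by (intro has_sum_add parseval c s1 s2)
    have e: "(norm (fourier_coeff f k))\<^sup>2 + (norm (fourier_coeff (deriv f) k))\<^sup>2 = (bracket k powr 1 * norm (fourier_coeff f k))\<^sup>2" for k
    proof -
      have "(bracket k)\<^sup>2 = 1 + (2 * pi * of_int k)\<^sup>2" by (simp add: bracket_def add_nonneg_nonneg)
      then show ?thesis unfolding D(3) norm_deriv_seq by (simp add: power_mult_distrib algebra_simps)
    qed
    have hs: "hs_summable 1 (fourier_coeff f)"
      using has_sum_imp_summable[OF P] unfolding e hs_summable_def .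
    have i: "integral {0..1} (\<lambda>x. (g x)\<^sup>2) \<le> B" if "continuous_on UNIV g" "\<And>x. (g x)\<^sup>2 \<le> B" for g :: "real \<Rightarrow> real"
    proof -
      have "integral {0..1} (\<lambda>x. (g x)\<^sup>2) \<le> integral {0..1} (\<lambda>x::real. B)"
        by (intro integral_le integrable_continuous_interval continuous_intros continuous_on_subset[OF that(1)] that(2)) auto
      then show ?thesis by simp
    qed
    have "hs_norm 1 (fourier_coeff f) = sqrt (integral {0..1} (\<lambda>x. (f x)\<^sup>2) + integral {0..1} (\<lambda>x. (deriv f x)\<^sup>2))"
      using infsumI[OF P] unfolding e hs_norm_def by simp
    also have "\<dots> \<le> sqrt (2 * B)" using i[OF c(1) B(1)] i[OF c(3) B(2)] by (intro real_sqrt_le_mono) simp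
    finally show "l1_norm (fourier_coeff f) \<le> C * sqrt (2 * B)"
      using C(2)[OF hs] C(1) by (meson mult_left_mono order_trans)
  qed
qed

section \<open>The Sobolev energy estimate\<close>

text \<open>The regularity \<open>r\<close> is \<open>s - 1\<close>: the velocity \<open>u\<close> is one degree smoother than \<open>w = \<partial>\<^sub>x u\<close> and \<open>\<rho>\<close>.\<close>

locale sobolev_solution = classical_solution +
  fixes r :: real
  assumes r: "3/2 < r"
    and u_mem: "\<And>t. t \<in> {0..<T} \<Longrightarrow> u t \<in> sobolev_cont (r + 1)"
    and w_mem: "\<And>t. t \<in> {0..<T} \<Longrightarrow> w t \<in> sobolev_cont r"
    and \<rho>_mem: "\<And>t. t \<in> {0..<T} \<Longrightarrow> \<rho> t \<in> sobolev_cont r"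
begin

lemma derivs:
  assumes "t \<in> {0..<T}"
  shows "deriv (u t) = w t" "deriv (w t) = wx t" "deriv (\<rho> t) = \<rho>x t"
  using dx[OF assms] by (auto intro!: DERIV_imp_deriv)

lemma coeff_derivs:
  assumes t: "t \<in> {0..<T}"
  shows "fourier_coeff (w t) = deriv_seq (fourier_coeff (u t))"
    "fourier_coeff (wx t) = deriv_seq (fourier_coeff (w t))"
    "fourier_coeff (\<rho>x t) = deriv_seq (fourier_coeff (\<rho> t))"
  using sobolev_cont_deriv(3)[OF _ u_mem[OF t]] sobolev_cont_deriv(3)[OF r w_mem[OF t]]
    sobolev_cont_deriv(3)[OF r \<rho>_mem[OF t]] r
  by (simp_all add: derivs[OF t])

lemma slices:
  assumes t: "t \<in> {0..<T}"
  shows "continuous_on UNIV (u t)" "continuous_on UNIV (w t)" "continuous_on UNIV (wx t)"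
    "continuous_on UNIV (\<rho> t)" "continuous_on UNIV (\<rho>x t)"
  using u_mem[OF t] w_mem[OF t] \<rho>_mem[OF t] sobolev_cont_deriv(2)[OF r w_mem[OF t]]
    sobolev_cont_deriv(2)[OF r \<rho>_mem[OF t]]
  by (auto simp: sobolev_cont_iff derivs[OF t])

lemma summabilities:
  assumes t: "t \<in> {0..<T}"
  shows "l1_summable (fourier_coeff (u t))" "l1_summable (fourier_coeff (w t))" "l1_summable (fourier_coeff (wx t))"
    "l1_summable (fourier_coeff (\<rho> t))" "l1_summable (fourier_coeff (\<rho>x t))"
    "hs_summable r (fourier_coeff (w t))" "hs_summable r (fourier_coeff (\<rho> t))"
  using sobolev_cont_l1[OF _ u_mem[OF t]] sobolev_cont_l1[OF _ w_mem[OF t]] sobolev_cont_l1[OF _ \<rho>_mem[OF t]]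
    sobolev_cont_deriv_seq_l1[OF r w_mem[OF t]] sobolev_cont_deriv_seq_l1[OF r \<rho>_mem[OF t]] r w_mem[OF t] \<rho>_mem[OF t]
  by (simp_all add: coeff_derivs(2,3)[OF t] sobolev_cont_iff)

text \<open>The quantity in terms of which all terms of the energy estimate are bounded.\<close>

definition hs_energy :: "real \<Rightarrow> real" where
  "hs_energy t = (hs_norm r (fourier_coeff (w t)))\<^sup>2 + (hs_norm r (fourier_coeff (\<rho> t)))\<^sup>2"

lemma transport_term:
  assumes t: "t \<in> {0..<T}" and N: "1 \<le> N" and \<Lambda>: "l1_norm (fourier_coeff (w t)) \<le> \<Lambda>" "l1_norm (fourier_coeff f) \<le> \<Lambda>"
    and f: "f \<in> sobolev_cont r" and n: "hs_norm r (fourier_coeff f) \<le> sqrt (hs_energy t)"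
  shows "\<bar>\<Sum>k\<in>{- int N..int N}. trunc_weight N r k * Re (cnj (fourier_coeff f k) * fourier_coeff (\<lambda>x. u t x * deriv f x) k)\<bar>
    \<le> (2 * r + 2) * 2 powr r * (3 * \<Lambda> * hs_energy t)"
proof -
  have r2: "1 \<le> 2 * r" using r by simp
  have Z: "0 \<le> hs_energy t" by (simp add: hs_energy_def)
  have nw: "hs_norm r (fourier_coeff (w t)) \<le> sqrt (hs_energy t)" by (rule real_le_rsqrt) (simp add: hs_energy_def)
  have \<Lambda>0: "0 \<le> \<Lambda>" using \<Lambda>(1) l1_norm_nonneg order_trans by blast
  have fd: "fourier_coeff (deriv f) = deriv_seq (fourier_coeff f)" "l1_summable (deriv_seq (fourier_coeff f))"
    "l1_summable (fourier_coeff f)" "hs_summable r (fourier_coeff f)"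
    using sobolev_cont_deriv(3)[OF r f] sobolev_cont_deriv_seq_l1[OF r f] sobolev_cont_l1[OF _ f] r f
    by (auto simp: sobolev_cont_iff)
  have fc: "continuous_on UNIV (deriv f)" "\<And>x. deriv f (x + 1) = deriv f x"
    using sobolev_cont_deriv(2)[OF r f] by (auto simp: sobolev_cont_iff)
  have g: "((\<lambda>l. fourier_coeff (u t) (k - l) * deriv_seq (fourier_coeff f) l) has_sum fourier_coeff (\<lambda>x. u t x * deriv f x) k) UNIV" for k
    using fourier_coeff_convolution[OF slices(1)[OF t] fc, of k] fd by (simp add: l1_summable_def)
  have "\<bar>\<Sum>k\<in>{- int N..int N}. trunc_weight N r k * Re (cnj (fourier_coeff f k) * fourier_coeff (\<lambda>x. u t x * deriv f x) k)\<bar>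
    \<le> (2 * r + 2) * 2 powr r * (l1_norm (deriv_seq (fourier_coeff (u t))) * (hs_norm r (fourier_coeff f))\<^sup>2
        + 2 * l1_norm (fourier_coeff f) * (hs_norm r (deriv_seq (fourier_coeff (u t))) * hs_norm r (fourier_coeff f)))"
    using summabilities[OF t] fd unfolding coeff_derivs(1)[OF t]
    by (intro transport_estimate r2 N fourier_coeff_uminus slices(1)[OF t] g)
  also have "\<dots> \<le> (2 * r + 2) * 2 powr r * (\<Lambda> * (sqrt (hs_energy t))\<^sup>2 + 2 * \<Lambda> * (sqrt (hs_energy t) * sqrt (hs_energy t)))"
    unfolding coeff_derivs(1)[OF t, symmetric] using r Z
    by (intro mult_left_mono add_mono mult_mono power_mono \<Lambda> n nw)
       (auto intro!: \<Lambda>0 mult_nonneg_nonneg hs_norm_nonneg l1_norm_nonneg)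
  also have "\<dots> = (2 * r + 2) * 2 powr r * (3 * \<Lambda> * hs_energy t)" using Z by simp
  finally show ?thesis .
qed

lemma product_term:
  assumes t: "t \<in> {0..<T}" and N: "1 \<le> N"
    and f: "f \<in> sobolev_cont r" "hs_norm r (fourier_coeff f) \<le> sqrt (hs_energy t)"
    and g: "g \<in> sobolev_cont r" "hs_norm r (fourier_coeff g) \<le> sqrt (hs_energy t)" "l1_norm (fourier_coeff g) \<le> \<Lambda>"
    and h: "h \<in> sobolev_cont r" "hs_norm r (fourier_coeff h) \<le> sqrt (hs_energy t)" "l1_norm (fourier_coeff h) \<le> \<Lambda>"
  shows "\<bar>\<Sum>k\<in>{- int N..int N}. trunc_weight N r k * Re (cnj (fourier_coeff f k) * fourier_coeff (\<lambda>x. g x * h x) k)\<bar>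
    \<le> 2 powr r * (2 * \<Lambda> * hs_energy t)"
proof -
  have r0: "0 \<le> r" "1/2 < r" using r by simp_all
  have Z: "0 \<le> hs_energy t" by (simp add: hs_energy_def)
  have \<Lambda>0: "0 \<le> \<Lambda>" using g(3) l1_norm_nonneg order_trans by blast
  have l: "l1_summable (fourier_coeff g)" "l1_summable (fourier_coeff h)"
    using sobolev_cont_l1[OF r0(2)] g h by auto
  have q: "((\<lambda>l. fourier_coeff g (k - l) * fourier_coeff h l) has_sum fourier_coeff (\<lambda>x. g x * h x) k) UNIV" for k
    using g h l by (intro fourier_coeff_convolution) (auto simp: sobolev_cont_iff l1_summable_def)
  have "\<bar>\<Sum>k\<in>{- int N..int N}. trunc_weight N r k * Re (cnj (fourier_coeff f k) * fourier_coeff (\<lambda>x. g x * h x) k)\<bar>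
    \<le> 2 powr r * hs_norm r (fourier_coeff f) * (hs_norm r (fourier_coeff g) * l1_norm (fourier_coeff h)
        + l1_norm (fourier_coeff g) * hs_norm r (fourier_coeff h))"
    using f g h l by (intro product_estimate r0 N q) (auto simp: sobolev_cont_iff)
  also have "\<dots> \<le> 2 powr r * sqrt (hs_energy t) * (sqrt (hs_energy t) * \<Lambda> + \<Lambda> * sqrt (hs_energy t))"
    using Z by (intro mult_mono add_mono f g h mult_nonneg_nonneg add_nonneg_nonneg hs_norm_nonneg l1_norm_nonneg \<Lambda>0) auto
  also have "\<dots> = 2 powr r * (2 * \<Lambda> * (sqrt (hs_energy t) * sqrt (hs_energy t)))" by (simp only: mult_2 distrib_left distrib_right mult_ac)
  also have "\<dots> = 2 powr r * (2 * \<Lambda> * hs_energy t)" using Z by simp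
  finally show ?thesis .
qed

end

lemma bracket_weighted_square: "(bracket k powr r * x)\<^sup>2 = bracket k powr (2 * r) * x\<^sup>2"
  unfolding powr_double[OF bracket_pos(1)] power2_eq_square by (simp only: mult_ac)

context sobolev_solution
begin

lemma norms_le_hs_energy:
  "hs_norm r (fourier_coeff (w t)) \<le> sqrt (hs_energy t)" "hs_norm r (fourier_coeff (\<rho> t)) \<le> sqrt (hs_energy t)" "0 \<le> hs_energy t"
  by (auto intro!: real_le_rsqrt simp: hs_energy_def)

lemma coeff_wt:
  assumes t: "t \<in> {0<..<T}"
  shows "fourier_coeff (wt t) k = - fourier_coeff (\<lambda>x. u t x * wx t x) k
     + of_real (\<kappa> / 2) * fourier_coeff (\<lambda>x. \<rho> t x * \<rho> t x) k
     - 1 / 2 * fourier_coeff (\<lambda>x. w t x * w t x) k + (if k = 0 then of_real (a t) else 0)"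
proof -
  have t': "t \<in> {0..<T}" using t by simp
  note c = continuous_on_mult[OF slices(1)[OF t'] slices(3)[OF t']]
    continuous_on_mult[OF slices(4)[OF t'] slices(4)[OF t']] continuous_on_mult[OF slices(2)[OF t'] slices(2)[OF t']]
  have wt: "wt t = (\<lambda>x. (- 1) * (u t x * wx t x)
       + 1 * ((\<kappa> / 2) * (\<rho> t x * \<rho> t x) + 1 * ((- 1 / 2) * (w t x * w t x) + a t * 1)))"
  proof
    fix x
    show "wt t x = (- 1) * (u t x * wx t x)
       + 1 * ((\<kappa> / 2) * (\<rho> t x * \<rho> t x) + 1 * ((- 1 / 2) * (w t x * w t x) + a t * 1))"
      using eq_w[OF t, of x] by (simp add: power2_eq_square)
  qed
  show ?thesis unfolding wt
    apply (subst fourier_coeff_lincomb, (intro continuous_intros c; fail)+)+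
    by (simp add: fourier_coeff_const)
qed

lemma coeff_\<rho>t:
  assumes t: "t \<in> {0<..<T}"
  shows "fourier_coeff (\<rho>t t) k = - fourier_coeff (\<lambda>x. u t x * \<rho>x t x) k - fourier_coeff (\<lambda>x. w t x * \<rho> t x) k"
proof -
  have t': "t \<in> {0..<T}" using t by simp
  note c = continuous_on_mult[OF slices(1)[OF t'] slices(5)[OF t']]
    continuous_on_mult[OF slices(2)[OF t'] slices(4)[OF t']]
  have \<rho>t: "\<rho>t t = (\<lambda>x. (- 1) * (u t x * \<rho>x t x) + (- 1) * (w t x * \<rho> t x))"
    using eq_\<rho>[OF t] by (auto simp: fun_eq_iff algebra_simps)
  show ?thesis unfolding \<rho>t by (subst fourier_coeff_lincomb) (auto intro!: c)
qed

text \<open>A finite sum, hence differentiable in time although \<open>w\<close> and \<open>\<rho>\<close> are differentiable in time only with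
values in \<open>H\<^sup>r\<^sup>-\<^sup>1\<close>.\<close>

definition trunc_energy :: "nat \<Rightarrow> real \<Rightarrow> real" where
  "trunc_energy N t = (\<Sum>k\<in>{- int N..int N}. trunc_weight N r k *
     ((norm (fourier_coeff (w t) k))\<^sup>2 + \<kappa> * (norm (fourier_coeff (\<rho> t) k))\<^sup>2))"

lemma trunc_energy_has_derivative:
  assumes t: "t \<in> {0..<T}"
  shows "(trunc_energy N has_real_derivative (\<Sum>k\<in>{- int N..int N}. trunc_weight N r k *
     (2 * Re (cnj (fourier_coeff (w t) k) * fourier_coeff (wt t) k)
      + \<kappa> * (2 * Re (cnj (fourier_coeff (\<rho> t) k) * fourier_coeff (\<rho>t t) k))))) (at t within {0..<T})"
proof -
  note dw = norm_sq_has_derivative[OF fourier_coeff_has_vector_derivative[OF cont(2,3) dt(1) t]]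
  note d\<rho> = norm_sq_has_derivative[OF fourier_coeff_has_vector_derivative[OF cont(5,6) dt(2) t]]
  show ?thesis unfolding trunc_energy_def[abs_def] by (intro DERIV_sum DERIV_cmult DERIV_add dw d\<rho>)
qed

text \<open>Insert the equations. The two transport terms and the three quadratic terms are covered by the
trilinear estimates, with constants that do not depend on \<open>N\<close>; the constant \<open>a\<close> is invisible because
\<open>w\<close> has mean zero.\<close>

lemma trunc_energy_derivative_bound:
  assumes \<Lambda>: "\<And>t. t \<in> {0..<T} \<Longrightarrow> l1_norm (fourier_coeff (w t)) \<le> \<Lambda>"
     "\<And>t. t \<in> {0..<T} \<Longrightarrow> l1_norm (fourier_coeff (\<rho> t)) \<le> \<Lambda>"
    and t: "t \<in> {0<..<T}" and N: "1 \<le> N"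
  shows "(\<Sum>k\<in>{- int N..int N}. trunc_weight N r k *
     (2 * Re (cnj (fourier_coeff (w t) k) * fourier_coeff (wt t) k)
      + \<kappa> * (2 * Re (cnj (fourier_coeff (\<rho> t) k) * fourier_coeff (\<rho>t t) k))))
    \<le> (2 + 2 * \<kappa>) * ((2 * r + 2) * 2 powr r * (3 * \<Lambda> * hs_energy t)) + (4 * \<kappa> + 1) * (2 powr r * (2 * \<Lambda> * hs_energy t))"
proof -
  have t': "t \<in> {0..<T}" using t by simp
  let ?K = "{- int N..int N}"
  let ?W = "fourier_coeff (w t)" and ?R = "fourier_coeff (\<rho> t)"
  define S where "S = (\<lambda>c p. \<Sum>k\<in>?K. trunc_weight N r k * Re (cnj (c k) * p k))"
  define P1 where "P1 = fourier_coeff (\<lambda>x. u t x * wx t x)"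
  define P2 where "P2 = fourier_coeff (\<lambda>x. \<rho> t x * \<rho> t x)"
  define P3 where "P3 = fourier_coeff (\<lambda>x. w t x * w t x)"
  define P4 where "P4 = fourier_coeff (\<lambda>x. u t x * \<rho>x t x)"
  define P5 where "P5 = fourier_coeff (\<lambda>x. w t x * \<rho> t x)"
  have W0: "?W 0 = 0" unfolding coeff_derivs(1)[OF t'] by (simp add: deriv_seq_def)
  have term_eq: "trunc_weight N r k * (2 * Re (cnj (?W k) * fourier_coeff (wt t) k)
      + \<kappa> * (2 * Re (cnj (?R k) * fourier_coeff (\<rho>t t) k)))
    = (- 2) * (trunc_weight N r k * Re (cnj (?W k) * P1 k)) + \<kappa> * (trunc_weight N r k * Re (cnj (?W k) * P2 k))
      + (- 1) * (trunc_weight N r k * Re (cnj (?W k) * P3 k)) + (- 2 * \<kappa>) * (trunc_weight N r k * Re (cnj (?R k) * P4 k))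
      + (- 2 * \<kappa>) * (trunc_weight N r k * Re (cnj (?R k) * P5 k))" for k
  proof -
    have c0: "cnj (?W k) * (if k = 0 then of_real (a t) else 0) = 0" using W0 by simp
    have "cnj (?W k) * fourier_coeff (wt t) k
       = of_real (- 1) * (cnj (?W k) * P1 k) + of_real (\<kappa> / 2) * (cnj (?W k) * P2 k) + of_real (- 1 / 2) * (cnj (?W k) * P3 k)"
      unfolding coeff_wt[OF t] P1_def[symmetric] P2_def[symmetric] P3_def[symmetric] distrib_left c0
      by (simp add: algebra_simps)
    then have 1: "Re (cnj (?W k) * fourier_coeff (wt t) k)
       = (- 1) * Re (cnj (?W k) * P1 k) + (\<kappa> / 2) * Re (cnj (?W k) * P2 k) + (- 1 / 2) * Re (cnj (?W k) * P3 k)"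
      by (simp only: plus_complex.sel Re_of_real_mult)
    have "cnj (?R k) * fourier_coeff (\<rho>t t) k = of_real (- 1) * (cnj (?R k) * P4 k) + of_real (- 1) * (cnj (?R k) * P5 k)"
      unfolding coeff_\<rho>t[OF t] P4_def[symmetric] P5_def[symmetric] by (simp add: algebra_simps)
    then have 2: "Re (cnj (?R k) * fourier_coeff (\<rho>t t) k) = (- 1) * Re (cnj (?R k) * P4 k) + (- 1) * Re (cnj (?R k) * P5 k)"
      by (simp only: plus_complex.sel Re_of_real_mult)
    have alg: "m * (2 * ((- 1) * a + (\<kappa> / 2) * b + (- 1 / 2) * c) + \<kappa> * (2 * ((- 1) * d + (- 1) * e)))
      = (- 2) * (m * a) + \<kappa> * (m * b) + (- 1) * (m * c) + (- 2 * \<kappa>) * (m * d) + (- 2 * \<kappa>) * (m * e)"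
      for m a b c d e :: real by (simp add: algebra_simps)
    show ?thesis unfolding 1 2 by (rule alg)
  qed
  have sum_eq: "(\<Sum>k\<in>?K. trunc_weight N r k * (2 * Re (cnj (?W k) * fourier_coeff (wt t) k)
      + \<kappa> * (2 * Re (cnj (?R k) * fourier_coeff (\<rho>t t) k))))
    = (- 2) * S ?W P1 + \<kappa> * S ?W P2 + (- 1) * S ?W P3 + (- 2 * \<kappa>) * S ?R P4 + (- 2 * \<kappa>) * S ?R P5"
    unfolding term_eq S_def sum.distrib sum_distrib_left[symmetric] ..
  define X where "X = (2 * r + 2) * 2 powr r * (3 * \<Lambda> * hs_energy t)"
  define Y where "Y = 2 powr r * (2 * \<Lambda> * hs_energy t)"
  have b1: "\<bar>S ?W P1\<bar> \<le> X"
    using transport_term[OF t' N \<Lambda>(1)[OF t'] \<Lambda>(1)[OF t'] w_mem[OF t'] norms_le_hs_energy(1)]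
    unfolding derivs(2)[OF t'] S_def P1_def X_def .
  have b4: "\<bar>S ?R P4\<bar> \<le> X"
    using transport_term[OF t' N \<Lambda>(1)[OF t'] \<Lambda>(2)[OF t'] \<rho>_mem[OF t'] norms_le_hs_energy(2)]
    unfolding derivs(3)[OF t'] S_def P4_def X_def .
  note w = w_mem[OF t'] norms_le_hs_energy(1) \<Lambda>(1)[OF t'] and \<rho> = \<rho>_mem[OF t'] norms_le_hs_energy(2) \<Lambda>(2)[OF t']
  have b2: "\<bar>S ?W P2\<bar> \<le> Y" unfolding S_def P2_def Y_def by (rule product_term[OF t' N w(1,2) \<rho> \<rho>])
  have b3: "\<bar>S ?W P3\<bar> \<le> Y" unfolding S_def P3_def Y_def by (rule product_term[OF t' N w(1,2) w w])
  have b5: "\<bar>S ?R P5\<bar> \<le> Y" unfolding S_def P5_def Y_def by (rule product_term[OF t' N \<rho>(1,2) w \<rho>])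
  have m: "c * S d p \<le> \<bar>c\<bar> * B" if "\<bar>S d p\<bar> \<le> B" for c d p B
    using order_trans[OF abs_ge_self[of "c * S d p"]] mult_left_mono[OF that, of "\<bar>c\<bar>"] by (simp add: abs_mult)
  have "(- 2) * S ?W P1 + \<kappa> * S ?W P2 + (- 1) * S ?W P3 + (- 2 * \<kappa>) * S ?R P4 + (- 2 * \<kappa>) * S ?R P5
    \<le> \<bar>- 2\<bar> * X + \<bar>\<kappa>\<bar> * Y + \<bar>- 1\<bar> * Y + \<bar>- 2 * \<kappa>\<bar> * X + \<bar>- 2 * \<kappa>\<bar> * Y"
    by (intro add_mono m b1 b2 b3 b4 b5)
  also have "\<dots> \<le> (2 + 2 * \<kappa>) * X + (4 * \<kappa> + 1) * Y"
  proof -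
    have "0 \<le> Y" using b2 by simp
    then have "0 \<le> \<kappa> * Y" using \<kappa> by simp
    then show ?thesis using \<kappa> by (simp add: abs_mult algebra_simps)
  qed
  finally show ?thesis unfolding sum_eq X_def Y_def .
qed

lemma wiener_norm_bounded:
  assumes nz: "\<And>x. \<rho> 0 x \<noteq> 0"
  obtains \<Lambda> where "0 \<le> \<Lambda>" "\<And>t. t \<in> {0..<T} \<Longrightarrow> l1_norm (fourier_coeff (w t)) \<le> \<Lambda>"
     "\<And>t. t \<in> {0..<T} \<Longrightarrow> l1_norm (fourier_coeff (\<rho> t)) \<le> \<Lambda>"
proof -
  obtain M where M: "0 < M" "\<And>t x. t \<in> {0..<T} \<Longrightarrow> \<bar>w t x\<bar> \<le> M" "\<And>t x. t \<in> {0..<T} \<Longrightarrow> \<bar>\<rho> t x\<bar> \<le> M"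
    "\<And>t x. t \<in> {0..<T} \<Longrightarrow> (wx t x)\<^sup>2 \<le> M" "\<And>t x. t \<in> {0..<T} \<Longrightarrow> (\<rho>x t x)\<^sup>2 \<le> M"
    using gradient_bound[OF nz] by metis
  obtain C where C: "0 \<le> C" "\<And>f B. \<lbrakk>f \<in> sobolev_cont r; 3/2 < r; \<And>x. (f x)\<^sup>2 \<le> B; \<And>x. (deriv f x)\<^sup>2 \<le> B\<rbrakk>
      \<Longrightarrow> l1_norm (fourier_coeff f) \<le> C * sqrt (2 * B)"
    using wiener_bound[of r] by metis
  have sq: "x\<^sup>2 \<le> M\<^sup>2 + M" if "\<bar>x\<bar> \<le> M" for x :: real
    using power_mono[OF that, of 2] M(1) by simp
  have le: "x \<le> M\<^sup>2 + M" if "x \<le> M" for x :: real using that by (simp add: add_increasing)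
  show ?thesis
  proof (rule that[of "C * sqrt (2 * (M\<^sup>2 + M))"])
    show "0 \<le> C * sqrt (2 * (M\<^sup>2 + M))" using C(1) M(1) by simp
    fix t assume t: "t \<in> {0..<T}"
    show "l1_norm (fourier_coeff (w t)) \<le> C * sqrt (2 * (M\<^sup>2 + M))"
      by (rule C(2)[OF w_mem[OF t] r sq[OF M(2)[OF t]]]) (use le[OF M(4)[OF t]] in \<open>simp add: derivs[OF t]\<close>)
    show "l1_norm (fourier_coeff (\<rho> t)) \<le> C * sqrt (2 * (M\<^sup>2 + M))"
      by (rule C(2)[OF \<rho>_mem[OF t] r sq[OF M(3)[OF t]]]) (use le[OF M(5)[OF t]] in \<open>simp add: derivs[OF t]\<close>)
  qed
qed

lemma trunc_energy_le:
  assumes t: "t \<in> {0..<T}"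
  shows "trunc_energy N t \<le> (hs_norm r (fourier_coeff (w t)))\<^sup>2 + \<kappa> * (hs_norm r (fourier_coeff (\<rho> t)))\<^sup>2"
proof -
  have le: "(\<Sum>k\<in>F. trunc_weight N r k * (norm (c k))\<^sup>2) \<le> (hs_norm r c)\<^sup>2" if c: "hs_summable r c" and F: "finite F" for c F
  proof -
    have "(\<Sum>k\<in>F. trunc_weight N r k * (norm (c k))\<^sup>2) \<le> (\<Sum>k\<in>F. (bracket k powr r * norm (c k))\<^sup>2)"
      unfolding bracket_weighted_square by (intro sum_mono mult_right_mono trunc_weight_bounds) auto
    also have "\<dots> \<le> (\<Sum>\<^sub>\<infinity>k. (bracket k powr r * norm (c k))\<^sup>2)"
      using c F by (intro finite_sum_le_infsum) (auto simp: hs_summable_def)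
    also have "\<dots> = (hs_norm r c)\<^sup>2" by (simp add: hs_norm_def infsum_nonneg)
    finally show ?thesis .
  qed
  have "trunc_energy N t = (\<Sum>k\<in>{- int N..int N}. trunc_weight N r k * (norm (fourier_coeff (w t) k))\<^sup>2)
      + \<kappa> * (\<Sum>k\<in>{- int N..int N}. trunc_weight N r k * (norm (fourier_coeff (\<rho> t) k))\<^sup>2)"
    unfolding trunc_energy_def sum_distrib_left sum.distrib[symmetric] by (intro sum.cong) (auto simp: algebra_simps)
  also have "\<dots> \<le> (hs_norm r (fourier_coeff (w t)))\<^sup>2 + \<kappa> * (hs_norm r (fourier_coeff (\<rho> t)))\<^sup>2"
    using \<kappa> summabilities(6,7)[OF t] by (intro add_mono mult_left_mono le) auto
  finally show ?thesis .
qed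

text \<open>On a finite set of frequencies the cutoff tends to \<open>1\<close> as \<open>N\<close> grows.\<close>

lemma energy_le_of_trunc:
  assumes t: "t \<in> {0..<T}" and B: "\<And>N. 1 \<le> N \<Longrightarrow> trunc_energy N t \<le> B"
  shows "(hs_norm r (fourier_coeff (w t)))\<^sup>2 + \<kappa> * (hs_norm r (fourier_coeff (\<rho> t)))\<^sup>2 \<le> B"
proof -
  let ?q = "\<lambda>k. (norm (fourier_coeff (w t) k))\<^sup>2 + \<kappa> * (norm (fourier_coeff (\<rho> t) k))\<^sup>2"
  let ?W = "\<lambda>k. (bracket k powr r * norm (fourier_coeff (w t) k))\<^sup>2" and ?R = "\<lambda>k. (bracket k powr r * norm (fourier_coeff (\<rho> t) k))\<^sup>2"
  have hs: "((\<lambda>k. ?W k + \<kappa> * ?R k) has_sum ((hs_norm r (fourier_coeff (w t)))\<^sup>2 + \<kappa> * (hs_norm r (fourier_coeff (\<rho> t)))\<^sup>2)) UNIV"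
    using summabilities(6,7)[OF t]
    by (intro has_sum_add has_sum_cmult_right) (auto simp: hs_norm_def hs_summable_def infsum_nonneg)
  show ?thesis
  proof (rule has_sum_le_finite_sums[OF hs])
    fix F :: "int set" assume F: "finite F"
    have q0: "0 \<le> ?q k" for k using \<kappa> by simp
    have lim: "(\<lambda>N. \<Sum>k\<in>F. trunc_weight N r k * ?q k) \<longlonglongrightarrow> (\<Sum>k\<in>F. (bracket k powr (2 * r) * 1) * ?q k)"
      unfolding trunc_weight_def by (intro tendsto_intros hat_cutoff_tendsto)
    have "\<forall>\<^sub>F N in sequentially. (\<Sum>k\<in>F. trunc_weight N r k * ?q k) \<le> B"
      using eventually_ge_at_top[of 1]
    proof eventually_elim
      case (elim N)
      have "(\<Sum>k\<in>F. trunc_weight N r k * ?q k) \<le> trunc_energy N t"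
      proof -
        have "(\<Sum>k\<in>F. trunc_weight N r k * ?q k) \<le> (\<Sum>k\<in>F \<union> {- int N..int N}. trunc_weight N r k * ?q k)"
          using F by (intro sum_mono2) (auto intro!: mult_nonneg_nonneg trunc_weight_bounds q0)
        also have "\<dots> = trunc_energy N t"
          unfolding trunc_energy_def using F trunc_weight_finite_support[OF elim, of r]
          by (intro sum.mono_neutral_right) auto
        finally show ?thesis .
      qed
      then show ?case using B[OF elim] by simp
    qed
    then have "(\<Sum>k\<in>F. (bracket k powr (2 * r) * 1) * ?q k) \<le> B"
      by (rule tendsto_upperbound[OF lim]) simp
    moreover have "(bracket k powr (2 * r) * 1) * ?q k = ?W k + \<kappa> * ?R k" for k
      unfolding bracket_weighted_square by (simp add: algebra_simps)
    ultimately show "(\<Sum>k\<in>F. ?W k + \<kappa> * ?R k) \<le> B" by simp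
  qed
qed

text \<open>For \<open>r = s - 1\<close> this is the square of the norm in the theorem.\<close>

definition pair_norm_sq :: "real \<Rightarrow> real" where
  "pair_norm_sq t = (sobolev_norm (r + 1) (u t))\<^sup>2 + (sobolev_norm r (\<rho> t))\<^sup>2"

lemma hs_energy_le_pair_norm_sq:
  assumes t: "t \<in> {0..<T}"
  shows "hs_energy t \<le> pair_norm_sq t"
proof -
  have "hs_norm r (fourier_coeff (w t)) \<le> hs_norm (r + 1) (fourier_coeff (u t))"
    using hs_norm_deriv_seq_le(2)[of "r + 1" "fourier_coeff (u t)"] u_mem[OF t]
    by (simp add: coeff_derivs(1)[OF t] sobolev_cont_iff)
  then show ?thesis
    unfolding hs_energy_def pair_norm_sq_def sobolev_norm_eq by (intro add_mono power_mono hs_norm_nonneg) auto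
qed

text \<open>For \<open>k \<noteq> 0\<close> the bracket is at most twice \<open>|2\<pi>k|\<close>, so that \<open>w\<close> controls all of \<open>u\<close> except its mean.\<close>

lemma pair_norm_sq_le:
  assumes t: "t \<in> {0..<T}"
  shows "pair_norm_sq t \<le> (norm (fourier_coeff (u t) 0))\<^sup>2
    + (4 + 1 / \<kappa>) * ((hs_norm r (fourier_coeff (w t)))\<^sup>2 + \<kappa> * (hs_norm r (fourier_coeff (\<rho> t)))\<^sup>2)"
proof -
  let ?U = "fourier_coeff (u t)" and ?W = "fourier_coeff (w t)"
  define n\<rho> where "n\<rho> = (hs_norm r (fourier_coeff (\<rho> t)))\<^sup>2"
  define nw where "nw = (hs_norm r ?W)\<^sup>2"
  have le: "(bracket k powr (r + 1) * norm (?U k))\<^sup>2 \<le> (if k = 0 then (norm (?U 0))\<^sup>2 else 0) + 4 * (bracket k powr r * norm (?W k))\<^sup>2" for k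
  proof (cases "k = 0")
    case True
    then show ?thesis by (simp add: bracket_def)
  next
    case False
    have "bracket k powr (r + 1) * norm (?U k) = bracket k powr r * (bracket k * norm (?U k))" by (simp add: powr_add)
    also have "\<dots> \<le> bracket k powr r * (2 * \<bar>2 * pi * of_int k\<bar> * norm (?U k))"
      by (intro mult_left_mono mult_right_mono bracket_le False) auto
    also have "\<dots> = 2 * (bracket k powr r * norm (?W k))" unfolding coeff_derivs(1)[OF t] norm_deriv_seq by simp
    finally have "(bracket k powr (r + 1) * norm (?U k))\<^sup>2 \<le> (2 * (bracket k powr r * norm (?W k)))\<^sup>2"
      by (rule power_mono) simp
    then show ?thesis using False by (simp add: power_mult_distrib)
  qed
  have su: "(\<lambda>k. (bracket k powr (r + 1) * norm (?U k))\<^sup>2) summable_on UNIV"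
    using u_mem[OF t] by (simp add: sobolev_cont_iff hs_summable_def)
  have h0: "((\<lambda>k::int. if k = 0 then (norm (?U 0))\<^sup>2 else 0) has_sum (norm (?U 0))\<^sup>2) UNIV"
    by (rule has_sum_finite_neutralI[of "{0}"]) auto
  have hw: "((\<lambda>k. (bracket k powr r * norm (?W k))\<^sup>2) has_sum nw) UNIV"
    using summabilities(6)[OF t] by (simp add: nw_def hs_norm_def hs_summable_def infsum_nonneg)
  have "(sobolev_norm (r + 1) (u t))\<^sup>2 = (\<Sum>\<^sub>\<infinity>k. (bracket k powr (r + 1) * norm (?U k))\<^sup>2)"
    by (simp add: sobolev_norm_eq hs_norm_def infsum_nonneg)
  also have "\<dots> \<le> (norm (?U 0))\<^sup>2 + 4 * nw"
    by (rule has_sum_mono[OF has_sum_infsum[OF su] has_sum_add[OF h0 has_sum_cmult_right[OF hw]] le])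
  finally have 1: "(sobolev_norm (r + 1) (u t))\<^sup>2 \<le> (norm (?U 0))\<^sup>2 + 4 * nw" .
  have nn: "0 \<le> nw" "0 \<le> n\<rho>" by (simp_all add: nw_def n\<rho>_def)
  have "(4 + 1 / \<kappa>) * (nw + \<kappa> * n\<rho>) = 4 * nw + n\<rho> + (4 * (\<kappa> * n\<rho>) + nw / \<kappa>)"
    using \<kappa> by (simp add: field_simps)
  moreover have "0 \<le> 4 * (\<kappa> * n\<rho>) + nw / \<kappa>" using nn \<kappa> by simp
  ultimately have "4 * nw + n\<rho> \<le> (4 + 1 / \<kappa>) * (nw + \<kappa> * n\<rho>)" by linarith
  then show ?thesis using 1 unfolding pair_norm_sq_def nw_def n\<rho>_def sobolev_norm_eq by linarith
qed

text \<open>The truncated energy at time \<open>t\<close> is at most its initial value plus a multiple of the integral of the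
full squared norm, uniformly in \<open>N\<close>. Letting \<open>N\<close> grow closes the estimate, because the full norm is
known to be finite and continuous in time; Gronwall's inequality then gives a bound in terms of \<open>T\<close>.\<close>

lemma pair_norm_sq_bounded:
  assumes nz: "\<And>x. \<rho> 0 x \<noteq> 0"
    and mean_bounded: "\<And>t. t \<in> {0..<T} \<Longrightarrow> norm (fourier_coeff (u t) 0) \<le> m"
    and pair_norm_sq_cont: "continuous_on {0..<T} pair_norm_sq"
  obtains B where "\<And>t. t \<in> {0..<T} \<Longrightarrow> pair_norm_sq t \<le> B"
proof -
  obtain \<Lambda> where \<Lambda>: "0 \<le> \<Lambda>" "\<And>t. t \<in> {0..<T} \<Longrightarrow> l1_norm (fourier_coeff (w t)) \<le> \<Lambda>"
     "\<And>t. t \<in> {0..<T} \<Longrightarrow> l1_norm (fourier_coeff (\<rho> t)) \<le> \<Lambda>"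
    using wiener_norm_bounded[OF nz] by metis
  define c where "c = (2 + 2 * \<kappa>) * ((2 * r + 2) * 2 powr r * (3 * \<Lambda>)) + (4 * \<kappa> + 1) * (2 powr r * (2 * \<Lambda>))"
  have c0: "0 \<le> c" unfolding c_def using \<kappa> r \<Lambda>(1) by simp
  define E where "E = (\<lambda>t. (hs_norm r (fourier_coeff (w t)))\<^sup>2 + \<kappa> * (hs_norm r (fourier_coeff (\<rho> t)))\<^sup>2)"
  have zero: "0 \<in> {0..<T}" using T by simp
  have E_le: "E t \<le> E 0 + c * integral {0..t} pair_norm_sq" if t: "t \<in> {0..<T}" for t
  proof -
    have "(hs_norm r (fourier_coeff (w t)))\<^sup>2 + \<kappa> * (hs_norm r (fourier_coeff (\<rho> t)))\<^sup>2 \<le> E 0 + c * integral {0..t} pair_norm_sq"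
    proof (rule energy_le_of_trunc[OF t])
      fix N :: nat assume N: "1 \<le> N"
      have "trunc_energy N t \<le> trunc_energy N 0 + c * integral {0..t} pair_norm_sq"
      proof (rule le_integral_of_derivative_bound)
        show "continuous_on {0..t} (trunc_energy N)"
          using t by (intro continuous_on_subset[OF DERIV_continuous_on[OF trunc_energy_has_derivative]]) auto
        show "continuous_on {0..t} pair_norm_sq" by (rule continuous_on_subset[OF pair_norm_sq_cont]) (use t in auto)
        show "0 \<le> t" using t by simp
        fix s assume s: "0 < s" "s < t"
        then have s': "s \<in> {0..<T}" "s \<in> {0<..<T}" using t by auto
        let ?D = "(\<Sum>k\<in>{- int N..int N}. trunc_weight N r k *
           (2 * Re (cnj (fourier_coeff (w s) k) * fourier_coeff (wt s) k)
            + \<kappa> * (2 * Re (cnj (fourier_coeff (\<rho> s) k) * fourier_coeff (\<rho>t s) k))))"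
        have "(trunc_energy N has_real_derivative ?D) (at s within {0<..<T})"
          by (rule has_field_derivative_subset[OF trunc_energy_has_derivative[OF s'(1)]]) auto
        then have d: "(trunc_energy N has_real_derivative ?D) (at s)"
          using at_within_open[OF s'(2)] by simp
        have "?D \<le> (2 + 2 * \<kappa>) * ((2 * r + 2) * 2 powr r * (3 * \<Lambda> * hs_energy s)) + (4 * \<kappa> + 1) * (2 powr r * (2 * \<Lambda> * hs_energy s))"
          by (rule trunc_energy_derivative_bound[OF \<Lambda>(2,3) s'(2) N])
        also have "\<dots> = c * hs_energy s" unfolding c_def by (simp add: algebra_simps)
        also have "\<dots> \<le> c * pair_norm_sq s" by (intro mult_left_mono hs_energy_le_pair_norm_sq s' c0)
        finally show "\<exists>y. (trunc_energy N has_real_derivative y) (at s) \<and> y \<le> c * pair_norm_sq s" using d by blast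
      qed
      also have "\<dots> \<le> E 0 + c * integral {0..t} pair_norm_sq" using trunc_energy_le[OF zero, of N] by (simp add: E_def)
      finally show "trunc_energy N t \<le> E 0 + c * integral {0..t} pair_norm_sq" .
    qed
    then show ?thesis by (simp only: E_def)
  qed
  define c0' where "c0' = m\<^sup>2 + (4 + 1 / \<kappa>) * E 0"
  define c1 where "c1 = (4 + 1 / \<kappa>) * c"
  have k: "0 \<le> 4 + 1 / \<kappa>" using \<kappa> by simp
  have tl: "pair_norm_sq t \<le> c0' + c1 * integral {0..t} pair_norm_sq" if t: "t \<in> {0..<T}" for t
  proof -
    have "pair_norm_sq t \<le> (norm (fourier_coeff (u t) 0))\<^sup>2 + (4 + 1 / \<kappa>) * E t"
      unfolding E_def by (rule pair_norm_sq_le[OF t])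
    also have "\<dots> \<le> m\<^sup>2 + (4 + 1 / \<kappa>) * (E 0 + c * integral {0..t} pair_norm_sq)"
      by (intro add_mono power_mono mean_bounded t mult_left_mono E_le k) auto
    finally show ?thesis by (simp add: c0'_def c1_def algebra_simps)
  qed
  have E0: "0 \<le> E 0" using \<kappa> by (simp add: E_def)
  have c0'_nn: "0 \<le> c0'" unfolding c0'_def by (intro add_nonneg_nonneg mult_nonneg_nonneg k E0) simp
  have c1_nn: "0 \<le> c1" unfolding c1_def by (intro mult_nonneg_nonneg k c0)
  have "pair_norm_sq t \<le> c0' * exp (c1 * T)" if t: "t \<in> {0..<T}" for t
  proof -
    have "pair_norm_sq t \<le> c0' * exp (c1 * t)" by (rule gronwall_integral[OF pair_norm_sq_cont c1_nn tl t])
    also have "\<dots> \<le> c0' * exp (c1 * T)"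
      using t c1_nn c0'_nn by (intro mult_left_mono) (auto intro!: mult_left_mono)
    finally show ?thesis .
  qed
  then show ?thesis using that by blast
qed

end

section \<open>The integrated system\<close>

lemma dx_inv_has_derivative:
  assumes F: "continuous_on UNIV F"
  shows "(dx_inv F has_real_derivative F x) (at x)"
proof -
  define b where "b = \<bar>x\<bar> + 1"
  have "dx_inv F = (\<lambda>z. interval_lebesgue_integral lborel (ereal 0) (ereal z) F)"
    by (simp add: dx_inv_def zero_ereal_def fun_eq_iff)
  moreover have "((\<lambda>z. interval_lebesgue_integral lborel (ereal 0) (ereal z) F) has_vector_derivative F x) (at x within {-b..b})"
    by (rule interval_integral_FTC2) (auto simp: b_def intro: continuous_on_subset[OF F])
  ultimately have "(dx_inv F has_real_derivative F x) (at x within {-b..b})"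
    by (simp add: has_real_derivative_iff_has_vector_derivative)
  moreover have "at x within {-b..b} = at x" by (rule at_within_Icc_at) (auto simp: b_def)
  ultimately show ?thesis by simp
qed

lemma dx_inv_0: "dx_inv F 0 = 0"
  by (simp add: dx_inv_def zero_ereal_def[symmetric])

lemma set_lebesgue_integral_unit:
  fixes f :: "real \<Rightarrow> real"
  assumes "continuous_on UNIV f"
  shows "(LINT x:{0..1}|lborel. f x) = integral {0..1} f"
  by (rule set_borel_integral_eq_integral(2)[OF borel_integrable_atLeastAtMost'[OF continuous_on_subset[OF assms]]]) auto

text \<open>Integrating the equation for \<open>u\<close> over a period, the transport term \<open>u \<partial>\<^sub>x u\<close> drops out, so the time
derivative of the mean is bounded by the right-hand side \<open>g\<close>.\<close>

lemma (in sobolev_solution) mean_velocity_bounded: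
  fixes ut g :: "real \<Rightarrow> real \<Rightarrow> real"
  assumes cont_ut: "continuous_on ({0..<T} \<times> UNIV) (\<lambda>(t, x). ut t x)"
    and dt_u: "\<And>t x. t \<in> {0..<T} \<Longrightarrow> ((\<lambda>t. u t x) has_real_derivative ut t x) (at t within {0..<T})"
    and eq_u: "\<And>t x. t \<in> {0<..<T} \<Longrightarrow> ut t x + u t x * w t x = g t x"
    and g: "\<And>t x. t \<in> {0<..<T} \<Longrightarrow> x \<in> {0..1} \<Longrightarrow> \<bar>g t x\<bar> \<le> G"
  obtains m where "\<And>t. t \<in> {0..<T} \<Longrightarrow> norm (fourier_coeff (u t) 0) \<le> m"
proof -
  let ?c = "\<lambda>t. fourier_coeff (u t) 0" and ?c' = "\<lambda>t. fourier_coeff (ut t) 0"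
  have d: "(?c has_vector_derivative ?c' t) (at t within {0..<T})" if "t \<in> {0..<T}" for t
    by (rule fourier_coeff_has_vector_derivative[OF cont(1) cont_ut dt_u that])
  have bound: "norm (?c' t) \<le> G" if t: "t \<in> {0<..<T}" for t
  proof -
    have t': "t \<in> {0..<T}" using t by simp
    have cut: "continuous_on UNIV (ut t)"
      using joint_cont[OF cont_ut, of UNIV "\<lambda>_. t" "\<lambda>x. x"] t' by simp
    have cg: "continuous_on S (g t)" for S
    proof -
      have "continuous_on UNIV (\<lambda>x. ut t x + u t x * w t x)"
        by (intro continuous_intros cut slices(1,2)[OF t'])
      then show ?thesis unfolding eq_u[OF t] by (rule continuous_on_subset) simp
    qed
    have "((\<lambda>x. u t x * w t x) has_integral ((u t 1)\<^sup>2 / 2 - (u t 0)\<^sup>2 / 2)) {0..1}"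
      by (rule fundamental_theorem_of_calculus)
         (auto simp: has_real_derivative_iff_has_vector_derivative[symmetric]
            intro!: derivative_eq_intros has_field_derivative_at_within[OF dx(1)[OF t']])
    then have uw: "((\<lambda>x. u t x * w t x) has_integral 0) {0..1}" using per(1)[OF t', of 0] by simp
    have "(g t has_integral integral {0..1} (g t)) {0..1}"
      by (intro integrable_integral integrable_continuous_interval cg)
    from has_integral_diff[OF this uw] have "integral {0..1} (ut t) = integral {0..1} (g t)"
      unfolding eq_u[OF t, symmetric] by (simp add: integral_unique)
    also have "\<bar>\<dots>\<bar> \<le> G * (1 - 0)"
      unfolding real_norm_def[symmetric] by (rule integral_bound) (use g[OF t] in \<open>auto intro: cg\<close>)
    finally show ?thesis unfolding fourier_coeff_0[OF cut] by simp
  qed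
  have zero: "0 \<in> {0..<T}" using T by simp
  have G: "0 \<le> G" by (rule order_trans[OF norm_ge_zero bound[of "T / 2"]]) (use T in simp)
  have "norm (?c t) \<le> norm (?c 0) + G * T" if t: "t \<in> {0..<T}" for t
  proof (cases "t = 0")
    case False
    have "norm (?c t - ?c 0) \<le> G * t - G * 0"
    proof (rule differentiable_bound_general[where f' = ?c' and \<phi>' = "\<lambda>_. G"])
      show "0 < t" using False t by simp
      show "continuous_on {0..t} ?c"
        using t by (intro continuous_on_subset[OF continuous_on_vector_derivative[OF d]]) auto
      fix s assume s: "0 < s" "s < t"
      then have s': "s \<in> {0..<T}" "s \<in> {0<..<T}" using t by auto
      have "(?c has_vector_derivative ?c' s) (at s within {0<..<T})"
        by (rule has_vector_derivative_within_subset[OF d[OF s'(1)]]) auto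
      then show "(?c has_vector_derivative ?c' s) (at s)" using at_within_open[OF s'(2)] by simp
      show "norm (?c' s) \<le> G" by (rule bound[OF s'(2)])
      show "((*) G has_vector_derivative G) (at s)"
        by (auto intro!: derivative_eq_intros simp: has_real_derivative_iff_has_vector_derivative[symmetric])
    qed (auto intro!: continuous_intros)
    also have "\<dots> \<le> G * T" using t G by (simp add: mult_left_mono)
    finally show ?thesis using norm_triangle_ineq2[of "?c t" "?c 0"] by linarith
  qed (use G T in simp)
  then show ?thesis using that by blast
qed

theorem theorem5p2:
  fixes \<alpha> \<kappa> s T :: real
    and h :: "real \<Rightarrow> real"
    and u0 \<rho>0 :: "real \<Rightarrow> real"
    and u \<rho> :: "real \<Rightarrow> real \<Rightarrow> real"
  assumes "\<alpha> = -1" and "\<kappa> > 0"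
    and "continuous_on {0..} h"
    and "s > 5 / 2"
    and "u0 \<in> sobolev_cont s" and "\<rho>0 \<in> sobolev_cont (s - 1)"
    and "(\<forall>x. \<rho>0 x > 0) \<or> (\<forall>x. \<rho>0 x < 0)"
    and "T > 0"
    and "gHS_solution \<alpha> \<kappa> h s T u0 \<rho>0 u \<rho>"
  shows "bounded ((\<lambda>t. sobolev_pair_norm s (u t) (\<rho> t)) ` {0..<T})"
proof -
  let ?I = "{0..<T}"
  define a where "a = (\<lambda>t. gHS_mean \<alpha> \<kappa> (u t) (\<rho> t))"
  define F where "F = (\<lambda>t y. \<kappa> / 2 * (\<rho> t y)\<^sup>2 + (\<alpha> + 2) / 2 * (deriv (u t) y)\<^sup>2 + a t)"
  from assms(9) obtain u' \<rho>' where uC0: "sobolev_C0 s ?I u" and \<rho>C0: "sobolev_C0 (s - 1) ?I \<rho>"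
    and init: "\<rho> 0 = \<rho>0"
    and uC1: "sobolev_C1 (s - 1) ?I u u'" and \<rho>C1: "sobolev_C1 (s - 2) ?I \<rho> \<rho>'"
    and eq1: "\<And>t x. t \<in> {0<..<T} \<Longrightarrow> u' t x + u t x * deriv (u t) x = dx_inv (F t) x + h t"
    and eq2: "\<And>t x. t \<in> {0<..<T} \<Longrightarrow> \<rho>' t x + u t x * deriv (\<rho> t) x = \<alpha> * deriv (u t) x * \<rho> t x"
    unfolding gHS_solution_def F_def a_def by blast
  define w where "w = (\<lambda>t. deriv (u t))"
  define wt where "wt = (\<lambda>t. deriv (u' t))"
  define wx where "wx = (\<lambda>t. deriv (w t))"
  define \<rho>x where "\<rho>x = (\<lambda>t. deriv (\<rho> t))"
  have s: "3/2 < s" "3/2 < s - 1" "1/2 < s" "1/2 < s - 1" "1/2 < s - 2" using assms(4) by simp_all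
  have wC0: "sobolev_C0 (s - 1) ?I w" unfolding w_def by (rule sobolev_C0_deriv[OF s(1) uC0])
  have wxC0: "sobolev_C0 (s - 2) ?I wx" using sobolev_C0_deriv[OF s(2) wC0] by (simp add: wx_def)
  have \<rho>xC0: "sobolev_C0 (s - 2) ?I \<rho>x" using sobolev_C0_deriv[OF s(2) \<rho>C0] by (simp add: \<rho>x_def)
  have wC1: "sobolev_C1 (s - 2) ?I w wt" using sobolev_C1_deriv[OF s(2) uC1] by (simp add: w_def wt_def)
  have u'C0: "sobolev_C0 (s - 1) ?I u'" and wtC0: "sobolev_C0 (s - 2) ?I wt" and \<rho>'C0: "sobolev_C0 (s - 2) ?I \<rho>'"
    using uC1 wC1 \<rho>C1 by (auto simp: sobolev_C1_def)
  have mem: "u t \<in> sobolev_cont s" "u' t \<in> sobolev_cont (s - 1)" "w t \<in> sobolev_cont (s - 1)" "wx t \<in> sobolev_cont (s - 2)"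
    "\<rho> t \<in> sobolev_cont (s - 1)" "\<rho>x t \<in> sobolev_cont (s - 2)" if "t \<in> ?I" for t
    using that uC0 u'C0 wC0 wxC0 \<rho>C0 \<rho>xC0 by (auto simp: sobolev_C0_def)
  have c: "continuous_on UNIV (u t)" "continuous_on UNIV (w t)" "continuous_on UNIV (\<rho> t)" if "t \<in> ?I" for t
    using mem[OF that] by (auto simp: sobolev_cont_iff)
  have Fc: "continuous_on UNIV (F t)" if "t \<in> ?I" for t
    unfolding F_def by (intro continuous_intros c[OF that, unfolded w_def])
  have du: "(u t has_real_derivative w t x) (at x)" "(u' t has_real_derivative wt t x) (at x)"
    "(w t has_real_derivative wx t x) (at x)" "(\<rho> t has_real_derivative \<rho>x t x) (at x)" if "t \<in> ?I" for t x
    using sobolev_cont_deriv(1)[OF s(1) mem(1)[OF that]] sobolev_cont_deriv(1)[OF s(2) mem(2)[OF that]]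
      sobolev_cont_deriv(1)[OF s(2) mem(3)[OF that]] sobolev_cont_deriv(1)[OF s(2) mem(5)[OF that]]
    unfolding wt_def wx_def \<rho>x_def w_def by blast+
  interpret sobolev_solution T \<kappa> u w wt wx \<rho> \<rho>' \<rho>x a "s - 1"
  proof
    show "0 < T" "0 < \<kappa>" by fact+
    show "continuous_on (?I \<times> UNIV) (\<lambda>(t, x). u t x)" by (rule sobolev_C0_joint_continuous[OF s(3) uC0])
    show "continuous_on (?I \<times> UNIV) (\<lambda>(t, x). w t x)" by (rule sobolev_C0_joint_continuous[OF s(4) wC0])
    show "continuous_on (?I \<times> UNIV) (\<lambda>(t, x). wt t x)" by (rule sobolev_C0_joint_continuous[OF s(5) wtC0])
    show "continuous_on (?I \<times> UNIV) (\<lambda>(t, x). wx t x)" by (rule sobolev_C0_joint_continuous[OF s(5) wxC0])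
    show "continuous_on (?I \<times> UNIV) (\<lambda>(t, x). \<rho> t x)" by (rule sobolev_C0_joint_continuous[OF s(4) \<rho>C0])
    show "continuous_on (?I \<times> UNIV) (\<lambda>(t, x). \<rho>' t x)" by (rule sobolev_C0_joint_continuous[OF s(5) \<rho>'C0])
    show "continuous_on (?I \<times> UNIV) (\<lambda>(t, x). \<rho>x t x)" by (rule sobolev_C0_joint_continuous[OF s(5) \<rho>xC0])
    show "3/2 < s - 1" by (rule s(2))
    fix t x
    {
      assume t: "t \<in> ?I"
      show "u t (x + 1) = u t x" "w t (x + 1) = w t x" "wx t (x + 1) = wx t x" "\<rho> t (x + 1) = \<rho> t x"
        "\<rho>x t (x + 1) = \<rho>x t x" using mem[OF t] by (auto simp: sobolev_cont_iff)
      show "(u t has_real_derivative w t x) (at x)" "(w t has_real_derivative wx t x) (at x)"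
        "(\<rho> t has_real_derivative \<rho>x t x) (at x)" by (rule du[OF t])+
      show "((\<lambda>t. w t x) has_real_derivative wt t x) (at t within ?I)" by (rule sobolev_C1_pointwise[OF s(5) wC1 t])
      show "((\<lambda>t. \<rho> t x) has_real_derivative \<rho>' t x) (at t within ?I)" by (rule sobolev_C1_pointwise[OF s(5) \<rho>C1 t])
      have "(LINT x:{0..1}|lborel. (\<rho> t x)\<^sup>2) = integral {0..1} (\<lambda>x. (\<rho> t x)\<^sup>2)"
        "(LINT x:{0..1}|lborel. (w t x)\<^sup>2) = integral {0..1} (\<lambda>x. (w t x)\<^sup>2)"
        by (intro set_lebesgue_integral_unit continuous_intros c t)+
      then show "a t = - (\<kappa> / 2) * integral {0..1} (\<lambda>x. (\<rho> t x)\<^sup>2) - 1 / 2 * integral {0..1} (\<lambda>x. (w t x)\<^sup>2)"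
        unfolding a_def gHS_mean_def assms(1) by (simp add: w_def)
      show "u t \<in> sobolev_cont (s - 1 + 1)" "w t \<in> sobolev_cont (s - 1)" "\<rho> t \<in> sobolev_cont (s - 1)"
        using mem[OF t] by simp_all
    }
    assume t: "t \<in> {0<..<T}"
    then have t': "t \<in> ?I" by simp
    show "wt t x + u t x * wx t x = \<kappa> / 2 * (\<rho> t x)\<^sup>2 - (w t x)\<^sup>2 / 2 + a t"
    proof -
      \<comment> \<open>differentiate both sides of the integrated equation in \<open>x\<close>; the function \<open>h\<close> disappears\<close>
      have "((\<lambda>x. u' t x + u t x * w t x) has_real_derivative wt t x + (u t x * wx t x + w t x * w t x)) (at x)"
        by (intro DERIV_add DERIV_mult' du t')
      moreover have "(\<lambda>x. u' t x + u t x * w t x) = (\<lambda>x. dx_inv (F t) x + h t)" using eq1[OF t] by (simp add: w_def)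
      moreover have "((\<lambda>x. dx_inv (F t) x + h t) has_real_derivative F t x + 0) (at x)"
        by (intro DERIV_add dx_inv_has_derivative Fc t' DERIV_const)
      ultimately have "wt t x + (u t x * wx t x + w t x * w t x) = F t x + 0" using DERIV_unique by metis
      then show ?thesis by (simp add: F_def assms(1) w_def power2_eq_square)
    qed
    show "\<rho>' t x + u t x * \<rho>x t x = - w t x * \<rho> t x" using eq2[OF t, of x] by (simp add: assms(1) w_def \<rho>x_def)
  qed
  have nz: "\<rho> 0 x \<noteq> 0" for x using assms(7) unfolding init by (metis less_irrefl)
  obtain M where M: "0 < M" "\<And>t x. t \<in> ?I \<Longrightarrow> \<bar>w t x\<bar> \<le> M" "\<And>t x. t \<in> ?I \<Longrightarrow> \<bar>\<rho> t x\<bar> \<le> M"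
    using amplitude_bound[OF nz] by metis
  \<comment> \<open>a bound for the integrand, which enters the bound for the mean of \<open>u\<close>\<close>
  define FB where "FB = \<kappa> / 2 * M\<^sup>2 + 1 / 2 * M\<^sup>2 + \<bar>energy 0 / 2\<bar>"
  have F_le: "\<bar>F t x\<bar> \<le> FB" if t: "t \<in> ?I" for t x
  proof -
    have sq: "(\<rho> t x)\<^sup>2 \<le> M\<^sup>2" "(w t x)\<^sup>2 \<le> M\<^sup>2"
      using power_mono[OF M(2)[OF t, of x], of 2] power_mono[OF M(3)[OF t, of x], of 2] by simp_all
    have "F t x = \<kappa> / 2 * (\<rho> t x)\<^sup>2 + 1 / 2 * (w t x)\<^sup>2 + - energy 0 / 2"
      using mean_eq_energy[OF t] energy_const[OF t] by (simp add: F_def assms(1) w_def)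
    also have "\<bar>\<dots>\<bar> \<le> \<kappa> / 2 * (\<rho> t x)\<^sup>2 + 1 / 2 * (w t x)\<^sup>2 + \<bar>energy 0 / 2\<bar>"
    proof -
      have "0 \<le> \<kappa> / 2 * (\<rho> t x)\<^sup>2" "0 \<le> 1 / 2 * (w t x)\<^sup>2" using \<kappa> by simp_all
      then show ?thesis by linarith
    qed
    also have "\<dots> \<le> FB" unfolding FB_def using \<kappa> sq by (intro add_mono mult_left_mono) auto
    finally show ?thesis .
  qed
  obtain hB where hB: "\<And>t. t \<in> {0..T} \<Longrightarrow> \<bar>h t\<bar> \<le> hB"
  proof -
    have "bounded (h ` {0..T})"
      by (intro compact_imp_bounded compact_continuous_image continuous_on_subset[OF assms(3)]) auto
    then show ?thesis using that unfolding bounded_iff by force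
  qed
  have G: "\<bar>dx_inv (F t) x + h t\<bar> \<le> FB + hB" if t: "t \<in> {0<..<T}" and x: "x \<in> {0..1}" for t x
  proof -
    have t': "t \<in> ?I" using t by simp
    have FB0: "0 \<le> FB" using F_le[OF t', of x] by simp
    have "norm (dx_inv (F t) x - dx_inv (F t) 0) \<le> FB * norm (x - 0)"
      by (rule field_differentiable_bound[where S=UNIV and f'="F t"])
         (auto intro!: dx_inv_has_derivative Fc t' F_le)
    also have "\<dots> \<le> FB * 1" using x FB0 by (intro mult_left_mono) auto
    finally show ?thesis using hB[of t] t by (simp add: dx_inv_0)
  qed
  have eq1': "u' t x + u t x * w t x = dx_inv (F t) x + h t" if "t \<in> {0<..<T}" for t x
    using eq1[OF that] by (simp add: w_def)
  obtain m where m: "\<And>t. t \<in> ?I \<Longrightarrow> norm (fourier_coeff (u t) 0) \<le> m"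
    using mean_velocity_bounded[OF sobolev_C0_joint_continuous[OF s(4) u'C0] sobolev_C1_pointwise[OF s(4) uC1]
        eq1' G] by metis
  have pair_norm_sq_eq: "pair_norm_sq t = (sobolev_norm s (u t))\<^sup>2 + (sobolev_norm (s - 1) (\<rho> t))\<^sup>2" for t
    by (simp add: pair_norm_sq_def)
  have "continuous_on ?I pair_norm_sq"
    unfolding pair_norm_sq_eq[abs_def] by (intro continuous_intros sobolev_C0_norm_continuous uC0 \<rho>C0)
  then obtain B where B: "\<And>t. t \<in> ?I \<Longrightarrow> pair_norm_sq t \<le> B" using pair_norm_sq_bounded[OF nz m] by metis
  show ?thesis
    unfolding bounded_iff
  proof (intro exI[of _ "sqrt B"] ballI)
    fix y assume "y \<in> (\<lambda>t. sobolev_pair_norm s (u t) (\<rho> t)) ` ?I"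
    then obtain t where t: "t \<in> ?I" "y = sqrt (pair_norm_sq t)" by (auto simp: sobolev_pair_norm_def pair_norm_sq_eq)
    then show "norm y \<le> sqrt B" using B[OF t(1)] by (simp add: pair_norm_sq_eq)
  qed
qed

end
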